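(* Let $(E,\varphi)$ be a product system of graphs over a countable semigroup $P$ with identity $e$, and let $X(E)$ be the corresponding product system of Cuntz-Krieger bimodules. If $\psi$ is a Toeplitz representation of $X(E)$ in a $C^*$-algebra $B$, then $$\{s_\lambda:=\psi_{d(\lambda)}(\delta_\lambda):\lambda\in E^1\}$$ is a Toeplitz $E$-family in $B$. Conversely, if $\{s_\lambda:\lambda\in E^1\}$ is a Toeplitz $E$-family in $B$, then the maps $$x\in C_c(E_p^1)\mapsto\sum_{\lambda\in E_p^1}x(\lambda)s_\lambda\qquad(p\in P)$$ extend to a Toeplitz representation $\psi$ of $X(E)$ from which we can recover $s_\lambda=\psi_{d(\lambda)}(\delta_\lambda)$. The representation $\psi$ is Cuntz-Pimsner covariant if and only if $\{s_\lambda\}$ satisfies $$s_v=\sum_{\lambda\in s_p^{-1}(v)}s_\lambda s_\lambda^*\quad\text{for all }p\in P,\ v\in E^0\text{ such that }s_p^{-1}(v)\text{ is finite (possibly empty)}.$$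
   Context: **Product systems of graphs.** A (directed) graph $(E^0,E^1,r,s)$ has countable vertex set $E^0$, countable edge set $E^1$ and range and source maps $r,s:E^1\to E^0$. For graphs $E,F$ with the same vertex set $E^0$, $E\times_{E^0}F$ is the graph with vertex set $E^0$, edge set $\{(\lambda,\mu):\lambda\in E^1,\mu\in F^1,r(\lambda)=s(\mu)\}$, $s(\lambda,\mu)=s(\lambda)$, $r(\lambda,\mu)=r(\mu)$. A product system $(E,\varphi)$ of graphs over $P$ consists of graphs $E_p=(E^0,E_p^1,r_p,s_p)$, $p\in P$, with common vertex set $E^0$ and disjoint edge sets, and graph isomorphisms $\varphi_{p,q}:E_p\times_{E^0}E_q\to E_{pq}$ (identity on vertices) with $\varphi_{pq,r}(\varphi_{p,q}(\lambda,\mu),\nu)=\varphi_{p,qr}(\lambda,\varphi_{q,r}(\mu,\nu))$ whenever defined, and $E_e=(E^0,E^0,\mathrm{id},\mathrm{id})$. Put $E^1:=\bigcup_pE_p^1$ (which contains $E^0=E_e^1$), $d(\lambda)=p$ if $\lambda\in E_p^1$, let $r,s:E^1\to E^0$ be the combined range and source maps, and write $\lambda\mu:=\varphi_{p,q}(\lambda,\mu)$. **Bimodules.** For a graph $E$, the Cuntz-Krieger bimodule $X(E)$ is the set of functions $x:E^1\to\mathbb{C}$ such that $v\mapsto\sum_{r(\lambda)=v}|x(\lambda)|^2$ is finite and vanishes at infinity on $E^0$; it is a Hilbert bimodule over $C_0(E^0)$ (right Hilbert module with left action by adjointable operators) with $(x\cdot a)(\lambda)=x(\lambda)a(r(\lambda))$,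 $(a\cdot x)(\lambda)=a(s(\lambda))x(\lambda)$, $\langle x,y\rangle(v)=\sum_{r(\lambda)=v}\overline{x(\lambda)}y(\lambda)$. For a product system $(E,\varphi)$, $X(E)=\bigsqcup_pX_p$ with $X_p=X(E_p)$, $X_e=C_0(E^0)$, and multiplication $X_p\times X_q\to X_{pq}$ given by $(xy)(\lambda\mu)=x(\lambda)y(\mu)$ for $(\lambda,\mu)\in(E_p\times_{E^0}E_q)^1$. $\delta_\lambda$ denotes the point mass at $\lambda$; $C_c(E_p^1)$ (finitely supported functions) is dense in $X_p$. **Toeplitz representations.** A Toeplitz representation of a Hilbert $A$-bimodule $Y$ in $B$ is a pair $(\psi,\pi)$ with $\psi:Y\to B$ linear and $\pi:A\to B$ a homomorphism satisfying $\psi(y\cdot a)=\psi(y)\pi(a)$, $\psi(a\cdot y)=\pi(a)\psi(y)$, $\psi(x)^*\psi(y)=\pi(\langle x,y\rangle)$. There is then a unique homomorphism $\psi^{(1)}:\mathcal{K}(Y)\to B$ with $\psi^{(1)}(\Theta_{x,y})=\psi(x)\psi(y)^*$, where $\Theta_{x,y}(z)=x\cdot\langle y,z\rangle$. With $\phi:A\to\mathcal{L}(Y)$ the left action, $(\psi,\pi)$ is Cuntz-Pimsner covariant if $\psi^{(1)}(\phi(a))=\pi(a)$ whenever $\phi(a)\in\mathcal{K}(Y)$. A Toeplitz representation $\psi$ of $X(E)$ in $B$ consists of linear maps $\psi_p:X_p\to B$ such that each $(\psi_p,\psi_e)$ is a Toeplitz representation of $X_p$ and $\psi_p(x)\psi_q(y)=\psi_{pq}(xy)$;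 it is Cuntz-Pimsner covariant if each $(\psi_p,\psi_e)$ is. **Toeplitz $E$-families.** Partial isometries $\{s_\lambda:\lambda\in E^1\}$ in $B$ form a Toeplitz $E$-family if: (1) $\{s_v:v\in E^0\}$ are mutually orthogonal projections; (2) $s_\lambda s_\mu=s_{\lambda\mu}$ whenever $r(\lambda)=s(\mu)$; (3) $s_\lambda^*s_\lambda=s_{r(\lambda)}$ for all $\lambda\in E^1$; (4) for all $p\in P\setminus\{e\}$, $v\in E^0$ and finite $F\subset s_p^{-1}(v)$, $s_v\ge\sum_{\lambda\in F}s_\lambda s_\lambda^*$. *)

theory Defs
  imports
    "HOL-Analysis.Analysis"
    "HOL-Library.FuncSet"
    "Graph_Theory.Digraph"
begin

section \<open>C*-algebras\<close>

text \<open>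
  Complex C*-algebras, not assumed unital or non-zero. The distribution has no class of
  complex normed spaces, so complex scaling is added on top of the real Banach algebra
  structure; it extends the given real scaling.
\<close>

class cstar_algebra = real_normed_algebra + banach +
  fixes cscale :: "complex \<Rightarrow> 'a \<Rightarrow> 'a"  (infixr \<open>*\<^sub>C\<close> 75)
    and cstar :: "'a \<Rightarrow> 'a"  (\<open>_\<^sup>\<star>\<close> [1000] 999)
  assumes cscale_add_right: "c *\<^sub>C (x + y) = c *\<^sub>C x + c *\<^sub>C y"
    and cscale_add_left: "(c + d) *\<^sub>C x = c *\<^sub>C x + d *\<^sub>C x"
    and cscale_cscale: "c *\<^sub>C d *\<^sub>C x = (c * d) *\<^sub>C x"
    and cscale_of_real: "complex_of_real t *\<^sub>C x = t *\<^sub>R x"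
    and norm_cscale: "norm (c *\<^sub>C x) = cmod c * norm x"
    and cscale_mult_left: "(c *\<^sub>C x) * y = c *\<^sub>C (x * y)"
    and cscale_mult_right: "x * (c *\<^sub>C y) = c *\<^sub>C (x * y)"
    and cstar_cstar: "(x\<^sup>\<star>)\<^sup>\<star> = x"
    and cstar_add: "(x + y)\<^sup>\<star> = x\<^sup>\<star> + y\<^sup>\<star>"
    and cstar_cscale: "(c *\<^sub>C x)\<^sup>\<star> = cnj c *\<^sub>C x\<^sup>\<star>"
    and cstar_mult: "(x * y)\<^sup>\<star> = y\<^sup>\<star> * x\<^sup>\<star>"
    and cstar_identity: "norm (x\<^sup>\<star> * x) = (norm x)\<^sup>2"

definition projection :: "'b::cstar_algebra \<Rightarrow> bool" where
  "projection p \<longleftrightarrow> p\<^sup>\<star> = p \<and> p * p = p"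

definition partial_isometry :: "'b::cstar_algebra \<Rightarrow> bool" where
  "partial_isometry s \<longleftrightarrow> s * s\<^sup>\<star> * s = s"

definition cstar_le :: "'b::cstar_algebra \<Rightarrow> 'b \<Rightarrow> bool"  (infix \<open>\<le>\<^sub>C\<close> 50) where
  "a \<le>\<^sub>C b \<longleftrightarrow> (\<exists>c. b - a = c\<^sup>\<star> * c)"


section \<open>Product systems of graphs\<close>

text \<open>
  The source and range maps of a graph are \<open>tail\<close> and \<open>head\<close>. A path \<open>l\<close> followed by \<open>m\<close> is
  composable when the range of \<open>l\<close> is the source of \<open>m\<close>.
\<close>

definition countable_graph :: "('v,'a) pre_digraph \<Rightarrow> bool" where
  "countable_graph G \<longleftrightarrow> wf_digraph G \<and> countable (verts G) \<and> countable (arcs G)"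

definition fibre_product ::
  "('v,'a) pre_digraph \<Rightarrow> ('v,'b) pre_digraph \<Rightarrow> ('v, 'a \<times> 'b) pre_digraph"
  (infixl \<open>\<times>\<^sub>G\<close> 70) where
  "F \<times>\<^sub>G G = \<lparr> verts = verts F,
     arcs = {(l, m). l \<in> arcs F \<and> m \<in> arcs G \<and> head F l = tail G m},
     tail = (\<lambda>(l, m). tail F l), head = (\<lambda>(l, m). head G m) \<rparr>"

definition vertex_fixing_iso ::
  "('v,'a) pre_digraph \<Rightarrow> ('v,'b) pre_digraph \<Rightarrow> ('a \<Rightarrow> 'b) \<Rightarrow> bool" where
  "vertex_fixing_iso F G f \<longleftrightarrow> verts F = verts G \<and> bij_betw f (arcs F) (arcs G) \<and>
     (\<forall>l\<in>arcs F. tail G (f l) = tail F l \<and> head G (f l) = head F l)"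

text \<open>
  Vertices and edges share one type, since the vertex set \<open>V\<close> is itself the edge set of the
  graph at the identity of the monoid.
\<close>

locale product_system =
  fixes V :: "'a set"
    and E :: "'p::{monoid_mult,countable} \<Rightarrow> ('a,'a) pre_digraph"
    and \<phi> :: "'p \<Rightarrow> 'p \<Rightarrow> 'a \<times> 'a \<Rightarrow> 'a"
  assumes graphs: "\<And>p. countable_graph (E p)"
    and common_verts: "\<And>p. verts (E p) = V"
    and disjoint_arcs: "\<And>p q. p \<noteq> q \<Longrightarrow> arcs (E p) \<inter> arcs (E q) = {}"
    and isos: "\<And>p q. vertex_fixing_iso (E p \<times>\<^sub>G E q) (E (p * q)) (\<phi> p q)"
    and assoc: "\<And>p q r l m n. \<lbrakk>(l, m) \<in> arcs (E p \<times>\<^sub>G E q); (m, n) \<in> arcs (E q \<times>\<^sub>G E r)\<rbrakk> \<Longrightarrow>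
           \<phi> (p * q) r (\<phi> p q (l, m), n) = \<phi> p (q * r) (l, \<phi> q r (m, n))"
    and identity_arcs: "arcs (E 1) = V"
    and identity_ends: "\<And>v. v \<in> V \<Longrightarrow> tail (E 1) v = v \<and> head (E 1) v = v"

definition all_arcs :: "('p \<Rightarrow> ('a,'a) pre_digraph) \<Rightarrow> 'a set" where
  "all_arcs E = (\<Union>p. arcs (E p))"

definition degree_of :: "('p \<Rightarrow> ('a,'a) pre_digraph) \<Rightarrow> 'a \<Rightarrow> 'p" where
  "degree_of E l = (THE p. l \<in> arcs (E p))"

definition src :: "('p \<Rightarrow> ('a,'a) pre_digraph) \<Rightarrow> 'a \<Rightarrow> 'a" where
  "src E l = tail (E (degree_of E l)) l"

definition rng :: "('p \<Rightarrow> ('a,'a) pre_digraph) \<Rightarrow> 'a \<Rightarrow> 'a" where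
  "rng E l = head (E (degree_of E l)) l"

definition path_comp ::
  "('p \<Rightarrow> ('a,'a) pre_digraph) \<Rightarrow> ('p \<Rightarrow> 'p \<Rightarrow> 'a \<times> 'a \<Rightarrow> 'a) \<Rightarrow> 'a \<Rightarrow> 'a \<Rightarrow> 'a" where
  "path_comp E \<phi> l m = \<phi> (degree_of E l) (degree_of E m) (l, m)"

definition out_arcs_at :: "('v,'a) pre_digraph \<Rightarrow> 'v \<Rightarrow> 'a set" where
  "out_arcs_at G v = {l \<in> arcs G. tail G l = v}"


section \<open>Cuntz-Krieger bimodules\<close>

text \<open>
  Functions on a set of vertices or edges are total functions vanishing outside that set.
\<close>

definition vanishes_at_infinity :: "'v set \<Rightarrow> ('v \<Rightarrow> complex) \<Rightarrow> bool" where
  "vanishes_at_infinity V a \<longleftrightarrow> (\<forall>\<epsilon>>0. finite {v \<in> V. cmod (a v) \<ge> \<epsilon>})"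

definition C0 :: "'v set \<Rightarrow> ('v \<Rightarrow> complex) set" where
  "C0 V = {a. (\<forall>v. v \<notin> V \<longrightarrow> a v = 0) \<and> vanishes_at_infinity V a}"

definition inner_prod ::
  "('v,'a) pre_digraph \<Rightarrow> ('a \<Rightarrow> complex) \<Rightarrow> ('a \<Rightarrow> complex) \<Rightarrow> 'v \<Rightarrow> complex" where
  "inner_prod G x y v = (\<Sum>\<^sub>\<infinity>l\<in>{l \<in> arcs G. head G l = v}. cnj (x l) * y l)"

definition bimod :: "('v,'a) pre_digraph \<Rightarrow> ('a \<Rightarrow> complex) set" where
  "bimod G = {x. (\<forall>l. l \<notin> arcs G \<longrightarrow> x l = 0) \<and>
     (\<forall>v\<in>verts G. (\<lambda>l. (cmod (x l))\<^sup>2) summable_on {l \<in> arcs G. head G l = v}) \<and>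
     vanishes_at_infinity (verts G)
       (\<lambda>v. complex_of_real (\<Sum>\<^sub>\<infinity>l\<in>{l \<in> arcs G. head G l = v}. (cmod (x l))\<^sup>2))}"

definition right_act ::
  "('v,'a) pre_digraph \<Rightarrow> ('a \<Rightarrow> complex) \<Rightarrow> ('v \<Rightarrow> complex) \<Rightarrow> 'a \<Rightarrow> complex" where
  "right_act G x a l = x l * a (head G l)"

definition left_act ::
  "('v,'a) pre_digraph \<Rightarrow> ('v \<Rightarrow> complex) \<Rightarrow> ('a \<Rightarrow> complex) \<Rightarrow> 'a \<Rightarrow> complex" where
  "left_act G a x l = a (tail G l) * x l"

text \<open>
  The Hilbert module norm, the square root of the supremum norm of \<open>\<langle>x, x\<rangle>\<close>. The supremum
  may run over the whole type because \<open>\<langle>x, x\<rangle>\<close> is \<open>0\<close> off the vertex set.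
\<close>

definition bimod_norm :: "('v,'a) pre_digraph \<Rightarrow> ('a \<Rightarrow> complex) \<Rightarrow> real" where
  "bimod_norm G x = sqrt (SUP v. cmod (inner_prod G x x v))"

definition fin_supp :: "('v,'a) pre_digraph \<Rightarrow> ('a \<Rightarrow> complex) set" where
  "fin_supp G = {x. (\<forall>l. l \<notin> arcs G \<longrightarrow> x l = 0) \<and> finite {l. x l \<noteq> 0}}"

definition point_mass :: "'a \<Rightarrow> 'a \<Rightarrow> complex"  (\<open>\<delta>\<close>) where
  "\<delta> l = (\<lambda>m. if m = l then 1 else 0)"

text \<open>The product \<open>x y\<close> in \<open>X\<^bsub>p q\<^esub>\<close> of \<open>x\<close> in \<open>X\<^bsub>p\<^esub>\<close> and \<open>y\<close> in \<open>X\<^bsub>q\<^esub>\<close>.\<close>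

definition bimod_mult ::
  "('p::monoid_mult \<Rightarrow> ('a,'a) pre_digraph) \<Rightarrow> ('p \<Rightarrow> 'p \<Rightarrow> 'a \<times> 'a \<Rightarrow> 'a) \<Rightarrow> 'p \<Rightarrow> 'p \<Rightarrow>
    ('a \<Rightarrow> complex) \<Rightarrow> ('a \<Rightarrow> complex) \<Rightarrow> 'a \<Rightarrow> complex" where
  "bimod_mult E \<phi> p q x y n =
     (if n \<in> arcs (E (p * q))
      then (case the_inv_into (arcs (E p \<times>\<^sub>G E q)) (\<phi> p q) n of (l, m) \<Rightarrow> x l * y m)
      else 0)"


section \<open>Adjointable and compact operators\<close>

text \<open>
  Operators on \<open>X(G)\<close> are extensional functions on \<open>bimod G\<close>, so that equality of operators is
  equality of functions.
\<close>

definition is_adjoint ::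
  "('v,'a) pre_digraph \<Rightarrow> (('a \<Rightarrow> complex) \<Rightarrow> ('a \<Rightarrow> complex)) \<Rightarrow>
    (('a \<Rightarrow> complex) \<Rightarrow> ('a \<Rightarrow> complex)) \<Rightarrow> bool" where
  "is_adjoint G T S \<longleftrightarrow>
     (\<forall>x\<in>bimod G. \<forall>y\<in>bimod G. inner_prod G (T x) y = inner_prod G x (S y))"

definition adjointables ::
  "('v,'a) pre_digraph \<Rightarrow> (('a \<Rightarrow> complex) \<Rightarrow> ('a \<Rightarrow> complex)) set" where
  "adjointables G =
     {T \<in> bimod G \<rightarrow>\<^sub>E bimod G. \<exists>S \<in> bimod G \<rightarrow>\<^sub>E bimod G. is_adjoint G T S}"

definition op_add ::
  "('v,'a) pre_digraph \<Rightarrow> (('a \<Rightarrow> complex) \<Rightarrow> ('a \<Rightarrow> complex)) \<Rightarrow>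
    (('a \<Rightarrow> complex) \<Rightarrow> ('a \<Rightarrow> complex)) \<Rightarrow> ('a \<Rightarrow> complex) \<Rightarrow> ('a \<Rightarrow> complex)" where
  "op_add G T S = (\<lambda>x\<in>bimod G. \<lambda>l. T x l + S x l)"

definition op_scale ::
  "('v,'a) pre_digraph \<Rightarrow> complex \<Rightarrow>
    (('a \<Rightarrow> complex) \<Rightarrow> ('a \<Rightarrow> complex)) \<Rightarrow> ('a \<Rightarrow> complex) \<Rightarrow> ('a \<Rightarrow> complex)" where
  "op_scale G c T = (\<lambda>x\<in>bimod G. \<lambda>l. c * T x l)"

definition Theta ::
  "('v,'a) pre_digraph \<Rightarrow> ('a \<Rightarrow> complex) \<Rightarrow> ('a \<Rightarrow> complex) \<Rightarrow>
    ('a \<Rightarrow> complex) \<Rightarrow> ('a \<Rightarrow> complex)" where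
  "Theta G x y = (\<lambda>z\<in>bimod G. right_act G x (inner_prod G y z))"

definition left_op ::
  "('v,'a) pre_digraph \<Rightarrow> ('v \<Rightarrow> complex) \<Rightarrow> ('a \<Rightarrow> complex) \<Rightarrow> ('a \<Rightarrow> complex)" where
  "left_op G a = (\<lambda>x\<in>bimod G. left_act G a x)"

text \<open>
  The closed linear span in operator norm of the \<open>Theta G x y\<close>. Scalars are unnecessary in the
  finite sums as they can be absorbed into \<open>xs i\<close>.
\<close>

definition compacts ::
  "('v,'a) pre_digraph \<Rightarrow> (('a \<Rightarrow> complex) \<Rightarrow> ('a \<Rightarrow> complex)) set" where
  "compacts G = {T \<in> adjointables G. \<forall>\<epsilon>>0. \<exists>(n::nat) xs ys.
     (\<forall>i<n. xs i \<in> bimod G \<and> ys i \<in> bimod G) \<and>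
     (\<forall>z\<in>bimod G. bimod_norm G (\<lambda>l. T z l - (\<Sum>i<n. Theta G (xs i) (ys i) z l))
        \<le> \<epsilon> * bimod_norm G z)}"


section \<open>Toeplitz representations\<close>

definition linear_on_functions ::
  "('a \<Rightarrow> complex) set \<Rightarrow> (('a \<Rightarrow> complex) \<Rightarrow> 'b::cstar_algebra) \<Rightarrow> bool" where
  "linear_on_functions X \<psi> \<longleftrightarrow>
     (\<forall>x\<in>X. \<forall>y\<in>X. \<psi> (\<lambda>l. x l + y l) = \<psi> x + \<psi> y) \<and>
     (\<forall>c. \<forall>x\<in>X. \<psi> (\<lambda>l. c * x l) = c *\<^sub>C \<psi> x)"

definition C0_hom :: "'v set \<Rightarrow> (('v \<Rightarrow> complex) \<Rightarrow> 'b::cstar_algebra) \<Rightarrow> bool" where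
  "C0_hom V \<pi> \<longleftrightarrow> linear_on_functions (C0 V) \<pi> \<and>
     (\<forall>a\<in>C0 V. \<forall>b\<in>C0 V. \<pi> (\<lambda>v. a v * b v) = \<pi> a * \<pi> b) \<and>
     (\<forall>a\<in>C0 V. \<pi> (\<lambda>v. cnj (a v)) = (\<pi> a)\<^sup>\<star>)"

definition toeplitz_bimod_rep ::
  "('v,'a) pre_digraph \<Rightarrow> (('a \<Rightarrow> complex) \<Rightarrow> 'b::cstar_algebra) \<Rightarrow>
    (('v \<Rightarrow> complex) \<Rightarrow> 'b) \<Rightarrow> bool" where
  "toeplitz_bimod_rep G \<psi> \<pi> \<longleftrightarrow>
     linear_on_functions (bimod G) \<psi> \<and> C0_hom (verts G) \<pi> \<and>
     (\<forall>y\<in>bimod G. \<forall>a\<in>C0 (verts G). \<psi> (right_act G y a) = \<psi> y * \<pi> a) \<and>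
     (\<forall>y\<in>bimod G. \<forall>a\<in>C0 (verts G). \<psi> (left_act G a y) = \<pi> a * \<psi> y) \<and>
     (\<forall>x\<in>bimod G. \<forall>y\<in>bimod G. (\<psi> x)\<^sup>\<star> * \<psi> y = \<pi> (inner_prod G x y))"

definition compacts_hom ::
  "('v,'a) pre_digraph \<Rightarrow> ((('a \<Rightarrow> complex) \<Rightarrow> ('a \<Rightarrow> complex)) \<Rightarrow> 'b::cstar_algebra) \<Rightarrow> bool" where
  "compacts_hom G \<rho> \<longleftrightarrow>
     (\<forall>T\<in>compacts G. \<forall>S\<in>compacts G. \<rho> (op_add G T S) = \<rho> T + \<rho> S) \<and>
     (\<forall>c. \<forall>T\<in>compacts G. \<rho> (op_scale G c T) = c *\<^sub>C \<rho> T) \<and>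
     (\<forall>T\<in>compacts G. \<forall>S\<in>compacts G. \<rho> (compose (bimod G) T S) = \<rho> T * \<rho> S) \<and>
     (\<forall>T\<in>compacts G. \<forall>S\<in>compacts G. is_adjoint G T S \<longrightarrow> \<rho> S = (\<rho> T)\<^sup>\<star>)"

text \<open>
  The homomorphism \<open>\<psi>\<^sup>(\<^sup>1\<^sup>)\<close> induced by a Toeplitz representation on the compact operators is
  specified by its characterizing property; for a Toeplitz representation exactly one such
  homomorphism exists, up to irrelevant values off \<open>compacts G\<close>.
\<close>

definition induced_hom ::
  "('v,'a) pre_digraph \<Rightarrow> (('a \<Rightarrow> complex) \<Rightarrow> 'b::cstar_algebra) \<Rightarrow>
    ((('a \<Rightarrow> complex) \<Rightarrow> ('a \<Rightarrow> complex)) \<Rightarrow> 'b) \<Rightarrow> bool" where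
  "induced_hom G \<psi> \<rho> \<longleftrightarrow> compacts_hom G \<rho> \<and>
     (\<forall>x\<in>bimod G. \<forall>y\<in>bimod G. \<rho> (Theta G x y) = \<psi> x * (\<psi> y)\<^sup>\<star>)"

definition cp_covariant_bimod ::
  "('v,'a) pre_digraph \<Rightarrow> (('a \<Rightarrow> complex) \<Rightarrow> 'b::cstar_algebra) \<Rightarrow>
    (('v \<Rightarrow> complex) \<Rightarrow> 'b) \<Rightarrow> bool" where
  "cp_covariant_bimod G \<psi> \<pi> \<longleftrightarrow>
     (\<exists>\<rho>. induced_hom G \<psi> \<rho> \<and>
          (\<forall>a\<in>C0 (verts G). left_op G a \<in> compacts G \<longrightarrow> \<rho> (left_op G a) = \<pi> a))"

text \<open>
  The algebra \<open>C0 V\<close> and the bimodule \<open>bimod (E 1)\<close> are the same set of functions, so \<open>\<psi> 1\<close>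
  serves as the homomorphism \<open>\<pi>\<close> for every fibre.
\<close>

definition toeplitz_rep ::
  "('p::monoid_mult \<Rightarrow> ('a,'a) pre_digraph) \<Rightarrow> ('p \<Rightarrow> 'p \<Rightarrow> 'a \<times> 'a \<Rightarrow> 'a) \<Rightarrow>
    ('p \<Rightarrow> ('a \<Rightarrow> complex) \<Rightarrow> 'b::cstar_algebra) \<Rightarrow> bool" where
  "toeplitz_rep E \<phi> \<psi> \<longleftrightarrow>
     (\<forall>p. toeplitz_bimod_rep (E p) (\<psi> p) (\<psi> 1)) \<and>
     (\<forall>p q. \<forall>x\<in>bimod (E p). \<forall>y\<in>bimod (E q).
        \<psi> p x * \<psi> q y = \<psi> (p * q) (bimod_mult E \<phi> p q x y))"

definition cp_covariant ::
  "('p::monoid_mult \<Rightarrow> ('a,'a) pre_digraph) \<Rightarrow>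
    ('p \<Rightarrow> ('a \<Rightarrow> complex) \<Rightarrow> 'b::cstar_algebra) \<Rightarrow> bool" where
  "cp_covariant E \<psi> \<longleftrightarrow> (\<forall>p. cp_covariant_bimod (E p) (\<psi> p) (\<psi> 1))"


section \<open>Toeplitz families\<close>

definition toeplitz_family ::
  "'a set \<Rightarrow> ('p::monoid_mult \<Rightarrow> ('a,'a) pre_digraph) \<Rightarrow> ('p \<Rightarrow> 'p \<Rightarrow> 'a \<times> 'a \<Rightarrow> 'a) \<Rightarrow>
    ('a \<Rightarrow> 'b::cstar_algebra) \<Rightarrow> bool" where
  "toeplitz_family V E \<phi> s \<longleftrightarrow>
     (\<forall>l\<in>all_arcs E. partial_isometry (s l)) \<and>
     (\<forall>v\<in>V. projection (s v)) \<and>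
     (\<forall>v\<in>V. \<forall>w\<in>V. v \<noteq> w \<longrightarrow> s v * s w = 0) \<and>
     (\<forall>l\<in>all_arcs E. \<forall>m\<in>all_arcs E. rng E l = src E m \<longrightarrow> s l * s m = s (path_comp E \<phi> l m)) \<and>
     (\<forall>l\<in>all_arcs E. (s l)\<^sup>\<star> * s l = s (rng E l)) \<and>
     (\<forall>p. p \<noteq> 1 \<longrightarrow> (\<forall>v\<in>V. \<forall>F. finite F \<and> F \<subseteq> out_arcs_at (E p) v \<longrightarrow>
        (\<Sum>l\<in>F. s l * (s l)\<^sup>\<star>) \<le>\<^sub>C s v))"

definition cuntz_pimsner_relations ::
  "'a set \<Rightarrow> ('p \<Rightarrow> ('a,'a) pre_digraph) \<Rightarrow> ('a \<Rightarrow> 'b::cstar_algebra) \<Rightarrow> bool" where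
  "cuntz_pimsner_relations V E s \<longleftrightarrow>
     (\<forall>p. \<forall>v\<in>V. finite (out_arcs_at (E p) v) \<longrightarrow>
        s v = (\<Sum>l\<in>out_arcs_at (E p) v. s l * (s l)\<^sup>\<star>))"

definition family_of ::
  "('p \<Rightarrow> ('a,'a) pre_digraph) \<Rightarrow> ('p \<Rightarrow> ('a \<Rightarrow> complex) \<Rightarrow> 'b) \<Rightarrow> 'a \<Rightarrow> 'b" where
  "family_of E \<psi> l = \<psi> (degree_of E l) (\<delta> l)"

end

theory Submission
  imports Defs
begin

text \<open>
  A Toeplitz representation is determined by its values on point masses, and its relations on point
  masses are those of a Toeplitz family. Conversely, condition (4) makes the range projections of
  distinct edges of the same degree orthogonal, because two projections whose sum is dominated by a
  projection are orthogonal; here order is \<open>r - p - q = c\<^sup>* c\<close>, so this needs that the cone of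
  elements \<open>c\<^sup>* c\<close> is salient. Then \<open>\<parallel>\<Sum> x(\<lambda>) s\<^sub>\<lambda>\<parallel>\<close> is bounded by the norm of \<open>x\<close> in the bimodule, and the series
  converges unconditionally on all of the bimodule. Finally, \<open>a\<close> acts compactly on \<open>X\<^sub>p\<close> only if it is
  supported on vertices emitting finitely many edges of degree \<open>p\<close>, so covariance can be tested on
  point masses at such vertices.
\<close>

section \<open>C*-algebras\<close>

text \<open>The norm bounds rest on two devices that stand in for spectral theory. One is a square
  root: for self-adjoint \<open>u\<close> with \<open>norm u < 1\<close> a fixed point supplies the
  element needed to complete \<open>u\<close> to a unitary. The other is squaring: the norm of the
  square of a self-adjoint element is the square of its norm, so a bound with a bad constant that is
  uniform over all powers improves to the constant 1.

  The order is the delicate point. \<open>a \<le>\<^sub>C b\<close> provides one factorization of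
  \<open>b - a\<close>, and it is not known beforehand that sums of such elements factor again;
  estimates for sums of squares of self-adjoint elements are used in place of a positive cone.

  Covariance speaks of a homomorphism on all compact operators. Its existence rests on the fact that
  a finite rank operator of norm at most \<open>\<epsilon>\<close> has an image of norm at most
  \<open>\<epsilon>\<close>, which is where squaring enters again.\<close>

lemma cscale_one [simp]: "1 *\<^sub>C x = (x::'b::cstar_algebra)"
  using cscale_of_real[of 1 x] by simp

lemma cscale_zero_left [simp]: "0 *\<^sub>C x = (0::'b::cstar_algebra)"
  using cscale_of_real[of 0 x] by simp

lemma bounded_linear_cscale: "bounded_linear ((*\<^sub>C) c :: 'b::cstar_algebra \<Rightarrow> 'b)"
proof (rule bounded_linear_intro[where K = "cmod c"])
  show "c *\<^sub>C (t *\<^sub>R x) = t *\<^sub>R (c *\<^sub>C x)" for t and x :: 'b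
    by (metis cscale_cscale cscale_of_real mult.commute)
qed (auto simp: cscale_add_right norm_cscale mult.commute)

lemma bounded_linear_cscale_left: "bounded_linear (\<lambda>c. c *\<^sub>C (x :: 'b::cstar_algebra))"
proof (rule bounded_linear_intro[where K = "norm x"])
  show "(t *\<^sub>R c) *\<^sub>C x = t *\<^sub>R (c *\<^sub>C x)" for t c
    by (metis cscale_cscale cscale_of_real scaleR_conv_of_real)
qed (auto simp: cscale_add_left norm_cscale)

lemmas cscale_zero_right [simp] = linear_0[OF bounded_linear.linear[OF bounded_linear_cscale]]
  and cscale_minus_right = linear_neg[OF bounded_linear.linear[OF bounded_linear_cscale]]
  and cscale_diff_right = linear_diff[OF bounded_linear.linear[OF bounded_linear_cscale]]
  and cscale_sum_right = linear_sum[OF bounded_linear.linear[OF bounded_linear_cscale]]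
  and cscale_sum_left = linear_sum[OF bounded_linear.linear[OF bounded_linear_cscale_left]]
  and cscale_minus_left = linear_neg[OF bounded_linear.linear[OF bounded_linear_cscale_left]]

lemma norm_cstar [simp]: "norm (x\<^sup>\<star>) = norm (x::'b::cstar_algebra)"
proof -
  have "norm y \<le> norm (y\<^sup>\<star>)" for y :: 'b
  proof (cases "y = 0")
    case False
    have "norm y * norm y \<le> norm (y\<^sup>\<star>) * norm y"
      using cstar_identity[of y] norm_mult_ineq[of "y\<^sup>\<star>" y] by (simp add: power2_eq_square)
    with False show ?thesis by simp
  qed simp
  from this[of x] this[of "x\<^sup>\<star>"] show ?thesis by (simp add: cstar_cstar)
qed

lemma cstar_scaleR: "(t *\<^sub>R x)\<^sup>\<star> = t *\<^sub>R (x::'b::cstar_algebra)\<^sup>\<star>"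
  by (metis complex_cnj_complex_of_real cscale_of_real cstar_cscale)

lemma bounded_linear_cstar: "bounded_linear (cstar :: 'b::cstar_algebra \<Rightarrow> 'b)"
  by (rule bounded_linear_intro[where K = 1]) (auto simp: cstar_add cstar_scaleR)

lemmas cstar_zero [simp] = linear_0[OF bounded_linear.linear[OF bounded_linear_cstar]]
  and cstar_diff = linear_diff[OF bounded_linear.linear[OF bounded_linear_cstar]]
  and cstar_sum = linear_sum[OF bounded_linear.linear[OF bounded_linear_cstar]]

lemma cstar_mult_self_eq_0: "x\<^sup>\<star> * x = 0 \<longleftrightarrow> (x::'b::cstar_algebra) = 0"
  using cstar_identity[of x] by auto

section \<open>Contractions built from unitaries, without functional calculus\<close>

lemma norm_self_adjoint_square:
  "x\<^sup>\<star> = x \<Longrightarrow> norm (x * x) = (norm (x::'b::cstar_algebra))\<^sup>2"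
  using cstar_identity[of x] by simp

lemma norm_eq_if_cstar_mult_eq:
  "x\<^sup>\<star> * x = y\<^sup>\<star> * y \<Longrightarrow> norm (x::'b::cstar_algebra) = norm y"
  by (metis cstar_identity norm_ge_zero power2_eq_iff_nonneg)

text \<open>
  If \<open>b\<close> plays the role of \<open>1 - sqrt (1 - u\<^sup>2)\<close>, then \<open>1 - b \<plusminus> \<i> u\<close> are unitaries of the
  unitization; there is no unit in the type, so they appear as multiplication operators.
\<close>

lemma norm_unitary_mult:
  fixes b u z :: "'b::cstar_algebra"
  assumes "b\<^sup>\<star> = b" "u\<^sup>\<star> = u" "b * u = u * b" "b + b - b * b = u * u"
  shows "norm (z - b * z + \<i> *\<^sub>C (u * z)) = norm z"
    and "norm (z - b * z - \<i> *\<^sub>C (u * z)) = norm z"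
proof -
  have key: "z\<^sup>\<star> * (b * z) + z\<^sup>\<star> * (b * z) - z\<^sup>\<star> * (b * (b * z)) = z\<^sup>\<star> * (u * (u * z))"
    using arg_cong[OF assms(4), of "\<lambda>x. z\<^sup>\<star> * x * z"] by (simp add: algebra_simps)
  have comm: "b * (u * z) = u * (b * z)"
    by (metis assms(3) mult.assoc)
  show "norm (z - b * z + \<i> *\<^sub>C (u * z)) = norm z"
    by (rule norm_eq_if_cstar_mult_eq)
      (use key comm in \<open>simp add: cstar_add cstar_diff cstar_mult cstar_cscale assms algebra_simps
        cscale_add_right cscale_diff_right
        cscale_mult_left cscale_mult_right cscale_cscale cscale_minus_left\<close>)
  show "norm (z - b * z - \<i> *\<^sub>C (u * z)) = norm z"
    by (rule norm_eq_if_cstar_mult_eq)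
      (use key comm in \<open>simp add: cstar_add cstar_diff cstar_mult cstar_cscale assms algebra_simps
        cscale_add_right cscale_diff_right
        cscale_mult_left cscale_mult_right cscale_cscale cscale_minus_left\<close>)
qed

text \<open>Half the difference of the two unitaries is \<open>\<i> u\<close>, so left
  multiplication by \<open>u\<close> is, up to a phase, an average of isometries.\<close>

lemma norm_mult_le_of_unitary:
  fixes b u z :: "'b::cstar_algebra"
  assumes "b\<^sup>\<star> = b" "u\<^sup>\<star> = u" "b * u = u * b" "b + b - b * b = u * u"
  shows "norm (u * z) \<le> norm z"
proof -
  let ?x = "z - b * z + \<i> *\<^sub>C (u * z)" and ?y = "z - b * z - \<i> *\<^sub>C (u * z)"
  have "2 * norm (u * z) = norm (?x - ?y)"
    by (simp add: norm_cscale flip: scaleR_2)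
  also have "\<dots> \<le> 2 * norm z"
    using norm_triangle_ineq4[of ?x ?y] norm_unitary_mult[OF assms, of z] by simp
  finally show ?thesis by simp
qed

text \<open>Squaring the two unitaries and averaging gives
  \<open>(1 - b)\<^sup>2 - u\<^sup>2\<close>, which the relation between \<open>b\<close> and
  \<open>u\<close> turns into \<open>1 - 2 u\<^sup>2\<close>.\<close>

lemma norm_diff_double_square_le:
  fixes b u z :: "'b::cstar_algebra"
  assumes "b\<^sup>\<star> = b" "u\<^sup>\<star> = u" "b * u = u * b" "b + b - b * b = u * u"
  shows "norm (z - 2 *\<^sub>R (u * u * z)) \<le> norm z"
proof -
  let ?x = "z - b * z + \<i> *\<^sub>C (u * z)" and ?y = "z - b * z - \<i> *\<^sub>C (u * z)"
  let ?xx = "?x - b * ?x + \<i> *\<^sub>C (u * ?x)" and ?yy = "?y - b * ?y - \<i> *\<^sub>C (u * ?y)"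
  have key: "b * z + b * z - b * (b * z) = u * (u * z)"
    using arg_cong[OF assms(4), of "\<lambda>x. x * z"] by (simp add: algebra_simps)
  have comm: "b * (u * z) = u * (b * z)"
    by (metis assms(3) mult.assoc)
  have "?xx + ?yy = 2 *\<^sub>R (z - 2 *\<^sub>R (u * u * z))"
    using key comm by (simp add: algebra_simps cscale_add_right cscale_diff_right cscale_mult_left
        cscale_mult_right cscale_cscale cscale_minus_left scaleR_2)
  then have "2 * norm (z - 2 *\<^sub>R (u * u * z)) = norm (?xx + ?yy)"
    by simp
  also have "\<dots> \<le> 2 * norm z"
    using norm_triangle_ineq[of ?xx ?yy] norm_unitary_mult[OF assms, of z]
      norm_unitary_mult(1)[OF assms, of ?x] norm_unitary_mult(2)[OF assms, of ?y] by simp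
  finally show ?thesis by simp
qed

text \<open>The equation for \<open>b\<close> is the fixed point equation of
  \<open>b \<mapsto> (u * u + b * b) / 2\<close>. On the ball of radius \<open>norm u\<close> this
  map contracts by the factor \<open>norm u < 1\<close>; self-adjointness and commutation with
  \<open>u\<close> are closed conditions that it preserves, so the fixed point has them.\<close>

lemma sqrt_complement_exists:
  fixes u :: "'b::cstar_algebra"
  assumes u: "u\<^sup>\<star> = u" "norm u < 1"
  obtains b where "b\<^sup>\<star> = b" "b * u = u * b" "b + b - b * b = u * u"
proof -
  define S where "S = {b. b\<^sup>\<star> = b \<and> b * u = u * b \<and> norm b \<le> norm u}"
  define f where "f = (\<lambda>b. (1/2::real) *\<^sub>R (u * u + b * b))"
  have "closed S"
    unfolding S_def
    by (intro closed_Collect_conj closed_Collect_eq closed_Collect_le continuous_intros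
        linear_continuous_on bounded_linear_cstar)
  then have "complete S"
    by (simp add: complete_eq_closed)
  moreover have "S \<noteq> {}"
    by (auto simp: S_def intro!: exI[of _ 0])
  moreover have "f ` S \<subseteq> S"
  proof (rule image_subsetI)
    fix b assume b: "b \<in> S"
    have "norm (f b) \<le> (norm (u * u) + norm (b * b)) / 2"
      unfolding f_def using norm_triangle_ineq[of "u * u" "b * b"] by simp
    also have "\<dots> \<le> (norm u * norm u + norm u * norm u) / 2"
      using norm_mult_ineq[of u u] norm_mult_ineq[of b b] b
        mult_mono[of "norm b" "norm u" "norm b" "norm u"] unfolding S_def by simp
    also have "\<dots> \<le> norm u"
      using u(2) mult_right_mono[of "norm u" 1 "norm u"] by simp
    finally have "norm (f b) \<le> norm u" .
    moreover have "b * (b * u) = u * (b * b)"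
      using b by (metis (mono_tags, lifting) S_def mem_Collect_eq mult.assoc)
    ultimately show "f b \<in> S"
      using b u(1) by (simp add: S_def f_def cstar_scaleR cstar_add cstar_mult algebra_simps)
  qed
  moreover have "dist (f x) (f y) \<le> norm u * dist x y" if "x \<in> S" "y \<in> S" for x y
  proof -
    \<comment> \<open>\<open>x\<close> and \<open>y\<close> need not commute, hence this form of the
      difference of squares.\<close>
    have "f x - f y = (1/2::real) *\<^sub>R (x * (x - y) + (x - y) * y)"
      by (simp add: f_def algebra_simps)
    then have "norm (f x - f y) \<le> (norm (x * (x - y)) + norm ((x - y) * y)) / 2"
      using norm_triangle_ineq[of "x * (x - y)" "(x - y) * y"] by simp
    also have "\<dots> \<le> (norm u * norm (x - y) + norm (x - y) * norm u) / 2"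
      using that unfolding S_def
      by (intro divide_right_mono add_mono order_trans[OF norm_mult_ineq] mult_right_mono mult_left_mono) auto
    finally show ?thesis by (simp add: dist_norm mult.commute)
  qed
  ultimately have "\<exists>!x\<in>S. f x = x"
    using u(2) by (intro Banach_fix[of S "norm u" f]) auto
  then obtain b where b: "b \<in> S" "f b = b" by auto
  have "u * u + b * b = 2 *\<^sub>R f b"
    by (simp add: f_def)
  then have "b + b - b * b = u * u"
    using b(2) by (simp add: scaleR_2 algebra_simps)
  with b(1) show ?thesis
    using that unfolding S_def by blast
qed

text \<open>Rescaling \<open>u\<close> by \<open>sqrt (t / 2)\<close> turns
  \<open>1 - 2 u\<^sup>2\<close> into \<open>1 - t u\<^sup>2\<close>; the strict bound 2 makes the
  rescaled element a strict contraction, as the square root requires.\<close>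

lemma norm_diff_square_le:
  fixes u z :: "'b::cstar_algebra"
  assumes "u\<^sup>\<star> = u" "0 \<le> t" "t * (norm u)\<^sup>2 < 2"
  shows "norm (z - t *\<^sub>R (u * u * z)) \<le> norm z"
proof -
  define s where "s = sqrt (t / 2)"
  have s: "s * s = t / 2" using assms(2) by (simp add: s_def)
  have "(s * norm u)\<^sup>2 < 1"
    using assms(3) unfolding power_mult_distrib power2_eq_square[of s] s by simp
  then have "s * norm u < 1"
    by (simp add: power_less_one_iff abs_square_less_1)
  then have "norm (s *\<^sub>R u) < 1" using assms(2) by (simp add: s_def)
  moreover have "(s *\<^sub>R u)\<^sup>\<star> = s *\<^sub>R u" by (simp add: cstar_scaleR assms)
  ultimately obtain b where
    "b\<^sup>\<star> = b" "b * (s *\<^sub>R u) = (s *\<^sub>R u) * b" "b + b - b * b = (s *\<^sub>R u) * (s *\<^sub>R u)"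
    using sqrt_complement_exists by blast
  from norm_diff_double_square_le[OF this(1) _ this(2,3), of z] show ?thesis
    using \<open>(s *\<^sub>R u)\<^sup>\<star> = s *\<^sub>R u\<close> s by simp
qed

text \<open>This estimate is the only consequence of the positivity of \<open>k\<close> that is needed.\<close>

lemma sum_squares_accretive:
  fixes u v w z :: "'b::cstar_algebra"
  assumes sa: "u\<^sup>\<star> = u" "v\<^sup>\<star> = v" "w\<^sup>\<star> = w" and "0 \<le> t"
  defines "k \<equiv> u * u + v * v + w * w"
  shows "norm z \<le> norm (z + t *\<^sub>R (k * z))"
proof -
  define M where "M = (norm u)\<^sup>2 + (norm v)\<^sup>2 + (norm w)\<^sup>2 + 1"
  have M: "M > 0" "(norm u)\<^sup>2 \<le> M" "(norm v)\<^sup>2 \<le> M" "(norm w)\<^sup>2 \<le> M"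
    by (auto simp: M_def add_nonneg_pos)
  define d where "d = 1 / M"
  have d: "d > 0" using M by (simp add: d_def)
  have sq: "norm (z - d *\<^sub>R (x * x * z)) \<le> norm z" if "x\<^sup>\<star> = x" "(norm x)\<^sup>2 \<le> M" for x
    by (rule norm_diff_square_le) (use that M in \<open>auto simp: d_def field_simps\<close>)
  have "norm (3 *\<^sub>R z - d *\<^sub>R (k * z)) =
      norm ((z - d *\<^sub>R (u * u * z)) + (z - d *\<^sub>R (v * v * z)) + (z - d *\<^sub>R (w * w * z)))"
    using scaleR_left_distrib[of 2 1 z]
    by (intro arg_cong[of _ _ norm]) (simp add: k_def algebra_simps scaleR_2)
  also have "\<dots> \<le> 3 * norm z"
    using sq[OF sa(1)] sq[OF sa(2)] sq[OF sa(3)] M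
      norm_triangle_ineq[of "z - d *\<^sub>R (u * u * z)" "z - d *\<^sub>R (v * v * z)"]
      norm_triangle_ineq[of "z - d *\<^sub>R (u * u * z) + (z - d *\<^sub>R (v * v * z))" "z - d *\<^sub>R (w * w * z)"]
    by linarith
  finally have le: "norm (3 *\<^sub>R z - d *\<^sub>R (k * z)) \<le> 3 * norm z" .
  \<comment> \<open>Splitting the scalar \<open>1 + 3 t / d\<close> into \<open>1 + t k\<close> and
    a multiple of \<open>3 - d k\<close> turns the upper bound for the latter into a lower bound for
    the former: the terms \<open>3 t / d\<close> cancel in the norms.\<close>
  have "(1 + 3 * t / d) *\<^sub>R z = (z + t *\<^sub>R (k * z)) + (t / d) *\<^sub>R (3 *\<^sub>R z - d *\<^sub>R (k * z))"
    using d by (simp add: algebra_simps)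
  then have "norm ((1 + 3 * t / d) *\<^sub>R z) \<le>
      norm (z + t *\<^sub>R (k * z)) + norm ((t / d) *\<^sub>R (3 *\<^sub>R z - d *\<^sub>R (k * z)))"
    by (metis norm_triangle_ineq)
  also have "norm ((t / d) *\<^sub>R (3 *\<^sub>R z - d *\<^sub>R (k * z))) \<le> (t / d) * (3 * norm z)"
    using le d \<open>0 \<le> t\<close> by (simp add: mult_left_mono divide_right_mono)
  finally have "norm ((1 + 3 * t / d) *\<^sub>R z) \<le> norm (z + t *\<^sub>R (k * z)) + (t / d) * (3 * norm z)" 
    by simp
  moreover have "norm ((1 + 3 * t / d) *\<^sub>R z) = norm z + (t / d) * (3 * norm z)"
    using d \<open>0 \<le> t\<close> unfolding norm_scaleR by (simp add: distrib_right)
  ultimately show ?thesis by simp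
qed

text \<open>Iterated squaring of a number above 1 leaves every bound. This takes the place of the
  spectral radius formula: suitably normalized norms of self-adjoint elements form a bounded set
  that is stable under squaring.\<close>

lemma self_improving_le_1:
  fixes S :: "real set"
  assumes "bdd_above S" "\<And>x. x \<in> S \<Longrightarrow> x\<^sup>2 \<in> S" "x \<in> S"
  shows "x \<le> 1"
proof (rule ccontr)
  assume "\<not> x \<le> 1"
  then have x: "1 < x" by simp
  have "x ^ (2 ^ n) \<in> S" for n
    by (induction n) (use assms in \<open>auto simp: power_mult mult.commute[of 2]\<close>)
  moreover obtain B where "\<And>y. y \<in> S \<Longrightarrow> y \<le> B"
    using assms(1) by (auto simp: bdd_above_def)
  moreover obtain n where "B < x ^ n"
    using real_arch_pow[OF x] by blast
  moreover have "x ^ n \<le> x ^ (2 ^ n)"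
    using x by (intro power_increasing) (auto intro: less_imp_le less_exp)
  ultimately show False
    by (metis linorder_not_le order_trans)
qed

text \<open>
  A special case of Kaplansky's theorem that \<open>y\<^sup>* y \<le> 0\<close> forces \<open>y = 0\<close>. With \<open>e = g\<close> of norm 1 and
  \<open>h = e\<^sup>2 = - x\<^sup>* x\<close>, the element \<open>k = x x\<^sup>*\<close> is half a sum of squares, hence accretive. Since
  \<open>k x = - x h\<close>, multiplication by \<open>1 - 3/4 h\<close> does not decrease \<open>\<parallel>x w\<parallel>\<close>. But
  \<open>3 (h - 3/4 h\<^sup>2) = 1 - W\<^sup>2\<close> for the contraction \<open>W = 1 - 3/2 h\<close>, so \<open>\<parallel>(h - 3/4 h\<^sup>2) h\<parallel> \<le> 2/3\<close>.
\<close>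

lemma cstar_square_eq_neg_square:
  fixes g y :: "'b::cstar_algebra"
  assumes g: "g\<^sup>\<star> = g" and y: "y\<^sup>\<star> * y = - (g * g)"
  shows "g = 0"
proof (rule ccontr)
  assume "g \<noteq> 0"
  define e where "e = g /\<^sub>R norm g"
  define x where "x = y /\<^sub>R norm g"
  have e: "e\<^sup>\<star> = e" "norm e = 1" and x: "x\<^sup>\<star> * x = - (e * e)"
    using \<open>g \<noteq> 0\<close> g y by (simp_all add: e_def x_def cstar_scaleR)
  define h where "h = e * e"
  define k where "k = x * x\<^sup>\<star>"
  define u where "u = x + x\<^sup>\<star>"
  define v where "v = \<i> *\<^sub>C (x - x\<^sup>\<star>)"
  have u: "u\<^sup>\<star> = u" "v\<^sup>\<star> = v"
    by (simp_all add: u_def v_def cstar_add cstar_diff cstar_cstar cstar_cscale cscale_minus_left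
        flip: cscale_minus_right)
  \<comment> \<open>\<open>u\<close> and \<open>- v\<close> are twice the real and the imaginary
    part of \<open>x\<close>, and in the sum of their squares the terms \<open>x * x\<close> and its
    adjoint cancel.\<close>
  have "u * u + v * v = 2 *\<^sub>R (x\<^sup>\<star> * x + k)"
    by (simp add: u_def v_def k_def cscale_mult_left cscale_mult_right cscale_cscale
        cscale_minus_left cscale_diff_right algebra_simps scaleR_2)
  then have k_eq: "2 *\<^sub>R k = u * u + v * v + (sqrt 2 *\<^sub>R e) * (sqrt 2 *\<^sub>R e)"
    using x by (simp add: algebra_simps)
  have accretive: "norm z \<le> norm (z + t *\<^sub>R (k * z))" if "0 \<le> t" for t z
    using sum_squares_accretive[of u v "sqrt 2 *\<^sub>R e" "t / 2" z] that u e k_eq[symmetric]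
    by (simp add: cstar_scaleR)
  have h: "h\<^sup>\<star> = h" "norm h = 1"
    using e norm_self_adjoint_square[of e] by (simp_all add: h_def cstar_mult)
  have h_mult: "norm (h * z) \<le> norm z" for z
    using norm_mult_ineq[of h z] h by simp
  \<comment> \<open>The constant \<open>3/4\<close> is \<open>s / 2\<close> for
    \<open>s = 3/2\<close>. Any \<open>s\<close> strictly between 1 and 2 would do:
    \<open>s < 2\<close> makes \<open>1 - s h\<close> a contraction, and the final comparison
    \<open>1 \<le> 1 / s\<close> is absurd for \<open>s > 1\<close>.\<close>
  define T where "T = (\<lambda>z. z - (3/4::real) *\<^sub>R (h * z))"
  have eh: "e * h = h * e" by (simp add: h_def mult.assoc)
  \<comment> \<open>With this argument \<open>e * ?w\<close> is \<open>h * h\<close>, of norm 1.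
    Since \<open>x\<close> and \<open>e\<close> have the same effect on norms, the estimate for
    \<open>x * ?w\<close> becomes \<open>1 \<le> norm (T (h * h))\<close>.\<close>
  let ?w = "e * h"
  have "norm (x * ?w) \<le> norm (x * T ?w)"
  proof -
    have "k * (x * ?w) = - (x * (h * ?w))"
      using x by (simp add: k_def h_def mult.assoc) (simp flip: mult.assoc)
    then have "x * T ?w = x * ?w + (3/4::real) *\<^sub>R (k * (x * ?w))"
      by (simp add: T_def algebra_simps)
    then show ?thesis using accretive[of "3/4"] by simp
  qed
  moreover have norm_x: "norm (x * z) = norm (e * z)" for z
  proof -
    have "(norm (x * z))\<^sup>2 = norm (z\<^sup>\<star> * (x\<^sup>\<star> * x) * z)"
      using cstar_identity[of "x * z"] by (simp add: cstar_mult mult.assoc)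
    also have "\<dots> = (norm (e * z))\<^sup>2"
      using cstar_identity[of "e * z"] e x by (simp add: cstar_mult mult.assoc)
    finally show ?thesis by simp
  qed
  moreover have "e * ?w = h * h" "e * T ?w = T (h * h)"
    by (simp_all add: T_def h_def algebra_simps)
  moreover have "norm (h * h) = 1"
    using norm_self_adjoint_square[of h] h by simp
  ultimately have "1 \<le> norm (T (h * h))" by simp
  moreover have "norm (3 *\<^sub>R T (h * h)) \<le> 2"
  proof -
    define W where "W = (\<lambda>z. z - (3/2::real) *\<^sub>R (h * z))"
    have W: "norm (W z) \<le> norm z" for z
      using norm_diff_square_le[of e "3/2" z] e by (simp add: W_def h_def)
    have "3 *\<^sub>R T (h * h) = h - W (W h)"
      by (simp add: T_def W_def algebra_simps)
        (simp flip: scaleR_left_distrib)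
    then show ?thesis
      using norm_triangle_ineq4[of h "W (W h)"] W[of "W h"] W[of h] h by simp
  qed
  ultimately show False by simp
qed

lemma projection_orthogonal_if_sum_le:
  fixes p q r :: "'b::cstar_algebra"
  assumes "projection p" "projection q" "projection r" "r * p = p" "r * q = q" "p + q \<le>\<^sub>C r"
  shows "p * q = 0"
proof -
  obtain c where c: "r - (p + q) = c\<^sup>\<star> * c"
    using assms by (auto simp: cstar_le_def)
  note pq = assms(1-3)[unfolded projection_def]
  \<comment> \<open>compressing by \<open>p q\<close> rather than by \<open>p\<close> turns \<open>r - p - q\<close> into the negative of a square\<close>
  let ?y = "c * (p * q)" and ?g = "q * p * q"
  have "?y\<^sup>\<star> * ?y = q * p * (r - (p + q)) * p * q"
    using pq by (simp add: c cstar_mult mult.assoc)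
  also have "\<dots> = q * p * (r * p) * q - q * p * (p * p) * q - q * p * q * p * q"
    by (simp add: algebra_simps)
  also have "\<dots> = - (?g * ?g)"
    using pq assms(4) by (simp add: mult.assoc) (metis mult.assoc)
  finally have "?g = 0"
    using pq by (intro cstar_square_eq_neg_square[of ?g ?y]) (simp_all add: cstar_mult mult.assoc)
  moreover have "(p * q)\<^sup>\<star> * (p * q) = ?g"
    using pq by (simp add: cstar_mult) (metis mult.assoc)
  ultimately show ?thesis
    by (metis cstar_mult_self_eq_0)
qed

section \<open>Cuntz-Krieger bimodules\<close>

text \<open>For a function that is 0 off \<open>V\<close>, the finiteness of its level sets on
  \<open>V\<close> is convergence to 0 along the cofinite filter of the whole type, so the calculus
  of limits applies.\<close>

lemma C0_iff: "a \<in> C0 V \<longleftrightarrow> (\<forall>v. v \<notin> V \<longrightarrow> a v = 0) \<and> (a \<longlongrightarrow> 0) cofinite"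
proof -
  have "{v \<in> V. \<epsilon> \<le> cmod (a v)} = {v. \<not> cmod (a v) < \<epsilon>}"
    if "\<forall>v. v \<notin> V \<longrightarrow> a v = 0" "\<epsilon> > 0" for \<epsilon>
    using that by (force simp: not_less)
  then show ?thesis
    unfolding C0_def vanishes_at_infinity_def tendsto_iff
    by (auto simp: eventually_cofinite)
qed

lemma tendsto_0_cofinite_bounded:
  fixes f :: "'v \<Rightarrow> 'c::real_normed_vector"
  assumes "(f \<longlongrightarrow> 0) cofinite"
  obtains B where "B > 0" "\<And>v. norm (f v) \<le> B"
proof -
  have "\<forall>\<^sub>F v in cofinite. norm (f v) < 1"
    using tendstoD[OF assms, of 1] by simp
  then have fin: "finite {v. \<not> norm (f v) < 1}"
    by (simp add: eventually_cofinite)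
  define B where "B = Max (insert 1 ((\<lambda>v. norm (f v)) ` {v. \<not> norm (f v) < 1}))"
  have "1 \<le> B" using fin by (auto simp: B_def)
  moreover have "norm (f v) \<le> B" for v
  proof (cases "norm (f v) < 1")
    case False
    then show ?thesis using fin by (auto simp: B_def intro!: Max_ge)
  qed (use \<open>1 \<le> B\<close> in simp)
  ultimately show ?thesis by (intro that[of B]) auto
qed

section \<open>Fibrewise square sums and the Hilbert module norm\<close>

abbreviation fibre :: "('v, 'a) pre_digraph \<Rightarrow> 'v \<Rightarrow> 'a set" where
  "fibre G v \<equiv> {l \<in> arcs G. head G l = v}"

text \<open>The real form of \<open>\<langle>x, x\<rangle>\<close>; order and limit arguments are
  run on it rather than on the complex inner product.\<close>

definition fibre_norm :: "('v, 'a) pre_digraph \<Rightarrow> ('a \<Rightarrow> complex) \<Rightarrow> 'v \<Rightarrow> real" where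
  "fibre_norm G x v = (\<Sum>\<^sub>\<infinity>l\<in>fibre G v. (cmod (x l))\<^sup>2)"

lemma fibre_norm_nonneg [simp]: "0 \<le> fibre_norm G x v"
  by (simp add: fibre_norm_def infsum_nonneg)

lemma summable_on_finite_ge:
  fixes f :: "'a \<Rightarrow> real"
  assumes "f summable_on A" "\<And>l. l \<in> A \<Longrightarrow> 0 \<le> f l" "\<epsilon> > 0"
  shows "finite {l \<in> A. \<epsilon> \<le> f l}"
proof (rule ccontr)
  assume inf: "infinite {l \<in> A. \<epsilon> \<le> f l}"
  obtain n :: nat where n: "infsum f A < n * \<epsilon>"
    using reals_Archimedean3[OF \<open>\<epsilon> > 0\<close>] by blast
  obtain F where F: "finite F" "card F = n" "F \<subseteq> {l \<in> A. \<epsilon> \<le> f l}"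
    using infinite_arbitrarily_large[OF inf] by blast
  have "n * \<epsilon> \<le> sum f F"
    using F sum_mono[of F "\<lambda>_. \<epsilon>" f] by auto
  also have "\<dots> \<le> infsum f A"
    using F assms by (intro finite_sum_le_infsum) auto
  finally show False using n by simp
qed

lemma cmod_add_square_le: "(cmod (a + b))\<^sup>2 \<le> 2 * (cmod a)\<^sup>2 + 2 * (cmod b)\<^sup>2"
proof -
  have "(cmod (a + b))\<^sup>2 \<le> (cmod a + cmod b)\<^sup>2"
    by (intro power_mono norm_triangle_ineq) auto
  also have "\<dots> \<le> 2 * (cmod a)\<^sup>2 + 2 * (cmod b)\<^sup>2"
    using sum_squares_bound[of "cmod a" "cmod b"] by (simp add: power2_sum)
  finally show ?thesis .
qed

context wf_digraph
begin

lemma fibre_empty: "v \<notin> verts G \<Longrightarrow> fibre G v = {}"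
  using head_in_verts by auto

text \<open>Fibres over points outside the vertex set are empty, so both conditions extend to the
  whole type.\<close>

lemma bimod_iff:
  "x \<in> bimod G \<longleftrightarrow> (\<forall>l. l \<notin> arcs G \<longrightarrow> x l = 0) \<and>
     (\<forall>v. (\<lambda>l. (cmod (x l))\<^sup>2) summable_on fibre G v) \<and> (fibre_norm G x \<longlongrightarrow> 0) cofinite"
proof -
  have "(\<forall>v\<in>verts G. (\<lambda>l. (cmod (x l))\<^sup>2) summable_on fibre G v) \<longleftrightarrow>
      (\<forall>v. (\<lambda>l. (cmod (x l))\<^sup>2) summable_on fibre G v)"
  proof -
    have "(\<lambda>l. (cmod (x l))\<^sup>2) summable_on fibre G v" if "v \<notin> verts G" for v
      unfolding fibre_empty[OF that] by simp
    then show ?thesis by blast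
  qed
  moreover have "vanishes_at_infinity (verts G) (\<lambda>v. complex_of_real (fibre_norm G x v)) \<longleftrightarrow>
      (fibre_norm G x \<longlongrightarrow> 0) cofinite"
  proof -
    have "{v \<in> verts G. \<epsilon> \<le> fibre_norm G x v} = {v. \<not> fibre_norm G x v < \<epsilon>}" if "\<epsilon> > 0" for \<epsilon>
    proof -
      have "fibre_norm G x v = 0" if "v \<notin> verts G" for v
        using that by (simp add: fibre_norm_def fibre_empty)
      with that show ?thesis by (force simp: not_less)
    qed
    then show ?thesis
      unfolding vanishes_at_infinity_def tendsto_iff by (auto simp: eventually_cofinite)
  qed
  ultimately show ?thesis
    by (simp add: bimod_def fibre_norm_def)
qed

lemma bimod_zero_off: "x \<in> bimod G \<Longrightarrow> l \<notin> arcs G \<Longrightarrow> x l = 0"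
  and bimod_summable: "x \<in> bimod G \<Longrightarrow> (\<lambda>l. (cmod (x l))\<^sup>2) summable_on fibre G v"
  and bimod_tendsto: "x \<in> bimod G \<Longrightarrow> (fibre_norm G x \<longlongrightarrow> 0) cofinite"
  by (auto simp: bimod_iff)

lemma inner_prod_self:
  assumes "x \<in> bimod G"
  shows "inner_prod G x x v = of_real (fibre_norm G x v)"
proof -
  have "((\<lambda>l. complex_of_real ((cmod (x l))\<^sup>2)) has_sum of_real (fibre_norm G x v)) (fibre G v)"
    using bimod_summable[OF assms] by (intro has_sum_of_real) (simp add: fibre_norm_def)
  moreover have "cnj z * z = complex_of_real ((cmod z)\<^sup>2)" for z
    by (simp only: complex_norm_square mult.commute)
  ultimately show ?thesis
    unfolding inner_prod_def by (simp only: infsumI)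
qed

lemma bimod_norm_eq: "x \<in> bimod G \<Longrightarrow> bimod_norm G x = sqrt (SUP v. fibre_norm G x v)"
  by (simp add: bimod_norm_def inner_prod_self)

text \<open>Vanishing at infinity makes the fibre norms bounded, so that the supremum in
  \<open>bimod_norm\<close> is an upper bound for them.\<close>

lemma fibre_norm_le_bimod_norm: "fibre_norm G x v \<le> (bimod_norm G x)\<^sup>2"
  and bimod_norm_nonneg [simp]: "0 \<le> bimod_norm G x"
  if x: "x \<in> bimod G"
proof -
  obtain B where "\<And>v. norm (fibre_norm G x v) \<le> B"
    by (rule tendsto_0_cofinite_bounded[OF bimod_tendsto[OF x]]) (rule that)
  then have "fibre_norm G x v \<le> B" for v
    by (metis fibre_norm_nonneg real_norm_def abs_of_nonneg)
  then have "bdd_above (range (fibre_norm G x))"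
    by (rule bdd_aboveI2)
  then have "fibre_norm G x v \<le> (SUP v. fibre_norm G x v)"
    by (rule cSUP_upper2) auto
  moreover from this have "0 \<le> (SUP v. fibre_norm G x v)"
    by (rule order_trans[OF fibre_norm_nonneg])
  ultimately show "fibre_norm G x v \<le> (bimod_norm G x)\<^sup>2" "0 \<le> bimod_norm G x"
    by (simp_all add: bimod_norm_eq[OF x])
qed

lemma bimod_norm_leI:
  assumes "x \<in> bimod G" "0 \<le> M" "\<And>v. fibre_norm G x v \<le> M\<^sup>2"
  shows "bimod_norm G x \<le> M"
proof -
  have "(SUP v. fibre_norm G x v) \<le> M\<^sup>2"
    by (rule cSUP_least) (use assms in auto)
  then show ?thesis
    using real_sqrt_le_mono[of _ "M\<^sup>2"] assms by (simp add: bimod_norm_eq)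
qed

lemma cmod_le_bimod_norm:
  assumes "x \<in> bimod G"
  shows "cmod (x l) \<le> bimod_norm G x"
proof (cases "l \<in> arcs G")
  case True
  then have "(cmod (x l))\<^sup>2 \<le> fibre_norm G x (head G l)"
    using finite_sum_le_infsum[OF bimod_summable[OF assms], of "{l}" "head G l"]
    by (simp add: fibre_norm_def)
  also have "\<dots> \<le> (bimod_norm G x)\<^sup>2"
    by (rule fibre_norm_le_bimod_norm[OF assms])
  finally show ?thesis
    using assms by (simp add: power2_le_iff_abs_le)
qed (use assms in \<open>simp add: bimod_zero_off\<close>)

text \<open>One comparison test for membership: sums, multiples, restrictions and right multiples by
  \<open>C0\<close> functions are all coordinatewise dominated by elements of the bimodule.\<close>

lemma bimod_dominated:
  assumes "x \<in> bimod G" "y \<in> bimod G" and off: "\<And>l. l \<notin> arcs G \<Longrightarrow> z l = 0"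
    and le: "\<And>l. l \<in> arcs G \<Longrightarrow> (cmod (z l))\<^sup>2 \<le> C * (cmod (x l))\<^sup>2 + D * (cmod (y l))\<^sup>2"
  shows "z \<in> bimod G" and "fibre_norm G z v \<le> C * fibre_norm G x v + D * fibre_norm G y v"
proof -
  have s: "(\<lambda>l. C * (cmod (x l))\<^sup>2 + D * (cmod (y l))\<^sup>2) summable_on fibre G v" for v
    using assms by (intro summable_on_add summable_on_cmult_right bimod_summable)
  have zs: "(\<lambda>l. (cmod (z l))\<^sup>2) summable_on fibre G v" for v
    by (rule summable_on_comparison_test[OF s]) (use le in auto)
  have bound: "fibre_norm G z v \<le> C * fibre_norm G x v + D * fibre_norm G y v" for v
  proof -
    have "fibre_norm G z v \<le> (\<Sum>\<^sub>\<infinity>l\<in>fibre G v. C * (cmod (x l))\<^sup>2 + D * (cmod (y l))\<^sup>2)"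
      unfolding fibre_norm_def by (rule infsum_mono[OF zs s]) (use le in auto)
    also have "\<dots> = C * fibre_norm G x v + D * fibre_norm G y v"
      unfolding fibre_norm_def using assms
      by (subst infsum_add) (auto intro!: summable_on_cmult_right bimod_summable simp: infsum_cmult_right')
    finally show ?thesis .
  qed
  show "fibre_norm G z v \<le> C * fibre_norm G x v + D * fibre_norm G y v" by (rule bound)
  have "((\<lambda>v. C * fibre_norm G x v + D * fibre_norm G y v) \<longlongrightarrow> C * 0 + D * 0) cofinite"
    using assms by (intro tendsto_intros bimod_tendsto)
  then have "((\<lambda>v. C * fibre_norm G x v + D * fibre_norm G y v) \<longlongrightarrow> 0) cofinite"
    by simp
  then have "(fibre_norm G z \<longlongrightarrow> 0) cofinite"
    by (rule Lim_null_comparison[rotated]) (simp add: bound)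
  with off zs show "z \<in> bimod G" by (auto simp: bimod_iff)
qed

lemma bimod_dominated':
  assumes "x \<in> bimod G" "\<And>l. l \<notin> arcs G \<Longrightarrow> z l = 0" "\<And>l. cmod (z l) \<le> C * cmod (x l)"
  shows "z \<in> bimod G" "fibre_norm G z v \<le> C\<^sup>2 * fibre_norm G x v"
proof -
  have *: "(cmod (z l))\<^sup>2 \<le> C\<^sup>2 * (cmod (x l))\<^sup>2 + 0 * (cmod (x l))\<^sup>2" for l
    using power_mono[OF assms(3)[of l], of 2] by (simp add: power_mult_distrib)
  show "z \<in> bimod G" by (rule bimod_dominated(1)[OF assms(1,1,2) *])
  show "fibre_norm G z v \<le> C\<^sup>2 * fibre_norm G x v"
    using bimod_dominated(2)[OF assms(1,1,2) *] by simp
qed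

lemma bimod_add: "x \<in> bimod G \<Longrightarrow> y \<in> bimod G \<Longrightarrow> (\<lambda>l. x l + y l) \<in> bimod G"
  by (rule bimod_dominated(1)[of x y _ 2 2]) (auto simp: bimod_zero_off cmod_add_square_le)

text \<open>The triangle inequality up to a factor is all that is needed.\<close>

lemma bimod_norm_add_le:
  assumes "x \<in> bimod G" "y \<in> bimod G" "bimod_norm G x \<le> M" "bimod_norm G y \<le> N"
  shows "bimod_norm G (\<lambda>l. x l + y l) \<le> 2 * (M + N)"
proof (rule bimod_norm_leI)
  have MN: "0 \<le> M" "0 \<le> N"
    using assms bimod_norm_nonneg order_trans by blast+
  then show "0 \<le> 2 * (M + N)" by simp
  fix v
  have "fibre_norm G (\<lambda>l. x l + y l) v \<le> 2 * fibre_norm G x v + 2 * fibre_norm G y v"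
    by (rule bimod_dominated(2)) (use assms in \<open>auto simp: bimod_zero_off cmod_add_square_le\<close>)
  also have "\<dots> \<le> 2 * M\<^sup>2 + 2 * N\<^sup>2"
    using fibre_norm_le_bimod_norm[OF assms(1), of v] fibre_norm_le_bimod_norm[OF assms(2), of v]
      power_mono[OF assms(3) bimod_norm_nonneg[OF assms(1)], of 2]
      power_mono[OF assms(4) bimod_norm_nonneg[OF assms(2)], of 2] by linarith
  also have "\<dots> \<le> (2 * (M + N))\<^sup>2"
    using MN mult_nonneg_nonneg[OF MN] zero_le_power2[of M] zero_le_power2[of N]
    by (simp add: power_mult_distrib power2_sum)
  finally show "fibre_norm G (\<lambda>l. x l + y l) v \<le> (2 * (M + N))\<^sup>2" .
qed (use assms in \<open>simp add: bimod_add\<close>)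

lemma bimod_scale: "x \<in> bimod G \<Longrightarrow> (\<lambda>l. c * x l) \<in> bimod G"
  by (rule bimod_dominated'(1)[of x _ "cmod c"]) (auto simp: bimod_zero_off norm_mult)

lemma fin_supp_subset_bimod: "fin_supp G \<subseteq> bimod G"
proof
  fix x assume "x \<in> fin_supp G"
  then have x: "\<forall>l. l \<notin> arcs G \<longrightarrow> x l = 0" and fin: "finite {l. x l \<noteq> 0}"
    by (auto simp: fin_supp_def)
  have "(\<lambda>l. (cmod (x l))\<^sup>2) summable_on fibre G v" for v
    by (rule finite_nonzero_values_imp_summable_on, rule finite_subset[OF _ fin]) auto
  moreover have "(fibre_norm G x \<longlongrightarrow> 0) cofinite"
  proof (rule tendsto_eventually)
    have "{v. fibre_norm G x v \<noteq> 0} \<subseteq> head G ` {l. x l \<noteq> 0}"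
    proof
      fix v assume "v \<in> {v. fibre_norm G x v \<noteq> 0}"
      then obtain l where "l \<in> fibre G v" "x l \<noteq> 0"
        using infsum_0[of "fibre G v" "\<lambda>l. (cmod (x l))\<^sup>2"] by (auto simp: fibre_norm_def)
      then show "v \<in> head G ` {l. x l \<noteq> 0}" by auto
    qed
    then show "\<forall>\<^sub>F v in cofinite. fibre_norm G x v = 0"
      using fin by (auto simp: eventually_cofinite intro: finite_subset)
  qed
  ultimately show "x \<in> bimod G" using x by (auto simp: bimod_iff)
qed

lemma zero_in_bimod [simp]: "(\<lambda>l. 0) \<in> bimod G"
  using fin_supp_subset_bimod by (auto simp: fin_supp_def)

lemma point_mass_in_bimod: "l \<in> arcs G \<Longrightarrow> \<delta> l \<in> bimod G"
  using fin_supp_subset_bimod by (auto simp: fin_supp_def point_mass_def)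

lemma bimod_sum: "(\<And>i. i \<in> I \<Longrightarrow> x i \<in> bimod G) \<Longrightarrow> (\<lambda>l. \<Sum>i\<in>I. x i l) \<in> bimod G"
  by (induction I rule: infinite_finite_induct) (auto intro: bimod_add)

lemma bimod_restrict: "x \<in> bimod G \<Longrightarrow> (\<lambda>l. if l \<in> F then x l else 0) \<in> bimod G"
  by (rule bimod_dominated'(1)[of x _ 1]) (auto simp: bimod_zero_off)

text \<open>Only finitely many fibres carry squared mass at least \<open>\<epsilon>\<^sup>2\<close>,
  and each of these, being square summable, has finitely many entries of modulus at least
  \<open>\<epsilon>\<close>. Diagonal coefficients of finite rank operators vanish at infinity for
  this reason.\<close>

lemma bimod_tendsto_0:
  assumes "x \<in> bimod G"
  shows "(x \<longlongrightarrow> 0) cofinite"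
proof (rule tendstoI)
  fix \<epsilon> :: real assume "\<epsilon> > 0"
  have "{l. \<not> dist (x l) 0 < \<epsilon>} \<subseteq>
      (\<Union>v\<in>{v. \<not> fibre_norm G x v < \<epsilon>\<^sup>2}. {l \<in> fibre G v. \<epsilon>\<^sup>2 \<le> (cmod (x l))\<^sup>2})"
  proof
    fix l assume "l \<in> {l. \<not> dist (x l) 0 < \<epsilon>}"
    then have l: "\<epsilon> \<le> cmod (x l)" by simp
    then have "l \<in> arcs G" using bimod_zero_off[OF assms, of l] \<open>\<epsilon> > 0\<close> by (cases "l \<in> arcs G") auto
    moreover have sq: "\<epsilon>\<^sup>2 \<le> (cmod (x l))\<^sup>2" using l \<open>\<epsilon> > 0\<close> by (intro power_mono) auto
    moreover have "(cmod (x l))\<^sup>2 \<le> fibre_norm G x (head G l)"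
      using finite_sum_le_infsum[OF bimod_summable[OF assms], of "{l}" "head G l"] \<open>l \<in> arcs G\<close>
      by (simp add: fibre_norm_def)
    ultimately show
      "l \<in> (\<Union>v\<in>{v. \<not> fibre_norm G x v < \<epsilon>\<^sup>2}. {l \<in> fibre G v. \<epsilon>\<^sup>2 \<le> (cmod (x l))\<^sup>2})"
      by auto
  qed
  moreover have "\<forall>\<^sub>F v in cofinite. fibre_norm G x v < \<epsilon>\<^sup>2"
    using tendstoD[OF bimod_tendsto[OF assms], of "\<epsilon>\<^sup>2"] \<open>\<epsilon> > 0\<close> by simp
  then have "finite {v. \<not> fibre_norm G x v < \<epsilon>\<^sup>2}" by (simp add: eventually_cofinite)
  moreover have "finite {l \<in> fibre G v. \<epsilon>\<^sup>2 \<le> (cmod (x l))\<^sup>2}" for v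
    using \<open>\<epsilon> > 0\<close> by (intro summable_on_finite_ge bimod_summable assms) auto
  ultimately show "\<forall>\<^sub>F l in cofinite. dist (x l) 0 < \<epsilon>"
    by (auto simp: eventually_cofinite intro: finite_subset)
qed

section \<open>The inner product, Cauchy-Schwarz and rank one operators\<close>

lemma inner_prod_abs_summable:
  assumes "x \<in> bimod G" "y \<in> bimod G"
  shows "(\<lambda>l. norm (cnj (x l) * y l)) summable_on fibre G v"
proof (rule abs_summable_product)
  have "(\<lambda>l. norm (cnj (x l) * cnj (x l))) = (\<lambda>l. (cmod (x l))\<^sup>2)"
    "(\<lambda>l. norm (y l * y l)) = (\<lambda>l. (cmod (y l))\<^sup>2)"
    by (auto simp: norm_mult power2_eq_square)
  then show "(\<lambda>l. norm (cnj (x l) * cnj (x l))) summable_on fibre G v"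
    "(\<lambda>l. norm (y l * y l)) summable_on fibre G v"
    using assms bimod_summable by auto
qed

lemmas inner_prod_summable = abs_summable_summable[OF inner_prod_abs_summable]

lemma inner_prod_Cauchy_Schwarz:
  assumes "x \<in> bimod G" "y \<in> bimod G"
  shows "(cmod (inner_prod G x y v))\<^sup>2 \<le> fibre_norm G x v * fibre_norm G y v"
proof -
  let ?f = "\<lambda>l. cmod (cnj (x l) * y l)"
  have "cmod (inner_prod G x y v) \<le> infsum ?f (fibre G v)"
    unfolding inner_prod_def by (rule norm_infsum_bound[OF inner_prod_abs_summable[OF assms]])
  also have "\<dots> \<le> sqrt (fibre_norm G x v * fibre_norm G y v)"
  proof (rule infsum_le_finite_sums[OF inner_prod_abs_summable[OF assms]])
    fix F assume F: "finite F" "F \<subseteq> fibre G v"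
    have "(sum ?f F)\<^sup>2 \<le> (\<Sum>l\<in>F. (cmod (x l))\<^sup>2) * (\<Sum>l\<in>F. (cmod (y l))\<^sup>2)"
      by (simp add: norm_mult Cauchy_Schwarz_ineq_sum)
    also have "\<dots> \<le> fibre_norm G x v * fibre_norm G y v"
      unfolding fibre_norm_def using F assms
      by (intro mult_mono finite_sum_le_infsum bimod_summable sum_nonneg infsum_nonneg) auto
    finally show "sum ?f F \<le> sqrt (fibre_norm G x v * fibre_norm G y v)"
      by (simp add: real_le_rsqrt)
  qed
  finally show ?thesis
    by (metis fibre_norm_nonneg mult_nonneg_nonneg norm_ge_zero power_mono real_sqrt_pow2)
qed

lemma inner_prod_le_bimod_norm:
  assumes "x \<in> bimod G" "y \<in> bimod G"
  shows "cmod (inner_prod G x y v) \<le> bimod_norm G x * bimod_norm G y"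
proof -
  have "(cmod (inner_prod G x y v))\<^sup>2 \<le> (bimod_norm G x)\<^sup>2 * (bimod_norm G y)\<^sup>2"
    using inner_prod_Cauchy_Schwarz[OF assms, of v] fibre_norm_le_bimod_norm[OF assms(1), of v]
      fibre_norm_le_bimod_norm[OF assms(2), of v]
    by (meson fibre_norm_nonneg mult_mono order_trans zero_le_power2)
  then show ?thesis
    using assms by (metis bimod_norm_nonneg mult_nonneg_nonneg power2_le_imp_le power_mult_distrib)
qed

lemma inner_prod_in_C0:
  assumes "x \<in> bimod G" "y \<in> bimod G"
  shows "inner_prod G x y \<in> C0 (verts G)"
proof -
  have "((\<lambda>v. sqrt (fibre_norm G x v * fibre_norm G y v)) \<longlongrightarrow> sqrt (0 * 0)) cofinite"
    using assms by (intro tendsto_intros bimod_tendsto)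
  then have "((\<lambda>v. sqrt (fibre_norm G x v * fibre_norm G y v)) \<longlongrightarrow> 0) cofinite"
    by simp
  then have "(inner_prod G x y \<longlongrightarrow> 0) cofinite"
    by (rule Lim_null_comparison[rotated])
      (simp add: real_le_rsqrt inner_prod_Cauchy_Schwarz[OF assms])
  moreover have "inner_prod G x y v = 0" if "v \<notin> verts G" for v
    unfolding inner_prod_def fibre_empty[OF that] by simp
  ultimately show ?thesis by (simp add: C0_iff)
qed

lemma inner_prod_add_right:
  "x \<in> bimod G \<Longrightarrow> y \<in> bimod G \<Longrightarrow> z \<in> bimod G \<Longrightarrow>
    inner_prod G x (\<lambda>l. y l + z l) v = inner_prod G x y v + inner_prod G x z v"
  unfolding inner_prod_def by (simp add: distrib_left infsum_add inner_prod_summable)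

lemma cnj_inner_prod: "cnj (inner_prod G x y v) = inner_prod G y x v"
  unfolding inner_prod_def by (simp flip: infsum_cnj add: mult.commute)

lemma inner_prod_right_act: "inner_prod G x (right_act G y a) v = inner_prod G x y v * a v"
proof -
  have "inner_prod G x (right_act G y a) v = (\<Sum>\<^sub>\<infinity>l\<in>fibre G v. cnj (x l) * y l * a v)"
    unfolding inner_prod_def right_act_def by (intro infsum_cong) auto
  then show ?thesis by (simp add: inner_prod_def infsum_cmult_left')
qed

lemma inner_prod_sum_right:
  assumes "x \<in> bimod G" "\<And>i. i \<in> I \<Longrightarrow> y i \<in> bimod G"
  shows "inner_prod G x (\<lambda>l. \<Sum>i\<in>I. y i l) v = (\<Sum>i\<in>I. inner_prod G x (y i) v)"
  using assms
  by (induction I rule: infinite_finite_induct)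
    (auto simp: inner_prod_add_right bimod_sum, auto simp: inner_prod_def)

lemma inner_prod_point_mass:
  assumes "l \<in> arcs G"
  shows "inner_prod G (\<delta> l) y v = (if v = head G l then y l else 0)"
proof -
  have "inner_prod G (\<delta> l) y v = (\<Sum>\<^sub>\<infinity>m\<in>{l} \<inter> fibre G v. y m)"
    unfolding inner_prod_def by (rule infsum_cong_neutral) (auto simp: point_mass_def)
  also have "{l} \<inter> fibre G v = (if v = head G l then {l} else {})" using assms by auto
  finally show ?thesis by simp
qed

lemma right_act_in_bimod:
  assumes "x \<in> bimod G" "a \<in> C0 V"
  shows "right_act G x a \<in> bimod G"
proof -
  obtain B where B: "B > 0" "\<And>v. norm (a v) \<le> B"
    using assms(2) tendsto_0_cofinite_bounded[of a] by (auto simp: C0_iff)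
  show ?thesis
    by (rule bimod_dominated'(1)[OF assms(1), of _ B])
      (use B(2) in \<open>auto simp: right_act_def bimod_zero_off[OF assms(1)] norm_mult mult.commute[of B]
        intro!: mult_left_mono\<close>)
qed

lemma Theta_in_bimod:
  "x \<in> bimod G \<Longrightarrow> y \<in> bimod G \<Longrightarrow> z \<in> bimod G \<Longrightarrow> Theta G x y z \<in> bimod G"
  unfolding Theta_def by (simp add: right_act_in_bimod[OF _ inner_prod_in_C0])

lemma inner_prod_Theta_swap:
  assumes "x \<in> bimod G" "y \<in> bimod G" "z \<in> bimod G" "w \<in> bimod G"
  shows "inner_prod G (Theta G x y z) w v = inner_prod G z (Theta G y x w) v"
proof -
  have "inner_prod G (Theta G x y z) w v = cnj (inner_prod G w x v * inner_prod G y z v)"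
    using assms by (subst cnj_inner_prod[symmetric]) (simp add: Theta_def inner_prod_right_act)
  also have "\<dots> = inner_prod G z (Theta G y x w) v"
    using assms by (simp add: Theta_def inner_prod_right_act cnj_inner_prod)
  finally show ?thesis .
qed

lemma bimod_norm_point_mass:
  assumes "l \<in> arcs G"
  shows "bimod_norm G (\<delta> l) \<le> 1"
proof (rule bimod_norm_leI)
  show "fibre_norm G (\<delta> l) v \<le> 1\<^sup>2" for v
    using inner_prod_self[OF point_mass_in_bimod[OF assms], of v]
    by (auto simp: inner_prod_point_mass[OF assms] split: if_splits) (auto simp: point_mass_def)
qed (use assms in \<open>auto simp: point_mass_in_bimod\<close>)

end

section \<open>Toeplitz representations of a bimodule\<close>

lemma C0_dominated:
  assumes "a \<in> C0 V" "\<And>v. v \<notin> V \<Longrightarrow> f v = 0" "\<And>v. cmod (f v) \<le> K * cmod (a v)"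
  shows "f \<in> C0 V"
proof -
  have "((\<lambda>v. K * cmod (a v)) \<longlongrightarrow> K * cmod 0) cofinite"
    using assms(1) by (intro tendsto_intros) (simp add: C0_iff)
  then have "((\<lambda>v. K * cmod (a v)) \<longlongrightarrow> 0) cofinite" by simp
  then have "(f \<longlongrightarrow> 0) cofinite"
    by (rule Lim_null_comparison[rotated]) (simp add: assms(3))
  with assms(2) show ?thesis by (simp add: C0_iff)
qed

lemma C0_add: "a \<in> C0 V \<Longrightarrow> b \<in> C0 V \<Longrightarrow> (\<lambda>v. a v + b v) \<in> C0 V"
  unfolding C0_iff by (auto intro: tendsto_add_zero)

lemma C0_scale: "a \<in> C0 V \<Longrightarrow> (\<lambda>v. c * a v) \<in> C0 V"
  by (rule C0_dominated[of a V _ "cmod c"]) (auto simp: C0_iff norm_mult)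

lemma C0_mult: "a \<in> C0 V \<Longrightarrow> b \<in> C0 V \<Longrightarrow> (\<lambda>v. a v * b v) \<in> C0 V"
  unfolding C0_iff by (auto intro: tendsto_mult_zero)

lemma C0_cnj: "a \<in> C0 V \<Longrightarrow> (\<lambda>v. cnj (a v)) \<in> C0 V"
  by (rule C0_dominated[of a V _ 1]) (auto simp: C0_iff)

lemma C0_zero: "(\<lambda>v. 0) \<in> C0 V"
  by (simp add: C0_iff)

lemma point_mass_in_C0: "v \<in> V \<Longrightarrow> \<delta> v \<in> C0 V"
  unfolding C0_iff by (auto simp: point_mass_def eventually_cofinite intro!: tendsto_eventually)

lemma linear_on_functions_sum:
  assumes lin: "linear_on_functions X f"
    and X: "(\<lambda>l. 0) \<in> X" "\<And>x y. x \<in> X \<Longrightarrow> y \<in> X \<Longrightarrow> (\<lambda>l. x l + y l) \<in> X"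
      "\<And>c x. x \<in> X \<Longrightarrow> (\<lambda>l. c * x l) \<in> X"
    and "\<And>i. i \<in> I \<Longrightarrow> x i \<in> X"
  shows "f (\<lambda>l. \<Sum>i\<in>I. c i * x i l) = (\<Sum>i\<in>I. c i *\<^sub>C f (x i))"
    and "(\<lambda>l. \<Sum>i\<in>I. c i * x i l) \<in> X"
proof -
  have "\<forall>c. \<forall>x\<in>X. f (\<lambda>l. c * x l) = c *\<^sub>C f x"
    using lin by (simp add: linear_on_functions_def)
  from this[rule_format, of "\<lambda>l. 0" 0] have zero: "f (\<lambda>l. 0) = 0"
    using X(1) by simp
  have "f (\<lambda>l. \<Sum>i\<in>I. c i * x i l) = (\<Sum>i\<in>I. c i *\<^sub>C f (x i)) \<and> (\<lambda>l. \<Sum>i\<in>I. c i * x i l) \<in> X"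
    using assms(5)
  proof (induction I rule: infinite_finite_induct)
    case (insert i I)
    then show ?case
      using lin X unfolding linear_on_functions_def by simp
  qed (use zero X(1) in auto)
  then show "f (\<lambda>l. \<Sum>i\<in>I. c i * x i l) = (\<Sum>i\<in>I. c i *\<^sub>C f (x i))"
    and "(\<lambda>l. \<Sum>i\<in>I. c i * x i l) \<in> X" by auto
qed

text \<open>The normalized square \<open>r\<close> of \<open>cmod (a v)\<close> has values in the
  unit interval, so \<open>1 - sqrt (1 - r\<^sup>2)\<close> can be formed pointwise inside
  \<open>C0 V\<close>, and its image is the \<open>b\<close> required for
  \<open>u = \<pi> r\<close>. Then \<open>norm (u * u) \<le> norm u\<close> gives
  \<open>norm u \<le> 1\<close>, and the C*-identity passes the bound to
  \<open>\<pi> a\<close>.\<close>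

lemma C0_hom_norm_le:
  fixes \<pi> :: "('v \<Rightarrow> complex) \<Rightarrow> 'b::cstar_algebra"
  assumes \<pi>: "C0_hom V \<pi>" and a: "a \<in> C0 V" and M: "\<And>v. cmod (a v) \<le> M"
  shows "norm (\<pi> a) \<le> M"
proof -
  have lin: "\<pi> (\<lambda>v. f v + g v) = \<pi> f + \<pi> g" "\<pi> (\<lambda>v. c * f v) = c *\<^sub>C \<pi> f"
      "\<pi> (\<lambda>v. f v * g v) = \<pi> f * \<pi> g" "\<pi> (\<lambda>v. cnj (f v)) = (\<pi> f)\<^sup>\<star>"
    if "f \<in> C0 V" "g \<in> C0 V" for f g c
    using \<pi> that by (auto simp: C0_hom_def linear_on_functions_def)
  have "0 \<le> M" using M[of undefined] norm_ge_zero order_trans by blast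
  show ?thesis
  proof (cases "M = 0")
    case True
    then have "a = (\<lambda>v. 0 * a v)" using M by auto
    then have "\<pi> a = 0 *\<^sub>C \<pi> a" using lin(2)[OF a a, of 0] by simp
    then show ?thesis using True by simp
  next
    case False
    with \<open>0 \<le> M\<close> have "M > 0" by simp
    define r where "r = (\<lambda>v. (cmod (a v) / M)\<^sup>2)"
    define b where "b = (\<lambda>v. 1 - sqrt (1 - (r v)\<^sup>2))"
    have r01: "0 \<le> r v" "r v \<le> 1" for v
      using M[of v] \<open>M > 0\<close> by (auto simp: r_def divide_le_eq power_le_one)
    have r2: "(r v)\<^sup>2 \<le> r v" for v
      using r01[of v] by (simp add: power2_eq_square mult_left_le)
    \<comment> \<open>The upper bound places \<open>b\<close> in \<open>C0 V\<close>, by comparison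
      with \<open>r\<close>.\<close>
    have b01: "0 \<le> b v" "b v \<le> r v" for v
    proof -
      have "1 - (r v)\<^sup>2 \<le> 1" by simp
      then show "0 \<le> b v" by (simp add: b_def)
      have "(1 - r v)\<^sup>2 \<le> 1 - (r v)\<^sup>2"
        using r2[of v] by (simp add: power2_diff)
      then have "1 - r v \<le> sqrt (1 - (r v)\<^sup>2)"
        by (rule real_le_rsqrt)
      then show "b v \<le> r v"
        by (simp add: b_def)
    qed
    have rel: "b v + b v = b v * b v + r v * r v" for v
    proof -
      have "(sqrt (1 - (r v)\<^sup>2))\<^sup>2 = 1 - (r v)\<^sup>2"
        using r2[of v] r01[of v] by simp
      then show ?thesis by (simp add: b_def power2_eq_square algebra_simps)
    qed
    have rC: "(\<lambda>v. complex_of_real (r v)) \<in> C0 V"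
    proof (rule C0_dominated[OF a, of _ "1 / M"])
      fix v
      have "(cmod (a v) / M)\<^sup>2 \<le> cmod (a v) / M"
        unfolding power2_eq_square
        by (rule mult_left_le) (use M[of v] \<open>M > 0\<close> in \<open>auto simp: divide_le_eq\<close>)
      then show "cmod (complex_of_real (r v)) \<le> 1 / M * cmod (a v)"
        using r01(1)[of v] unfolding norm_of_real by (simp add: r_def)
    qed (use a in \<open>auto simp: r_def C0_iff\<close>)
    have bC: "(\<lambda>v. complex_of_real (b v)) \<in> C0 V"
    proof (rule C0_dominated[OF rC, of _ 1])
      show "complex_of_real (b v) = 0" if "v \<notin> V" for v
        using that a by (simp add: b_def r_def C0_iff)
    qed (use b01 r01 in auto)
    let ?u = "\<pi> (\<lambda>v. complex_of_real (r v))" and ?b = "\<pi> (\<lambda>v. complex_of_real (b v))"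
    have "?u\<^sup>\<star> = ?u" "?b\<^sup>\<star> = ?b"
      using lin(4)[OF rC rC] lin(4)[OF bC bC] by simp_all
    moreover have "?b * ?u = ?u * ?b"
      using lin(3)[OF rC bC] lin(3)[OF bC rC] by (simp add: mult.commute)
    moreover have "?b + ?b = ?b * ?b + ?u * ?u"
    proof -
      have "(\<lambda>v. complex_of_real (b v) + complex_of_real (b v)) =
        (\<lambda>v. complex_of_real (b v) * complex_of_real (b v) + complex_of_real (r v) * complex_of_real (r v))"
        using rel by (metis of_real_add of_real_mult)
      then show ?thesis
        using lin(1)[OF bC bC] lin(1)[OF C0_mult[OF bC bC] C0_mult[OF rC rC]] lin(3)[OF bC bC]
          lin(3)[OF rC rC] by simp
    qed
    ultimately have "norm (?u * ?u) \<le> norm ?u"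
      by (intro norm_mult_le_of_unitary[of ?b]) (simp_all add: diff_eq_eq)
    then have "norm ?u * norm ?u \<le> norm ?u"
      using norm_self_adjoint_square[OF \<open>?u\<^sup>\<star> = ?u\<close>] by (simp add: power2_eq_square)
    then have u1: "norm ?u \<le> 1"
      by (cases "?u = 0") auto
    have "(\<pi> a)\<^sup>\<star> * \<pi> a = \<pi> (\<lambda>v. cnj (a v) * a v)"
      using lin(3)[OF C0_cnj[OF a] a] lin(4)[OF a a] by simp
    also have "(\<lambda>v. cnj (a v) * a v) = (\<lambda>v. complex_of_real (M\<^sup>2) * complex_of_real (r v))"
    proof
      fix v
      have "cnj (a v) * a v = complex_of_real ((cmod (a v))\<^sup>2)"
        by (simp only: complex_norm_square mult.commute)
      also have "(cmod (a v))\<^sup>2 = M\<^sup>2 * r v"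
        using \<open>M > 0\<close> by (simp add: r_def power_divide)
      finally show "cnj (a v) * a v = complex_of_real (M\<^sup>2) * complex_of_real (r v)" by simp
    qed
    also have "\<pi> \<dots> = complex_of_real (M\<^sup>2) *\<^sub>C ?u"
      by (rule lin(2)[OF rC rC])
    finally have "(norm (\<pi> a))\<^sup>2 = M\<^sup>2 * norm ?u"
      using cstar_identity[of "\<pi> a"] by (simp add: norm_cscale norm_power)
    also have "\<dots> \<le> M\<^sup>2"
      using u1 by (simp add: mult_left_le)
    finally show ?thesis using \<open>0 \<le> M\<close> by (rule power2_le_imp_le)
  qed
qed

section \<open>A Toeplitz representation of one bimodule and its rank one elements\<close>

locale toeplitz_bimod = wf_digraph G
  for G :: "('v, 'a) pre_digraph" +
  fixes \<psi> :: "('a \<Rightarrow> complex) \<Rightarrow> 'b::cstar_algebra" and \<pi> :: "('v \<Rightarrow> complex) \<Rightarrow> 'b"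
  assumes rep: "toeplitz_bimod_rep G \<psi> \<pi>"
begin

lemma psi_linear: "linear_on_functions (bimod G) \<psi>"
  and pi_hom: "C0_hom (verts G) \<pi>"
  and psi_right: "y \<in> bimod G \<Longrightarrow> a \<in> C0 (verts G) \<Longrightarrow> \<psi> (right_act G y a) = \<psi> y * \<pi> a"
  and psi_left: "y \<in> bimod G \<Longrightarrow> a \<in> C0 (verts G) \<Longrightarrow> \<psi> (left_act G a y) = \<pi> a * \<psi> y"
  and psi_inner: "x \<in> bimod G \<Longrightarrow> y \<in> bimod G \<Longrightarrow> (\<psi> x)\<^sup>\<star> * \<psi> y = \<pi> (inner_prod G x y)"
  using rep by (simp_all add: toeplitz_bimod_rep_def)

lemma pi_linear: "linear_on_functions (C0 (verts G)) \<pi>"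
  using pi_hom by (simp add: C0_hom_def)

lemma psi_add: "x \<in> bimod G \<Longrightarrow> y \<in> bimod G \<Longrightarrow> \<psi> (\<lambda>l. x l + y l) = \<psi> x + \<psi> y"
  and psi_scale: "x \<in> bimod G \<Longrightarrow> \<psi> (\<lambda>l. c * x l) = c *\<^sub>C \<psi> x"
  using psi_linear by (simp_all add: linear_on_functions_def)

lemma psi_diff: "x \<in> bimod G \<Longrightarrow> y \<in> bimod G \<Longrightarrow> \<psi> (\<lambda>l. x l - y l) = \<psi> x - \<psi> y"
  using psi_add[OF _ bimod_scale[of y "-1"], of x] psi_scale[of y "-1"]
  by (simp add: cscale_minus_left)

lemma psi_sum:
  assumes "\<And>i. i \<in> I \<Longrightarrow> x i \<in> bimod G"
  shows "\<psi> (\<lambda>l. \<Sum>i\<in>I. x i l) = (\<Sum>i\<in>I. \<psi> (x i))"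
proof -
  have "\<psi> (\<lambda>l. \<Sum>i\<in>I. 1 * x i l) = (\<Sum>i\<in>I. 1 *\<^sub>C \<psi> (x i))"
    by (rule linear_on_functions_sum(1)[OF psi_linear zero_in_bimod bimod_add bimod_scale assms])
  then show ?thesis by simp
qed

lemma psi_norm_le: "x \<in> bimod G \<Longrightarrow> norm (\<psi> x) \<le> bimod_norm G x"
proof -
  assume x: "x \<in> bimod G"
  have "(norm (\<psi> x))\<^sup>2 \<le> (bimod_norm G x)\<^sup>2"
    unfolding cstar_identity[symmetric] psi_inner[OF x x]
    by (rule C0_hom_norm_le[OF pi_hom inner_prod_in_C0[OF x x]])
      (simp add: inner_prod_self[OF x] fibre_norm_le_bimod_norm[OF x])
  then show ?thesis using x by (auto intro: power2_le_imp_le)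
qed

lemma psi_Theta:
  "x \<in> bimod G \<Longrightarrow> y \<in> bimod G \<Longrightarrow> z \<in> bimod G \<Longrightarrow>
    \<psi> (Theta G x y z) = \<psi> x * (\<psi> y)\<^sup>\<star> * \<psi> z"
  by (simp add: Theta_def psi_right inner_prod_in_C0 psi_inner mult.assoc)

text \<open>This is where the homomorphism on compact operators takes its values. The intersection
  reduces statements about members to the generators; \<open>subspace\<close> is real, and complex
  scalars are recovered by moving them into \<open>x\<close>.\<close>

definition rank_one_span :: "'b set" where
  "rank_one_span =
     \<Inter>{S. closed S \<and> subspace S \<and> (\<forall>x\<in>bimod G. \<forall>y\<in>bimod G. \<psi> x * (\<psi> y)\<^sup>\<star> \<in> S)}"

lemma closed_rank_one_span: "closed rank_one_span"
  and subspace_rank_one_span: "subspace rank_one_span"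
  unfolding rank_one_span_def by (auto intro!: closed_Inter subspace_Inter)

lemma rank_one_in_span: "x \<in> bimod G \<Longrightarrow> y \<in> bimod G \<Longrightarrow> \<psi> x * (\<psi> y)\<^sup>\<star> \<in> rank_one_span"
  unfolding rank_one_span_def by blast

text \<open>The preimage of \<open>S\<close> under \<open>f\<close> is a closed subspace, and it
  contains the generators. Stability under complex scaling, adjoints and products are instances of
  this induction principle.\<close>

lemma rank_one_span_image:
  assumes "bounded_linear f" "closed S" "subspace S" "b \<in> rank_one_span"
    and "\<And>x y. x \<in> bimod G \<Longrightarrow> y \<in> bimod G \<Longrightarrow> f (\<psi> x * (\<psi> y)\<^sup>\<star>) \<in> S"
  shows "f b \<in> S"
proof -
  have "closed (f -` S)"
    using assms(1,2) by (intro continuous_closed_vimage linear_continuous_at) auto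
  moreover have "subspace (f -` S)"
    using assms(1,3) by (intro linear_subspace_vimage bounded_linear.linear)
  ultimately show ?thesis
    using assms(4,5) unfolding rank_one_span_def by auto
qed

lemma rank_one_span_cscale: "b \<in> rank_one_span \<Longrightarrow> c *\<^sub>C b \<in> rank_one_span"
  by (rule rank_one_span_image[OF bounded_linear_cscale closed_rank_one_span subspace_rank_one_span])
    (auto simp flip: cscale_mult_left psi_scale intro: rank_one_in_span bimod_scale)

lemma rank_one_span_cstar: "b \<in> rank_one_span \<Longrightarrow> b\<^sup>\<star> \<in> rank_one_span"
  by (rule rank_one_span_image[OF bounded_linear_cstar closed_rank_one_span subspace_rank_one_span])
    (auto simp: cstar_mult cstar_cstar intro: rank_one_in_span)

text \<open>One factor varies at a time. On generators the middle product
  \<open>(\<psi> y)\<^sup>\<star> * \<psi> z\<close> is absorbed into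
  \<open>Theta G x y z\<close>.\<close>

lemma rank_one_span_mult:
  assumes "b \<in> rank_one_span" "d \<in> rank_one_span"
  shows "b * d \<in> rank_one_span"
proof (rule rank_one_span_image[OF bounded_linear_mult_left closed_rank_one_span
      subspace_rank_one_span assms(1)])
  fix x y assume xy: "x \<in> bimod G" "y \<in> bimod G"
  show "\<psi> x * (\<psi> y)\<^sup>\<star> * d \<in> rank_one_span"
  proof (rule rank_one_span_image[OF bounded_linear_mult_right closed_rank_one_span
        subspace_rank_one_span assms(2)])
    fix z w assume zw: "z \<in> bimod G" "w \<in> bimod G"
    have "\<psi> x * (\<psi> y)\<^sup>\<star> * (\<psi> z * (\<psi> w)\<^sup>\<star>) = \<psi> (Theta G x y z) * (\<psi> w)\<^sup>\<star>"
      using xy zw by (simp add: psi_Theta mult.assoc)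
    then show "\<psi> x * (\<psi> y)\<^sup>\<star> * (\<psi> z * (\<psi> w)\<^sup>\<star>) \<in> rank_one_span"
      using xy zw by (simp add: rank_one_in_span Theta_in_bimod)
  qed
qed

text \<open>The adjoint of \<open>b\<close> lies in the span, whose generators all begin with some
  \<open>\<psi> x\<close>, so \<open>b * b\<^sup>\<star>\<close> vanishes. Elements of the span are
  thus determined by their products with the range of \<open>\<psi>\<close>.\<close>

lemma rank_one_span_eq_0:
  assumes "b \<in> rank_one_span" "\<And>x. x \<in> bimod G \<Longrightarrow> b * \<psi> x = 0"
  shows "b = 0"
proof -
  have "b * b\<^sup>\<star> \<in> {0}"
    by (rule rank_one_span_image[OF bounded_linear_mult_right _ _ rank_one_span_cstar[OF assms(1)]])
      (auto simp: assms(2) simp flip: mult.assoc)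
  then show ?thesis
    using cstar_mult_self_eq_0[of "b\<^sup>\<star>"] cstar_cstar[of b] by simp
qed

text \<open>
  This is \<open>\<psi>\<^sup>(\<^sup>1\<^sup>)\<close>: an element of the closed span of the \<open>\<psi> x (\<psi> y)\<^sup>*\<close> is determined by its action
  on the range of \<open>\<psi>\<close>, which makes the algebraic properties immediate.
\<close>

definition psi_compact :: "(('a \<Rightarrow> complex) \<Rightarrow> ('a \<Rightarrow> complex)) \<Rightarrow> 'b" where
  "psi_compact T = (THE b. b \<in> rank_one_span \<and> (\<forall>x\<in>bimod G. b * \<psi> x = \<psi> (T x)))"

lemma psi_compact_eqI:
  assumes "b \<in> rank_one_span" "\<And>x. x \<in> bimod G \<Longrightarrow> b * \<psi> x = \<psi> (T x)"
  shows "psi_compact T = b"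
  unfolding psi_compact_def
proof (rule the_equality)
  fix d assume d: "d \<in> rank_one_span \<and> (\<forall>x\<in>bimod G. d * \<psi> x = \<psi> (T x))"
  then have "d - b \<in> rank_one_span"
    using assms subspace_diff[OF subspace_rank_one_span] by blast
  moreover have "(d - b) * \<psi> x = 0" if "x \<in> bimod G" for x
    using d assms(2)[OF that] that by (simp add: left_diff_distrib)
  ultimately have "d - b = 0"
    by (rule rank_one_span_eq_0)
  then show "d = b" by simp
qed (use assms in auto)

text \<open>
  Contractivity on finite rank operators \<open>K\<close>: writing \<open>Z\<close> for the image of \<open>K\<close>, the powers of
  \<open>Z\<^sup>* Z\<close> grow at most like those of the squared operator norm of \<open>K\<close>.
\<close>

lemma finite_rank_norm_le:
  fixes I :: "'i set"
  assumes xy: "\<And>i. i \<in> I \<Longrightarrow> xs i \<in> bimod G" "\<And>i. i \<in> I \<Longrightarrow> ys i \<in> bimod G"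
    and "\<epsilon> > 0"
    and le: "\<And>z. z \<in> bimod G \<Longrightarrow>
      bimod_norm G (\<lambda>l. \<Sum>i\<in>I. Theta G (xs i) (ys i) z l) \<le> \<epsilon> * bimod_norm G z"
  shows "norm (\<Sum>i\<in>I. \<psi> (xs i) * (\<psi> (ys i))\<^sup>\<star>) \<le> \<epsilon>"
proof -
  define K where "K = (\<lambda>z l. \<Sum>i\<in>I. Theta G (xs i) (ys i) z l)"
  define K' where "K' = (\<lambda>z l. \<Sum>i\<in>I. Theta G (ys i) (xs i) z l)"
  define L where "L = (\<lambda>z. K' (K z))"
  define Z where "Z = (\<Sum>i\<in>I. \<psi> (xs i) * (\<psi> (ys i))\<^sup>\<star>)"
  have K_in: "K z \<in> bimod G" "K' z \<in> bimod G" if "z \<in> bimod G" for z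
    using that xy by (auto simp: K_def K'_def intro!: bimod_sum Theta_in_bimod)
  have ZK: "Z * \<psi> z = \<psi> (K z)" "Z\<^sup>\<star> * \<psi> z = \<psi> (K' z)" if "z \<in> bimod G" for z
    using that xy by (simp_all add: Z_def K_def K'_def psi_sum Theta_in_bimod psi_Theta
        sum_distrib_right cstar_sum cstar_mult cstar_cstar)
  have adj: "inner_prod G (K z) w v = inner_prod G z (K' w) v"
    if "z \<in> bimod G" "w \<in> bimod G" for z w v
  proof -
    have "inner_prod G (K z) w v = cnj (inner_prod G w (K z) v)"
      by (simp add: cnj_inner_prod)
    also have "\<dots> = (\<Sum>i\<in>I. inner_prod G (Theta G (xs i) (ys i) z) w v)"
      using that xy by (simp add: K_def inner_prod_sum_right Theta_in_bimod cnj_sum cnj_inner_prod)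
    also have "\<dots> = inner_prod G z (K' w) v"
      using that xy by (simp add: K'_def inner_prod_sum_right Theta_in_bimod inner_prod_Theta_swap)
    finally show ?thesis .
  qed
  \<comment> \<open>Moving \<open>K'\<close> across the inner product bounds the square of
    \<open>?n\<close> by \<open>\<epsilon> * ?n\<close> times the norm of \<open>z\<close>, and one
    factor \<open>?n\<close> cancels.\<close>
  have le': "bimod_norm G (K' z) \<le> \<epsilon> * bimod_norm G z" if z: "z \<in> bimod G" for z
  proof -
    let ?w = "K' z" and ?n = "bimod_norm G (K' z)"
    have w: "?w \<in> bimod G" using K_in z by blast
    have "fibre_norm G ?w v \<le> \<epsilon> * ?n * bimod_norm G z" for v
    proof -
      have "fibre_norm G ?w v = cmod (inner_prod G (K ?w) z v)"
        using inner_prod_self[OF w, of v] adj[OF w z] by simp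
      also have "\<dots> \<le> bimod_norm G (K ?w) * bimod_norm G z"
        using w z K_in by (intro inner_prod_le_bimod_norm)
      also have "\<dots> \<le> \<epsilon> * ?n * bimod_norm G z"
        using le[OF w] z by (intro mult_right_mono) (auto simp: K_def)
      finally show ?thesis .
    qed
    moreover have nn: "0 \<le> \<epsilon> * ?n * bimod_norm G z"
      using w z \<open>\<epsilon> > 0\<close> by (intro mult_nonneg_nonneg) auto
    ultimately have "?n \<le> sqrt (\<epsilon> * ?n * bimod_norm G z)"
      using w by (intro bimod_norm_leI) auto
    then have "?n\<^sup>2 \<le> \<epsilon> * ?n * bimod_norm G z"
      using w nn by (metis bimod_norm_nonneg power_mono real_sqrt_pow2)
    then have "?n * ?n \<le> ?n * (\<epsilon> * bimod_norm G z)"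
      by (simp add: power2_eq_square ac_simps)
    then show ?thesis
      using z w \<open>\<epsilon> > 0\<close> by (cases "?n = 0") (auto simp: mult_le_cancel_left_pos less_le)
  qed
  have L_in: "L z \<in> bimod G" if "z \<in> bimod G" for z
    using that K_in by (simp add: L_def)
  have L_le: "bimod_norm G (L z) \<le> \<epsilon>\<^sup>2 * bimod_norm G z" if "z \<in> bimod G" for z
  proof -
    have "bimod_norm G (L z) \<le> \<epsilon> * bimod_norm G (K z)"
      using le'[OF K_in(1)[OF that]] by (simp add: L_def)
    also have "\<dots> \<le> \<epsilon> * (\<epsilon> * bimod_norm G z)"
      using le[OF that] \<open>\<epsilon> > 0\<close> by (intro mult_left_mono) (auto simp: K_def)
    finally show ?thesis by (simp add: power2_eq_square mult.assoc)
  qed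
  have Ln: "(L ^^ n) z \<in> bimod G \<and> bimod_norm G ((L ^^ n) z) \<le> \<epsilon> ^ (2 * n) * bimod_norm G z"
    if "z \<in> bimod G" for z n
  proof (induction n)
    case (Suc n)
    then have "bimod_norm G (L ((L ^^ n) z)) \<le> \<epsilon>\<^sup>2 * (\<epsilon> ^ (2 * n) * bimod_norm G z)"
      using L_le[of "(L ^^ n) z"] by (meson mult_left_mono order_trans zero_le_power2)
    with Suc show ?case by (simp add: L_in power2_eq_square mult.assoc)
  qed (use that in simp)
  define A where "A = Z\<^sup>\<star> * Z"
  \<comment> \<open>\<open>An n\<close> is the power of \<open>A\<close> with exponent
    \<open>n + 1\<close>; the shift avoids a unit, which the algebra may not have.\<close>
  define An where "An = (\<lambda>n. ((*) A ^^ n) A)"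
  have An_Suc: "An (Suc n) = A * An n" for n by (simp add: An_def)
  have An_mult: "An m * An n = An (Suc (m + n))" for m n
    by (induction m) (simp_all add: An_Suc mult.assoc, simp add: An_def)
  have An_star: "(An n)\<^sup>\<star> = An n" for n
  proof (induction n)
    case (Suc n)
    have "(An (Suc n))\<^sup>\<star> = An n * An 0"
      using Suc by (simp add: An_Suc cstar_mult) (simp add: An_def A_def cstar_mult cstar_cstar)
    then show ?case by (simp add: An_mult)
  qed (simp add: An_def A_def cstar_mult cstar_cstar)
  have An_eq: "An n = (\<Sum>i\<in>I. \<psi> ((L ^^ n) (K' (xs i))) * (\<psi> (ys i))\<^sup>\<star>)" for n
  proof (induction n)
    case 0
    have "An 0 = (\<Sum>i\<in>I. Z\<^sup>\<star> * \<psi> (xs i) * (\<psi> (ys i))\<^sup>\<star>)"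
      by (simp add: An_def A_def) (simp add: Z_def sum_distrib_left mult.assoc)
    then show ?case using ZK(2) xy by simp
  next
    case (Suc n)
    have "An (Suc n) = (\<Sum>i\<in>I. A * \<psi> ((L ^^ n) (K' (xs i))) * (\<psi> (ys i))\<^sup>\<star>)"
      by (simp add: An_Suc Suc sum_distrib_left mult.assoc)
    also have "\<dots> = (\<Sum>i\<in>I. \<psi> ((L ^^ Suc n) (K' (xs i))) * (\<psi> (ys i))\<^sup>\<star>)"
    proof (rule sum.cong[OF refl])
      fix i assume "i \<in> I"
      then have "(L ^^ n) (K' (xs i)) \<in> bimod G" using Ln K_in xy by blast
      then show "A * \<psi> ((L ^^ n) (K' (xs i))) * (\<psi> (ys i))\<^sup>\<star> =
          \<psi> ((L ^^ Suc n) (K' (xs i))) * (\<psi> (ys i))\<^sup>\<star>"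
        by (simp add: A_def mult.assoc[of "Z\<^sup>\<star>" Z] ZK K_in L_def)
    qed
    finally show ?case .
  qed
  \<comment> \<open>The powers of \<open>A\<close> act through powers of \<open>L\<close> on the
    fixed vectors \<open>K' (xs i)\<close>, so \<open>C\<close> depends on the chosen decomposition
    but not on \<open>n\<close>.\<close>
  define C where "C = (\<Sum>i\<in>I. bimod_norm G (K' (xs i)) * norm (\<psi> (ys i)))"
  have An_le: "norm (An n) \<le> \<epsilon> ^ (2 * n) * C" for n
  proof -
    have "norm (An n) \<le> (\<Sum>i\<in>I. norm (\<psi> ((L ^^ n) (K' (xs i))) * (\<psi> (ys i))\<^sup>\<star>))"
      unfolding An_eq by (rule norm_sum)
    also have "\<dots> \<le> (\<Sum>i\<in>I. \<epsilon> ^ (2 * n) * bimod_norm G (K' (xs i)) * norm (\<psi> (ys i)))"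
    proof (rule sum_mono)
      fix i assume "i \<in> I"
      then have "K' (xs i) \<in> bimod G" using K_in xy by blast
      then have "norm (\<psi> ((L ^^ n) (K' (xs i)))) \<le> \<epsilon> ^ (2 * n) * bimod_norm G (K' (xs i))"
        using Ln psi_norm_le order_trans by blast
      then show "norm (\<psi> ((L ^^ n) (K' (xs i))) * (\<psi> (ys i))\<^sup>\<star>) \<le>
          \<epsilon> ^ (2 * n) * bimod_norm G (K' (xs i)) * norm (\<psi> (ys i))"
        using norm_mult_ineq[of "\<psi> ((L ^^ n) (K' (xs i)))" "(\<psi> (ys i))\<^sup>\<star>"]
        by (simp add: mult_right_mono order_trans)
    qed
    finally show ?thesis by (simp add: C_def sum_distrib_left mult.assoc)
  qed
  \<comment> \<open>Squaring sends the member with index \<open>n\<close> to the one with index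
    \<open>2 n + 1\<close>, as \<open>An n\<close> is self-adjoint; this removes the constant
    \<open>C\<close>.\<close>
  define S where "S = range (\<lambda>n. norm (An n) / \<epsilon> ^ (2 * Suc n))"
  have "bdd_above S"
  proof -
    have "norm (An n) / \<epsilon> ^ (2 * Suc n) \<le> C / \<epsilon>\<^sup>2" for n
      using An_le[of n] \<open>\<epsilon> > 0\<close> by (simp add: field_simps power2_eq_square)
    then show ?thesis unfolding S_def by (rule bdd_aboveI2)
  qed
  moreover have "x\<^sup>2 \<in> S" if "x \<in> S" for x
  proof -
    obtain n where n: "x = norm (An n) / \<epsilon> ^ (2 * Suc n)" using \<open>x \<in> S\<close> unfolding S_def by blast
    have "x\<^sup>2 = norm (An (Suc (n + n))) / \<epsilon> ^ (2 * Suc (Suc (n + n)))"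
    proof -
      have "(\<epsilon> ^ (2 * Suc n))\<^sup>2 = \<epsilon> ^ (2 * Suc (Suc (n + n)))"
        unfolding power_mult[symmetric] by (rule arg_cong) simp
      then show ?thesis
        using norm_self_adjoint_square[OF An_star, of n] by (simp only: n An_mult power_divide)
    qed
    then show ?thesis unfolding S_def by blast
  qed
  moreover have "norm (An 0) / \<epsilon> ^ (2 * Suc 0) \<in> S" unfolding S_def by blast
  ultimately have "norm (An 0) / \<epsilon> ^ (2 * Suc 0) \<le> 1"
    by (rule self_improving_le_1)
  then have "(norm Z)\<^sup>2 \<le> \<epsilon>\<^sup>2"
    using \<open>\<epsilon> > 0\<close> cstar_identity[of Z] by (simp add: An_def A_def divide_le_eq power2_eq_square)
  then show ?thesis
    using \<open>\<epsilon> > 0\<close> by (auto simp: Z_def intro: power2_le_imp_le)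
qed

end

section \<open>Compact operators: coordinate restrictions and diagonal coefficients\<close>

context wf_digraph
begin

lemma bimod_norm_minus: "x \<in> bimod G \<Longrightarrow> bimod_norm G (\<lambda>l. (-1) * x l) \<le> bimod_norm G x"
  using bimod_dominated'(2)[of x "\<lambda>l. (-1) * x l" 1] fibre_norm_le_bimod_norm[of x] bimod_scale[of x "-1"]
  by (intro bimod_norm_leI) (auto simp: bimod_zero_off intro: order_trans)

lemma bimod_norm_zero [simp]: "bimod_norm G (\<lambda>l. 0) = 0"
  by (simp add: bimod_norm_def inner_prod_def)

text \<open>For \<open>F\<close> the edges leaving \<open>v\<close> this is the left action of
  \<open>\<delta> v\<close>; for a finite set of edges it is the sum of the rank one operators
  \<open>Theta G (\<delta> l) (\<delta> l)\<close>.\<close>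

definition restrict_op :: "'b set \<Rightarrow> ('b \<Rightarrow> complex) \<Rightarrow> 'b \<Rightarrow> complex" where
  "restrict_op F = (\<lambda>x\<in>bimod G. \<lambda>l. if l \<in> F then x l else 0)"

lemma Theta_point_mass:
  "m \<in> arcs G \<Longrightarrow> z \<in> bimod G \<Longrightarrow> Theta G (\<delta> m) (\<delta> m) z l = (if l = m then z l else 0)"
  by (simp add: Theta_def right_act_def inner_prod_point_mass) (simp add: point_mass_def)

lemma restrict_op_compact:
  assumes "finite F" "F \<subseteq> arcs G"
  shows "restrict_op F \<in> compacts G"
proof -
  have in_bimod: "restrict_op F \<in> bimod G \<rightarrow>\<^sub>E bimod G"
    by (auto simp: restrict_op_def bimod_restrict)
  moreover have "is_adjoint G (restrict_op F) (restrict_op F)"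
    unfolding is_adjoint_def inner_prod_def restrict_op_def by (auto intro!: infsum_cong)
  ultimately have "restrict_op F \<in> adjointables G"
    unfolding adjointables_def by blast
  moreover have "\<exists>(n::nat) xs ys. (\<forall>i<n. xs i \<in> bimod G \<and> ys i \<in> bimod G) \<and>
     (\<forall>z\<in>bimod G. bimod_norm G (\<lambda>l. restrict_op F z l - (\<Sum>i<n. Theta G (xs i) (ys i) z l))
        \<le> \<epsilon> * bimod_norm G z)" if "\<epsilon> > 0" for \<epsilon>
  proof -
    obtain h where "bij_betw h {0..<card F} F"
      using ex_bij_betw_nat_finite[OF assms(1)] by blast
    then have h: "bij_betw h {..<card F} F" by (simp add: atLeast0LessThan)
    then have h_in: "h i \<in> arcs G" if "i < card F" for i
      using that assms(2) by (auto dest: bij_betwE)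
    have "restrict_op F z l - (\<Sum>i<card F. Theta G (\<delta> (h i)) (\<delta> (h i)) z l) = 0"
      if z: "z \<in> bimod G" for z l
    proof -
      have "(\<Sum>i<card F. Theta G (\<delta> (h i)) (\<delta> (h i)) z l) = (\<Sum>m\<in>F. Theta G (\<delta> m) (\<delta> m) z l)"
        by (rule sum.reindex_bij_betw[OF h])
      also have "\<dots> = (\<Sum>m\<in>F. if l = m then z l else 0)"
        using assms(2) z by (intro sum.cong refl Theta_point_mass) auto
      finally show ?thesis using assms(1) z by (simp add: restrict_op_def)
    qed
    then have "\<forall>z\<in>bimod G. bimod_norm G
        (\<lambda>l. restrict_op F z l - (\<Sum>i<card F. Theta G (\<delta> (h i)) (\<delta> (h i)) z l)) \<le> \<epsilon> * bimod_norm G z"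
      using that by simp
    with h_in show ?thesis
      by (intro exI[of _ "card F"] exI[of _ "\<lambda>i. \<delta> (h i)"]) (auto intro: point_mass_in_bimod)
  qed
  ultimately show ?thesis by (simp add: compacts_def)
qed

text \<open>
  Compactness forces matrix coefficients to vanish at infinity along the diagonal.
\<close>

lemma left_op_compact_finite:
  assumes comp: "left_op G a \<in> compacts G" and "a v \<noteq> 0"
  shows "finite (out_arcs_at G v)"
proof -
  define \<epsilon> where "\<epsilon> = cmod (a v) / 2"
  have "\<epsilon> > 0" using assms by (simp add: \<epsilon>_def)
  then obtain n :: nat and xs ys where xy: "\<And>i. i < n \<Longrightarrow> xs i \<in> bimod G" "\<And>i. i < n \<Longrightarrow> ys i \<in> bimod G"
    and le: "\<And>z. z \<in> bimod G \<Longrightarrow>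
      bimod_norm G (\<lambda>l. left_op G a z l - (\<Sum>i<n. Theta G (xs i) (ys i) z l)) \<le> \<epsilon> * bimod_norm G z"
  proof -
    have "\<exists>(n::nat) xs ys. (\<forall>i<n. xs i \<in> bimod G \<and> ys i \<in> bimod G) \<and>
       (\<forall>z\<in>bimod G. bimod_norm G (\<lambda>l. left_op G a z l - (\<Sum>i<n. Theta G (xs i) (ys i) z l))
          \<le> \<epsilon> * bimod_norm G z)"
      using comp \<open>\<epsilon> > 0\<close> unfolding compacts_def by blast
    then show thesis using that by blast
  qed
  \<comment> \<open>\<open>f l\<close> is the diagonal coefficient at \<open>l\<close> of the finite
    rank approximant and tends to 0, while that of the left action is \<open>a v\<close> on every
    edge leaving \<open>v\<close>. As \<open>\<epsilon>\<close> is half of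
    \<open>cmod (a v)\<close>, the approximation forces \<open>cmod (f l) \<ge> \<epsilon>\<close>
    on these edges.\<close>
  define f where "f = (\<lambda>l. \<Sum>i<n. xs i l * cnj (ys i l))"
  have "(f \<longlongrightarrow> (\<Sum>i<n. 0 * cnj 0)) cofinite"
    unfolding f_def using xy by (intro tendsto_intros bimod_tendsto_0) auto
  then have "\<forall>\<^sub>F l in cofinite. cmod (f l) < \<epsilon>"
    using tendstoD[of f 0 cofinite \<epsilon>] \<open>\<epsilon> > 0\<close> by simp
  then have "finite {l. \<not> cmod (f l) < \<epsilon>}" by (simp add: eventually_cofinite)
  moreover have "out_arcs_at G v \<subseteq> {l. \<not> cmod (f l) < \<epsilon>}"
  proof
    fix l assume "l \<in> out_arcs_at G v"
    then have l: "l \<in> arcs G" "tail G l = v" by (auto simp: out_arcs_at_def)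
    let ?w = "\<lambda>m. left_op G a (\<delta> l) m - (\<Sum>i<n. Theta G (xs i) (ys i) (\<delta> l) m)"
    have "left_op G a (\<delta> l) \<in> bimod G"
      using comp point_mass_in_bimod[OF l(1)] by (auto simp: compacts_def adjointables_def)
    moreover have "(\<lambda>m. \<Sum>i<n. Theta G (xs i) (ys i) (\<delta> l) m) \<in> bimod G"
      using xy l by (intro bimod_sum Theta_in_bimod point_mass_in_bimod) auto
    ultimately have "?w \<in> bimod G"
      using bimod_add[OF _ bimod_scale[where c = "-1"]] by fastforce
    then have "cmod (?w l) \<le> \<epsilon> * bimod_norm G (\<delta> l)"
      using cmod_le_bimod_norm le[OF point_mass_in_bimod[OF l(1)]] order_trans by blast
    also have "\<dots> \<le> \<epsilon>"
      using bimod_norm_point_mass[OF l(1)] \<open>\<epsilon> > 0\<close> by (simp add: mult_left_le)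
    finally have "cmod (?w l) \<le> \<epsilon>" .
    moreover have "inner_prod G (ys i) (\<delta> l) (head G l) = cnj (ys i l)" for i
      by (subst cnj_inner_prod[symmetric]) (simp add: inner_prod_point_mass[OF l(1)])
    then have "?w l = a v - f l"
      using l point_mass_in_bimod[OF l(1)]
      by (simp add: left_op_def left_act_def Theta_def right_act_def f_def) (simp add: point_mass_def)
    moreover have "cmod (a v) \<le> cmod (a v - f l) + cmod (f l)"
      using norm_triangle_ineq[of "a v - f l" "f l"] by simp
    ultimately show "l \<in> {l. \<not> cmod (f l) < \<epsilon>}"
      by (simp add: \<epsilon>_def)
  qed
  ultimately show ?thesis by (rule rev_finite_subset)
qed

end

section \<open>The homomorphism on compact operators and covariance in one degree\<close>

context toeplitz_bimod
begin

text \<open>Finite rank approximants of \<open>T\<close> have explicit images \<open>Z k\<close>.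
  Their differences are finite rank of small norm, so the images form a Cauchy sequence, and the
  limit of \<open>Z k * \<psi> x\<close> identifies the action of the limit.\<close>

lemma psi_compact_exists:
  assumes T: "T \<in> compacts G"
  obtains b where "b \<in> rank_one_span" "\<And>x. x \<in> bimod G \<Longrightarrow> b * \<psi> x = \<psi> (T x)"
proof -
  define e where "e = (\<lambda>k::nat. 1 / real (Suc k))"
  have e: "e k > 0" for k by (simp add: e_def)
  have T_in: "T z \<in> bimod G" if "z \<in> bimod G" for z
    using T that by (auto simp: compacts_def adjointables_def)
  define Q where "Q k n xs ys \<longleftrightarrow> (\<forall>i<n. xs i \<in> bimod G \<and> ys i \<in> bimod G) \<and>
     (\<forall>z\<in>bimod G. bimod_norm G (\<lambda>l. T z l - (\<Sum>i<n. Theta G (xs i) (ys i) z l))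
        \<le> e k * bimod_norm G z)" for k and n :: nat and xs ys
  have "\<exists>n xs ys. Q k n xs ys" for k
    using T e unfolding compacts_def Q_def by blast
  then obtain n xs ys where "\<And>k. Q k (n k) (xs k) (ys k)"
    by metis
  then have xy: "\<And>k i. i < n k \<Longrightarrow> xs k i \<in> bimod G" "\<And>k i. i < n k \<Longrightarrow> ys k i \<in> bimod G"
    and le: "\<And>k z. z \<in> bimod G \<Longrightarrow>
      bimod_norm G (\<lambda>l. T z l - (\<Sum>i<n k. Theta G (xs k i) (ys k i) z l)) \<le> e k * bimod_norm G z"
    unfolding Q_def by blast+
  define K where "K = (\<lambda>k z l. \<Sum>i<n k. Theta G (xs k i) (ys k i) z l)"
  define Z where "Z = (\<lambda>k. \<Sum>i<n k. \<psi> (xs k i) * (\<psi> (ys k i))\<^sup>\<star>)"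
  have K_in: "K k z \<in> bimod G" if "z \<in> bimod G" for k z
    using that xy by (auto simp: K_def intro!: bimod_sum Theta_in_bimod)
  have diff_in: "(\<lambda>l. T z l - K k z l) \<in> bimod G" if "z \<in> bimod G" for k z
    using bimod_add[OF T_in[OF that] bimod_scale[OF K_in[OF that], of "-1"]] by simp
  have le_K: "bimod_norm G (\<lambda>l. T z l - K k z l) \<le> e k * bimod_norm G z" if "z \<in> bimod G" for k z
    using le[OF that] by (simp add: K_def)
  have Z_in: "Z k \<in> rank_one_span" for k
    unfolding Z_def using xy by (intro subspace_sum subspace_rank_one_span rank_one_in_span) auto
  have ZK: "Z k * \<psi> z = \<psi> (K k z)" if "z \<in> bimod G" for z k
  proof -
    have "\<psi> (K k z) = (\<Sum>i<n k. \<psi> (Theta G (xs k i) (ys k i) z))"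
      unfolding K_def by (rule psi_sum) (use that xy Theta_in_bimod in auto)
    also have "\<dots> = (\<Sum>i<n k. \<psi> (xs k i) * (\<psi> (ys k i))\<^sup>\<star> * \<psi> z)"
      by (intro sum.cong refl psi_Theta) (use that xy in auto)
    finally show ?thesis by (simp add: Z_def sum_distrib_right)
  qed
  have Z_diff: "norm (Z k - Z m) \<le> 2 * (e m + e k)" for k m
  proof -
    \<comment> \<open>The difference of two approximants is one finite sum over the disjoint union
      of the index sets, with the sign absorbed into \<open>xs m\<close>. The factor 2 in the bound
      comes from the weak triangle inequality.\<close>
    let ?I = "{..<n k} <+> {..<n m}"
    let ?xs = "case_sum (xs k) (\<lambda>i l. (-1) * xs m i l)" and ?ys = "case_sum (ys k) (ys m)"
    have "norm (\<Sum>i\<in>?I. \<psi> (?xs i) * (\<psi> (?ys i))\<^sup>\<star>) \<le> 2 * (e m + e k)"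
    proof (rule finite_rank_norm_le)
      show "?xs i \<in> bimod G" "?ys i \<in> bimod G" if "i \<in> ?I" for i
        using that xy bimod_scale[of _ "-1"] by auto
      show "0 < 2 * (e m + e k)" using e[of m] e[of k] by simp
      fix z assume z: "z \<in> bimod G"
      have "Theta G (\<lambda>l. (-1) * x l) y z l = - Theta G x y z l" for x y l
        using z by (simp add: Theta_def right_act_def)
      then have "(\<lambda>l. \<Sum>i\<in>?I. Theta G (?xs i) (?ys i) z l) =
          (\<lambda>l. (T z l - K m z l) + (-1) * (T z l - K k z l))"
        by (simp add: sum.Plus K_def sum_negf)
      moreover have "bimod_norm G (\<lambda>l. (T z l - K m z l) + (-1) * (T z l - K k z l)) \<le>
          2 * (e m * bimod_norm G z + e k * bimod_norm G z)"
        by (intro bimod_norm_add_le bimod_scale diff_in z le_K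
            order_trans[OF bimod_norm_minus[OF diff_in[OF z]] le_K[OF z]])
      ultimately show "bimod_norm G (\<lambda>l. \<Sum>i\<in>?I. Theta G (?xs i) (?ys i) z l)
          \<le> 2 * (e m + e k) * bimod_norm G z"
        by (simp add: algebra_simps)
    qed
    moreover have "(\<Sum>i\<in>?I. \<psi> (?xs i) * (\<psi> (?ys i))\<^sup>\<star>) = Z k - Z m"
    proof -
      have "(\<Sum>i<n m. \<psi> (\<lambda>l. (-1) * xs m i l) * (\<psi> (ys m i))\<^sup>\<star>) = - Z m"
        unfolding Z_def sum_negf[symmetric]
      proof (rule sum.cong[OF refl])
        fix i assume "i \<in> {..<n m}"
        then show "\<psi> (\<lambda>l. (-1) * xs m i l) * (\<psi> (ys m i))\<^sup>\<star> = - (\<psi> (xs m i) * (\<psi> (ys m i))\<^sup>\<star>)"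
          using psi_scale[OF xy(1)[of i m], of "-1"] by (simp add: cscale_minus_left)
      qed
      then show ?thesis by (simp add: sum.Plus Z_def)
    qed
    ultimately show ?thesis by simp
  qed
  have e_tendsto: "e \<longlonglongrightarrow> 0"
    unfolding e_def by (rule lim_1_over_n[THEN LIMSEQ_Suc])
  have "Cauchy Z"
  proof (rule CauchyI)
    fix r :: real assume "r > 0"
    then obtain M where "\<forall>k\<ge>M. norm (e k - 0) < r / 4"
      using LIMSEQ_D[OF e_tendsto, of "r / 4"] by auto
    then have M: "e k < r / 4" if "k \<ge> M" for k
      using that by (force simp: abs_less_iff)
    have "norm (Z k - Z m) < r" if "k \<ge> M" "m \<ge> M" for k m
      using Z_diff[of k m] add_strict_mono[OF M[OF that(2)] M[OF that(1)]]
      by (simp add: order_le_less_trans)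
    then show "\<exists>M. \<forall>m\<ge>M. \<forall>n\<ge>M. norm (Z m - Z n) < r" by blast
  qed
  then obtain b where b: "Z \<longlonglongrightarrow> b"
    using Cauchy_convergent_iff convergent_def by blast
  show ?thesis
  proof
    show "b \<in> rank_one_span"
      using closed_sequentially[OF closed_rank_one_span Z_in b] .
    fix x assume x: "x \<in> bimod G"
    have "(\<lambda>k. Z k * \<psi> x) \<longlonglongrightarrow> b * \<psi> x"
      using b by (intro tendsto_intros)
    moreover have "(\<lambda>k. Z k * \<psi> x) \<longlonglongrightarrow> \<psi> (T x)"
    proof (rule LIM_zero_cancel, rule Lim_null_comparison)
      have "norm (Z k * \<psi> x - \<psi> (T x)) \<le> e k * bimod_norm G x" for k
      proof -
        have "norm (Z k * \<psi> x - \<psi> (T x)) = norm (\<psi> (\<lambda>l. T x l - K k x l))"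
          using x by (simp add: ZK psi_diff T_in K_in norm_minus_commute)
        also have "\<dots> \<le> e k * bimod_norm G x"
          using psi_norm_le[OF diff_in[OF x]] le_K[OF x] order_trans by blast
        finally show ?thesis .
      qed
      then show "\<forall>\<^sub>F k in sequentially. norm (Z k * \<psi> x - \<psi> (T x)) \<le> e k * bimod_norm G x"
        by simp
      show "(\<lambda>k. e k * bimod_norm G x) \<longlonglongrightarrow> 0"
        using tendsto_mult_right[OF e_tendsto, of "bimod_norm G x"] by simp
    qed
    ultimately show "b * \<psi> x = \<psi> (T x)" by (rule LIMSEQ_unique)
  qed
qed

lemma psi_compact:
  assumes "T \<in> compacts G"
  shows psi_compact_in_span: "psi_compact T \<in> rank_one_span"
    and psi_compact_mult: "x \<in> bimod G \<Longrightarrow> psi_compact T * \<psi> x = \<psi> (T x)"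
proof -
  obtain b where b: "b \<in> rank_one_span" "\<And>x. x \<in> bimod G \<Longrightarrow> b * \<psi> x = \<psi> (T x)"
    using psi_compact_exists[OF assms] by blast
  then have "psi_compact T = b" by (rule psi_compact_eqI)
  with b show "psi_compact T \<in> rank_one_span" 
    "x \<in> bimod G \<Longrightarrow> psi_compact T * \<psi> x = \<psi> (T x)" by auto
qed

text \<open>Sums, multiples and products are respected because both sides lie in the span and act
  alike on the range of \<open>\<psi>\<close>. For adjoints only the compressions
  \<open>(\<psi> y)\<^sup>\<star> * c * \<psi> x\<close> of the difference \<open>c\<close> can be
  computed directly, so one more step is needed.\<close>

lemma induced_hom_psi_compact: "induced_hom G \<psi> psi_compact"
proof -
  have T_in: "T x \<in> bimod G" if "T \<in> compacts G" "x \<in> bimod G" for T x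
    using that by (auto simp: compacts_def adjointables_def)
  have "psi_compact (op_add G T S) = psi_compact T + psi_compact S"
    if "T \<in> compacts G" "S \<in> compacts G" for T S
    using that by (intro psi_compact_eqI subspace_add[OF subspace_rank_one_span] psi_compact_in_span)
      (simp_all add: op_add_def psi_add T_in distrib_right psi_compact_mult)
  moreover have "psi_compact (op_scale G c T) = c *\<^sub>C psi_compact T" if "T \<in> compacts G" for c T
    using that by (intro psi_compact_eqI rank_one_span_cscale psi_compact_in_span)
      (simp_all add: op_scale_def psi_scale T_in cscale_mult_left psi_compact_mult)
  moreover have "psi_compact (compose (bimod G) T S) = psi_compact T * psi_compact S"
    if "T \<in> compacts G" "S \<in> compacts G" for T S
    using that by (intro psi_compact_eqI rank_one_span_mult psi_compact_in_span)
      (simp_all add: compose_eq T_in mult.assoc psi_compact_mult)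
  moreover have "psi_compact S = (psi_compact T)\<^sup>\<star>"
    if TS: "T \<in> compacts G" "S \<in> compacts G" and adj: "is_adjoint G T S" for T S
  proof -
    define c where "c = psi_compact S - (psi_compact T)\<^sup>\<star>"
    have c_in: "c \<in> rank_one_span"
      unfolding c_def using TS
      by (intro subspace_diff[OF subspace_rank_one_span] rank_one_span_cstar psi_compact_in_span)
    have zero: "(\<psi> y)\<^sup>\<star> * (c * \<psi> x) = 0" if "x \<in> bimod G" "y \<in> bimod G" for x y
    proof -
      have "(\<psi> y)\<^sup>\<star> * ((psi_compact T)\<^sup>\<star> * \<psi> x) = (psi_compact T * \<psi> y)\<^sup>\<star> * \<psi> x"
        by (simp add: cstar_mult mult.assoc)
      also have "\<dots> = \<pi> (inner_prod G (T y) x)"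
        using that TS by (simp add: psi_compact_mult psi_inner T_in)
      also have "inner_prod G (T y) x = inner_prod G y (S x)"
        using that adj by (simp add: is_adjoint_def)
      also have "\<pi> \<dots> = (\<psi> y)\<^sup>\<star> * (psi_compact S * \<psi> x)"
        using that TS by (simp add: psi_compact_mult psi_inner T_in)
      finally show ?thesis by (simp add: c_def left_diff_distrib right_diff_distrib)
    qed
    have "c * \<psi> x = 0" if x: "x \<in> bimod G" for x
    proof -
      \<comment> \<open>The left factor lies in the span, whose generators end in some
        \<open>(\<psi> y)\<^sup>\<star>\<close>, and these meet a vanishing compression.\<close>
      have "(c\<^sup>\<star> * (c * \<psi> x)) \<in> {0}"
        by (rule rank_one_span_image[OF bounded_linear_mult_left _ _ rank_one_span_cstar[OF c_in]])
          (use zero x in \<open>auto simp: mult.assoc\<close>)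
      then have "(c * \<psi> x)\<^sup>\<star> * (c * \<psi> x) = 0"
        by (simp add: cstar_mult mult.assoc)
      then show ?thesis by (simp only: cstar_mult_self_eq_0)
    qed
    then have "c = 0" by (rule rank_one_span_eq_0[OF c_in])
    then show ?thesis by (simp add: c_def)
  qed
  moreover have "psi_compact (Theta G x y) = \<psi> x * (\<psi> y)\<^sup>\<star>" if "x \<in> bimod G" "y \<in> bimod G" for x y
    using that by (intro psi_compact_eqI rank_one_in_span) (simp_all add: psi_Theta)
  ultimately show ?thesis
    unfolding induced_hom_def compacts_hom_def by blast
qed

text \<open>Stated for an arbitrary induced homomorphism, because covariance only provides some
  \<open>\<rho>\<close>. Restriction to finitely many edges is a sum of rank one operators, on which
  \<open>\<rho>\<close> is prescribed.\<close>

lemma induced_hom_restrict_op: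
  assumes "induced_hom G \<psi> \<rho>" "finite F" "F \<subseteq> arcs G"
  shows "\<rho> (restrict_op F) = (\<Sum>l\<in>F. \<psi> (\<delta> l) * (\<psi> (\<delta> l))\<^sup>\<star>)"
  using assms(2,3)
proof (induction F rule: finite_induct)
  case empty
  \<comment> \<open>The zero operator is fixed by scaling with 0, which forces its image to be
    0.\<close>
  have "op_scale G 0 (restrict_op {}) = restrict_op {}"
    by (auto simp: op_scale_def restrict_op_def)
  moreover have "\<rho> (op_scale G 0 (restrict_op {})) = 0 *\<^sub>C \<rho> (restrict_op {})"
    using assms(1) restrict_op_compact[of "{}"] by (auto simp: induced_hom_def compacts_hom_def)
  ultimately show ?case by simp
next
  case (insert l F)
  have "op_add G (restrict_op {l}) (restrict_op F) = restrict_op (insert l F)"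
    using insert.hyps by (auto simp: op_add_def restrict_op_def fun_eq_iff)
  moreover have "Theta G (\<delta> l) (\<delta> l) = restrict_op {l}"
  proof
    fix z
    show "Theta G (\<delta> l) (\<delta> l) z = restrict_op {l} z"
      using insert.prems Theta_point_mass[of l z]
      by (cases "z \<in> bimod G") (auto simp: restrict_op_def Theta_def)
  qed
  moreover have "\<rho> (op_add G (restrict_op {l}) (restrict_op F)) = \<rho> (restrict_op {l}) + \<rho> (restrict_op F)"
    using assms(1) restrict_op_compact[of "{l}"] restrict_op_compact[of F] insert.hyps insert.prems
    by (auto simp: induced_hom_def compacts_hom_def)
  ultimately have "\<rho> (restrict_op (insert l F)) = \<rho> (Theta G (\<delta> l) (\<delta> l)) + \<rho> (restrict_op F)"
    by simp
  then show ?case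
    using assms(1) insert by (simp add: induced_hom_def point_mass_in_bimod)
qed

text \<open>Truncating \<open>a\<close> to the finitely many vertices where it is not small changes
  \<open>\<pi> a\<close> by little, as \<open>\<pi>\<close> is contractive, and the truncation is a
  finite combination of point masses.\<close>

lemma pi_in_rank_one_span:
  assumes a: "a \<in> C0 (verts G)"
    and s: "\<And>v. a v \<noteq> 0 \<Longrightarrow> \<pi> (\<delta> v) \<in> rank_one_span"
  shows "\<pi> a \<in> rank_one_span"
proof (rule closed_approachable[OF closed_rank_one_span, THEN iffD1], intro allI impI)
  fix \<epsilon> :: real assume "\<epsilon> > 0"
  define F where "F = {v. \<not> cmod (a v) < \<epsilon> / 2}"
  have "\<forall>\<^sub>F v in cofinite. cmod (a v) < \<epsilon> / 2"
    using a \<open>\<epsilon> > 0\<close> tendstoD[of a 0 cofinite "\<epsilon> / 2"] by (simp add: C0_iff)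
  then have "finite F" by (simp add: eventually_cofinite F_def)
  have nz: "a v \<noteq> 0" if "v \<in> F" for v
    using that \<open>\<epsilon> > 0\<close> by (auto simp: F_def)
  then have F_in: "v \<in> verts G" if "v \<in> F" for v
    using that a by (auto simp: C0_iff)
  let ?b = "\<lambda>v. \<Sum>w\<in>F. a w * \<delta> w v"
  have pi_b: "\<pi> ?b = (\<Sum>w\<in>F. a w *\<^sub>C \<pi> (\<delta> w))" and b_in: "?b \<in> C0 (verts G)"
    by (rule linear_on_functions_sum[OF pi_linear C0_zero C0_add C0_scale],
        assumption+, rule point_mass_in_C0, rule F_in, assumption)+
  have b_eq: "?b v = (if v \<in> F then a v else 0)" for v
    using \<open>finite F\<close> by (simp add: point_mass_def if_distrib[of "(*) _"] cong: if_cong)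
  have diff_in: "(\<lambda>v. a v + (-1) * ?b v) \<in> C0 (verts G)"
    using a b_in by (intro C0_add C0_scale)
  have "\<pi> (\<lambda>v. a v + (-1) * ?b v) = \<pi> a - \<pi> ?b"
  proof -
    have "\<pi> (\<lambda>v. a v + (-1) * ?b v) = \<pi> a + \<pi> (\<lambda>v. (-1) * ?b v)"
      by (rule conjunct1[OF pi_linear[unfolded linear_on_functions_def], rule_format, OF a C0_scale[OF b_in]])
    also have "\<pi> (\<lambda>v. (-1) * ?b v) = (-1) *\<^sub>C \<pi> ?b"
      by (rule conjunct2[OF pi_linear[unfolded linear_on_functions_def], rule_format, OF b_in])
    finally show ?thesis by (simp add: cscale_minus_left)
  qed
  moreover have "norm (\<pi> (\<lambda>v. a v + (-1) * ?b v)) \<le> \<epsilon> / 2"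
  proof (rule C0_hom_norm_le[OF pi_hom diff_in])
    show "cmod (a v + (-1) * ?b v) \<le> \<epsilon> / 2" for v
      unfolding b_eq using \<open>\<epsilon> > 0\<close> by (cases "v \<in> F") (auto simp: F_def)
  qed
  ultimately have "dist (\<pi> ?b) (\<pi> a) < \<epsilon>"
    using \<open>\<epsilon> > 0\<close> by (simp add: dist_norm norm_minus_commute)
  moreover have "\<pi> ?b \<in> rank_one_span"
    unfolding pi_b by (intro subspace_sum[OF subspace_rank_one_span] rank_one_span_cscale s nz)
  ultimately show "\<exists>y\<in>rank_one_span. dist y (\<pi> a) < \<epsilon>" by blast
qed

text \<open>From right to left the only question is whether \<open>\<pi> a\<close> lies in the span:
  its products with the range of \<open>\<psi>\<close> are already those prescribed by
  \<open>left_op G a\<close>. At a vertex without outgoing edges the sum is empty and the condition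
  reads \<open>\<pi> (\<delta> v) = 0\<close>.\<close>

theorem cp_covariant_bimod_iff:
  "cp_covariant_bimod G \<psi> \<pi> \<longleftrightarrow> (\<forall>v\<in>verts G. finite (out_arcs_at G v) \<longrightarrow>
     \<pi> (\<delta> v) = (\<Sum>l\<in>out_arcs_at G v. \<psi> (\<delta> l) * (\<psi> (\<delta> l))\<^sup>\<star>))" (is "?L \<longleftrightarrow> ?R")
proof
  assume ?L
  then obtain \<rho> where \<rho>: "induced_hom G \<psi> \<rho>"
    and cov: "\<And>a. a \<in> C0 (verts G) \<Longrightarrow> left_op G a \<in> compacts G \<Longrightarrow> \<rho> (left_op G a) = \<pi> a"
    by (auto simp: cp_covariant_bimod_def)
  show ?R
  proof (intro ballI impI)
    fix v assume v: "v \<in> verts G" and fin: "finite (out_arcs_at G v)"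
    have "left_op G (\<delta> v) = restrict_op (out_arcs_at G v)"
      by (auto simp: left_op_def restrict_op_def left_act_def out_arcs_at_def point_mass_def
          fun_eq_iff bimod_zero_off)
    moreover have sub: "out_arcs_at G v \<subseteq> arcs G" by (auto simp: out_arcs_at_def)
    ultimately show "\<pi> (\<delta> v) = (\<Sum>l\<in>out_arcs_at G v. \<psi> (\<delta> l) * (\<psi> (\<delta> l))\<^sup>\<star>)"
      using cov[OF point_mass_in_C0[OF v]] restrict_op_compact[OF fin sub]
        induced_hom_restrict_op[OF \<rho> fin sub] by simp
  qed
next
  assume R: ?R
  have "psi_compact (left_op G a) = \<pi> a" if a: "a \<in> C0 (verts G)" and comp: "left_op G a \<in> compacts G" for a
  proof (rule psi_compact_eqI)
    show "\<pi> a \<in> rank_one_span"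
    proof (rule pi_in_rank_one_span[OF a])
      fix v assume nz: "a v \<noteq> 0"
      then have "v \<in> verts G" using a by (auto simp: C0_iff)
      then have "\<pi> (\<delta> v) = (\<Sum>l\<in>out_arcs_at G v. \<psi> (\<delta> l) * (\<psi> (\<delta> l))\<^sup>\<star>)"
        using R left_op_compact_finite[OF comp nz] by blast
      then show "\<pi> (\<delta> v) \<in> rank_one_span"
        by (auto simp: out_arcs_at_def
            intro!: subspace_sum[OF subspace_rank_one_span] rank_one_in_span point_mass_in_bimod)
    qed
  qed (simp add: left_op_def psi_left a)
  with induced_hom_psi_compact show ?L
    unfolding cp_covariant_bimod_def by blast
qed

end

section \<open>Toeplitz families\<close>

text \<open>Any two finite sums containing \<open>F0\<close> differ from the sum over
  \<open>F0\<close> by small amounts, so the net of finite sums is Cauchy and completeness gives the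
  limit.\<close>

lemma summable_on_Cauchy_criterion:
  fixes f :: "'a \<Rightarrow> 'b::banach"
  assumes "\<And>\<epsilon>. \<epsilon> > 0 \<Longrightarrow> \<exists>F0. finite F0 \<and> F0 \<subseteq> A \<and>
    (\<forall>F. finite F \<and> F \<subseteq> A - F0 \<longrightarrow> norm (sum f F) < \<epsilon>)"
  shows "f summable_on A"
proof -
  have "\<exists>P. eventually P (finite_subsets_at_top A) \<and> (\<forall>F F'. P F \<and> P F' \<longrightarrow> dist (sum f F) (sum f F') < \<epsilon>)"
    if \<epsilon>: "\<epsilon> > 0" for \<epsilon>
  proof -
    obtain F0 where F0: "finite F0" "F0 \<subseteq> A"
      "\<forall>F. finite F \<and> F \<subseteq> A - F0 \<longrightarrow> norm (sum f F) < \<epsilon> / 2"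
      using assms[OF half_gt_zero[OF \<epsilon>]] by (elim exE conjE)
    let ?P = "\<lambda>F. finite F \<and> F0 \<subseteq> F \<and> F \<subseteq> A"
    have "eventually ?P (finite_subsets_at_top A)"
      using F0 by (auto simp: eventually_finite_subsets_at_top)
    moreover have "dist (sum f F) (sum f F') < \<epsilon>" if "?P F" "?P F'" for F F'
    proof -
      have near: "norm (sum f H - sum f F0) < \<epsilon> / 2" if H: "?P H" for H
      proof -
        have "norm (sum f (H - F0)) < \<epsilon> / 2"
          using F0(3) H by blast
        then show ?thesis using H by (simp add: sum_diff)
      qed
      have "dist (sum f F) (sum f F') \<le> dist (sum f F) (sum f F0) + dist (sum f F') (sum f F0)"
        by (rule dist_triangle2)
      with near[OF that(1)] near[OF that(2)] show ?thesis unfolding dist_norm by argo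
    qed
    ultimately show ?thesis by (intro exI[of _ ?P]) simp
  qed
  then have "cauchy_filter (filtermap (sum f) (finite_subsets_at_top A))"
    by (simp add: cauchy_filter_metric_filtermap)
  moreover have "complete (UNIV::'b set)"
    by (meson Cauchy_convergent UNIV_I complete_def convergent_def)
  ultimately obtain L where "(sum f \<longlongrightarrow> L) (finite_subsets_at_top A)"
    using complete_uniform[where S=UNIV] by (force simp add: filterlim_def)
  then show ?thesis
    using summable_on_def has_sum_def by blast
qed

lemma infsum_bounded_linear_summable:
  assumes "bounded_linear h" "f summable_on A"
  shows "(\<Sum>\<^sub>\<infinity>x\<in>A. h (f x)) = h (infsum f A)"
  using assms by (simp add: infsum_bounded_linear_strong summable_on_bounded_linear)

lemma infsum_single:
  fixes f :: "'a \<Rightarrow> 'b::real_normed_vector"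
  assumes "a \<in> A" "\<And>x. x \<in> A \<Longrightarrow> x \<noteq> a \<Longrightarrow> f x = 0"
  shows "infsum f A = f a"
proof -
  have "infsum f A = infsum f {a}"
    by (rule infsum_cong_neutral) (use assms in auto)
  then show ?thesis by simp
qed

text \<open>The relations of a single degree, with orthogonality of edges built into
  \<open>S_inner\<close>. Both the family read off from a representation and a given Toeplitz family
  are brought into this form.\<close>

locale graph_family = wf_digraph G
  for G :: "('v, 'a) pre_digraph" +
  fixes t :: "'v \<Rightarrow> 'b::cstar_algebra" and S :: "'a \<Rightarrow> 'b"
  assumes t_proj: "v \<in> verts G \<Longrightarrow> projection (t v)"
    and t_orth: "v \<in> verts G \<Longrightarrow> w \<in> verts G \<Longrightarrow> v \<noteq> w \<Longrightarrow> t v * t w = 0"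
    and S_inner: "l \<in> arcs G \<Longrightarrow> m \<in> arcs G \<Longrightarrow> (S l)\<^sup>\<star> * S m = (if l = m then t (head G l) else 0)"
    and S_tail: "l \<in> arcs G \<Longrightarrow> t (tail G l) * S l = S l"
    and S_head: "l \<in> arcs G \<Longrightarrow> S l * t (head G l) = S l"
begin

text \<open>The C*-identity replaces the coefficients by their squared moduli, so the norms arising
  from coefficients of modulus at most 1 form a set stable under squaring, bounded by the sum of the
  norms of the \<open>t v\<close>.\<close>

lemma norm_sum_projections_le:
  assumes F: "finite F" "F \<subseteq> verts G" and c: "\<And>v. v \<in> F \<Longrightarrow> cmod (c v) \<le> M" and "0 \<le> M"
  shows "norm (\<Sum>v\<in>F. c v *\<^sub>C t v) \<le> M"
proof -
  define T where "T = {norm (\<Sum>v\<in>F. c v *\<^sub>C t v) |c. \<forall>v\<in>F. cmod (c v) \<le> 1}"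
  have le_1: "norm (\<Sum>v\<in>F. c v *\<^sub>C t v) \<le> 1" if "\<And>v. v \<in> F \<Longrightarrow> cmod (c v) \<le> 1" for c
  proof (rule self_improving_le_1)
    show "bdd_above T"
    proof (rule bdd_aboveI)
      fix x assume "x \<in> T"
      then obtain c where c: "x = norm (\<Sum>v\<in>F. c v *\<^sub>C t v)" "\<forall>v\<in>F. cmod (c v) \<le> 1"
        by (auto simp: T_def)
      have "x \<le> (\<Sum>v\<in>F. norm (c v *\<^sub>C t v))" unfolding c(1) by (rule norm_sum)
      also have "\<dots> \<le> (\<Sum>v\<in>F. norm (t v))"
        using c(2) by (intro sum_mono) (simp add: norm_cscale mult_left_le_one_le)
      finally show "x \<le> (\<Sum>v\<in>F. norm (t v))" .
    qed
    show "norm (\<Sum>v\<in>F. c v *\<^sub>C t v) \<in> T" using that by (auto simp: T_def)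
    fix x assume "x \<in> T"
    then obtain c where c: "x = norm (\<Sum>v\<in>F. c v *\<^sub>C t v)" "\<forall>v\<in>F. cmod (c v) \<le> 1"
      by (auto simp: T_def)
    have "(\<Sum>v\<in>F. c v *\<^sub>C t v)\<^sup>\<star> * (\<Sum>v\<in>F. c v *\<^sub>C t v) =
        (\<Sum>v\<in>F. \<Sum>w\<in>F. (cnj (c v) * c w) *\<^sub>C (t v * t w))"
    proof -
      have "(c v *\<^sub>C t v)\<^sup>\<star> * (c w *\<^sub>C t w) = (cnj (c v) * c w) *\<^sub>C (t v * t w)" if "v \<in> F" for v w
        using t_proj[OF subsetD[OF F(2) that]] by (simp add: cstar_cscale projection_def
            cscale_mult_left cscale_mult_right cscale_cscale mult.commute)
      then show ?thesis by (simp add: cstar_sum sum_product)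
    qed
    also have "\<dots> = (\<Sum>v\<in>F. \<Sum>w\<in>F. if v = w then (cnj (c v) * c v) *\<^sub>C t v else 0)"
      using F t_proj t_orth by (intro sum.cong refl) (auto simp: projection_def subset_iff)
    also have "\<dots> = (\<Sum>v\<in>F. (cnj (c v) * c v) *\<^sub>C t v)"
      using F by (simp add: sum.delta')
    finally have "x\<^sup>2 = norm (\<Sum>v\<in>F. (cnj (c v) * c v) *\<^sub>C t v)"
      unfolding c(1) by (simp flip: cstar_identity)
    moreover have "\<forall>v\<in>F. cmod (cnj (c v) * c v) \<le> 1"
      using c(2) by (auto simp: norm_mult mult_le_one)
    ultimately show "x\<^sup>2 \<in> T" unfolding T_def mem_Collect_eq by (intro exI[of _ "\<lambda>v. cnj (c v) * c v"] conjI)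
  qed
  show ?thesis
  proof (cases "M = 0")
    case True
    then show ?thesis using c by simp
  next
    case False
    then have "norm (\<Sum>v\<in>F. (c v / of_real M) *\<^sub>C t v) \<le> 1"
      using c \<open>0 \<le> M\<close> by (intro le_1) (auto simp: norm_divide)
    moreover have "(\<Sum>v\<in>F. c v *\<^sub>C t v) = of_real M *\<^sub>C (\<Sum>v\<in>F. (c v / of_real M) *\<^sub>C t v)"
      using False by (simp add: cscale_sum_right cscale_cscale)
    ultimately show ?thesis
      using \<open>0 \<le> M\<close> by (simp add: norm_cscale mult_left_le)
  qed
qed

text \<open>By orthogonality the squared norm is that of a combination of vertex projections, the
  coefficient at \<open>v\<close> being the mass of \<open>x\<close> on the edges of
  \<open>F\<close> ending at \<open>v\<close>. The bound is therefore a supremum over vertices, not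
  a sum.\<close>

lemma norm_sum_arcs_le:
  assumes F: "finite F" "F \<subseteq> arcs G" and "0 \<le> M"
    and le: "\<And>v. (\<Sum>l | l \<in> F \<and> head G l = v. (cmod (x l))\<^sup>2) \<le> M\<^sup>2"
  shows "norm (\<Sum>l\<in>F. x l *\<^sub>C S l) \<le> M"
proof -
  let ?n = "\<lambda>v. \<Sum>l | l \<in> F \<and> head G l = v. complex_of_real ((cmod (x l))\<^sup>2)"
  have "(\<Sum>l\<in>F. x l *\<^sub>C S l)\<^sup>\<star> * (\<Sum>l\<in>F. x l *\<^sub>C S l) =
      (\<Sum>l\<in>F. \<Sum>m\<in>F. (cnj (x l) * x m) *\<^sub>C ((S l)\<^sup>\<star> * S m))"
    by (simp add: cstar_sum sum_product cstar_cscale cscale_mult_left cscale_mult_right cscale_cscale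
        mult.commute)
  also have "\<dots> = (\<Sum>l\<in>F. \<Sum>m\<in>F. if l = m then (cnj (x l) * x l) *\<^sub>C t (head G l) else 0)"
    using F by (intro sum.cong refl) (auto simp: S_inner subset_iff)
  also have "\<dots> = (\<Sum>l\<in>F. (cnj (x l) * x l) *\<^sub>C t (head G l))"
    using F by (simp add: sum.delta')
  also have "\<dots> = (\<Sum>l\<in>F. complex_of_real ((cmod (x l))\<^sup>2) *\<^sub>C t (head G l))"
    by (simp only: complex_norm_square mult.commute)
  also have "\<dots> = (\<Sum>v\<in>head G ` F. \<Sum>l | l \<in> F \<and> head G l = v. complex_of_real ((cmod (x l))\<^sup>2) *\<^sub>C t (head G l))"
    by (rule sum.image_gen[OF F(1)])
  also have "\<dots> = (\<Sum>v\<in>head G ` F. ?n v *\<^sub>C t v)"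
    by (intro sum.cong refl) (simp add: cscale_sum_left)
  finally have "(norm (\<Sum>l\<in>F. x l *\<^sub>C S l))\<^sup>2 = norm (\<Sum>v\<in>head G ` F. ?n v *\<^sub>C t v)"
    by (simp flip: cstar_identity)
  also have "\<dots> \<le> M\<^sup>2"
  proof (rule norm_sum_projections_le)
    fix v
    have "cmod (?n v) = (\<Sum>l | l \<in> F \<and> head G l = v. (cmod (x l))\<^sup>2)"
      by (simp add: sum_nonneg flip: of_real_sum of_real_power)
    then show "cmod (?n v) \<le> M\<^sup>2" using le[of v] by simp
  qed (use F head_in_verts in auto)
  finally show ?thesis using \<open>0 \<le> M\<close> by (rule power2_le_imp_le)
qed

lemma family_summable:
  assumes x: "x \<in> bimod G"
  shows "(\<lambda>l. x l *\<^sub>C S l) summable_on arcs G"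
proof (rule summable_on_Cauchy_criterion)
  fix \<epsilon> :: real assume "\<epsilon> > 0"
  define \<eta> where "\<eta> = \<epsilon> / 2"
  have \<eta>: "\<eta> > 0" using \<open>\<epsilon> > 0\<close> by (simp add: \<eta>_def)
  define W where "W = {v. \<not> fibre_norm G x v < \<eta>\<^sup>2}"
  have "\<forall>\<^sub>F v in cofinite. fibre_norm G x v < \<eta>\<^sup>2"
    using tendstoD[OF bimod_tendsto[OF x], of "\<eta>\<^sup>2"] \<eta> by simp
  then have "finite W" by (simp add: eventually_cofinite W_def)
  define Q where "Q v H \<longleftrightarrow> finite H \<and> H \<subseteq> fibre G v \<and>
    dist (\<Sum>l\<in>H. (cmod (x l))\<^sup>2) (fibre_norm G x v) \<le> \<eta>\<^sup>2" for v H
  have "\<exists>H. Q v H" for v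
    using infsum_finite_approximation[OF bimod_summable[OF x], of "\<eta>\<^sup>2" v] \<eta>
    by (auto simp: fibre_norm_def Q_def)
  then obtain H where "\<And>v. Q v (H v)"
    by metis
  then have H: "finite (H v)" "H v \<subseteq> fibre G v"
    "dist (\<Sum>l\<in>H v. (cmod (x l))\<^sup>2) (fibre_norm G x v) \<le> \<eta>\<^sup>2" for v
    unfolding Q_def by blast+
  \<comment> \<open>Outside the finite set \<open>W\<close> whole fibres are small, and over
    \<open>W\<close> the sets \<open>H v\<close> exhaust the fibres up to
    \<open>\<eta>\<^sup>2\<close>. Avoiding \<open>?F0\<close> thus leaves mass at most
    \<open>\<eta>\<^sup>2\<close> over every vertex at once.\<close>
  let ?F0 = "\<Union>v\<in>W. H v"
  have "norm (\<Sum>l\<in>F. x l *\<^sub>C S l) < \<epsilon>" if F: "finite F" "F \<subseteq> arcs G - ?F0" for F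
  proof -
    have "norm (\<Sum>l\<in>F. x l *\<^sub>C S l) \<le> \<eta>"
    proof (rule norm_sum_arcs_le)
      fix v
      let ?Fv = "{l \<in> F. head G l = v}"
      show "(\<Sum>l\<in>?Fv. (cmod (x l))\<^sup>2) \<le> \<eta>\<^sup>2"
      proof (cases "v \<in> W")
        case True
        then have disj: "H v \<inter> ?Fv = {}" using F by auto
        have "(\<Sum>l\<in>H v. (cmod (x l))\<^sup>2) + (\<Sum>l\<in>?Fv. (cmod (x l))\<^sup>2) = (\<Sum>l\<in>H v \<union> ?Fv. (cmod (x l))\<^sup>2)"
          using H F disj by (intro sum.union_disjoint[symmetric]) auto
        also have "\<dots> \<le> fibre_norm G x v"
          unfolding fibre_norm_def using H F by (intro finite_sum_le_infsum bimod_summable x) auto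
        finally show ?thesis using H(3)[of v] by (simp add: dist_real_def)
      next
        case False
        have "(\<Sum>l\<in>?Fv. (cmod (x l))\<^sup>2) \<le> fibre_norm G x v"
          unfolding fibre_norm_def using F by (intro finite_sum_le_infsum bimod_summable x) auto
        with False show ?thesis by (simp add: W_def)
      qed
    qed (use F \<eta> in auto)
    then show ?thesis using \<open>\<epsilon> > 0\<close> by (simp add: \<eta>_def)
  qed
  moreover have "finite ?F0" using \<open>finite W\<close> H(1) by blast
  moreover have "?F0 \<subseteq> arcs G" using H(2) by auto
  ultimately show "\<exists>F0. finite F0 \<and> F0 \<subseteq> arcs G \<and>
      (\<forall>F. finite F \<and> F \<subseteq> arcs G - F0 \<longrightarrow> norm (\<Sum>l\<in>F. x l *\<^sub>C S l) < \<epsilon>)"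
    by blast
qed

definition series :: "('a \<Rightarrow> complex) \<Rightarrow> 'b" where
  "series x = (\<Sum>\<^sub>\<infinity>l\<in>arcs G. x l *\<^sub>C S l)"

lemma series_linear: "linear_on_functions (bimod G) series"
  unfolding linear_on_functions_def series_def
  by (simp add: cscale_add_left infsum_add family_summable
      infsum_bounded_linear_summable[OF bounded_linear_cscale family_summable] flip: cscale_cscale)

lemma series_image:
  assumes "bounded_linear h" "x \<in> bimod G"
  shows "h (series x) = (\<Sum>\<^sub>\<infinity>l\<in>arcs G. h (x l *\<^sub>C S l))"
  unfolding series_def by (rule infsum_bounded_linear_summable[OF assms(1) family_summable[OF assms(2)], symmetric])

lemma series_fin_supp:
  assumes "x \<in> fin_supp G"
  shows "series x = (\<Sum>l | l \<in> arcs G \<and> x l \<noteq> 0. x l *\<^sub>C S l)"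
proof -
  have "series x = (\<Sum>\<^sub>\<infinity>l\<in>{l \<in> arcs G. x l \<noteq> 0}. x l *\<^sub>C S l)"
    unfolding series_def by (rule infsum_cong_neutral) auto
  moreover have "finite {l \<in> arcs G. x l \<noteq> 0}"
    using assms by (auto simp: fin_supp_def)
  ultimately show ?thesis by simp
qed

lemma series_point_mass: "l \<in> arcs G \<Longrightarrow> series (\<delta> l) = S l"
  unfolding series_def by (subst infsum_single[of l]) (auto simp: point_mass_def)

lemma cstar_S_mult_series:
  assumes "l \<in> arcs G" "x \<in> bimod G"
  shows "(S l)\<^sup>\<star> * series x = x l *\<^sub>C t (head G l)"
  unfolding series_image[OF bounded_linear_mult_right assms(2)]
  by (subst infsum_single[OF assms(1)]) (auto simp: cscale_mult_right S_inner assms(1))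

lemma series_inner:
  assumes x: "x \<in> bimod G" and y: "y \<in> bimod G"
  shows "(series x)\<^sup>\<star> * series y = (\<Sum>\<^sub>\<infinity>v\<in>verts G. inner_prod G x y v *\<^sub>C t v)"
proof -
  \<comment> \<open>Conjugate linear, but real linear and bounded, which suffices to move it inside
    the sum.\<close>
  let ?h = "\<lambda>b. b\<^sup>\<star> * series y"
  have h: "bounded_linear ?h"
    by (rule bounded_linear_compose[OF bounded_linear_mult_left bounded_linear_cstar])
  have eq: "?h (x l *\<^sub>C S l) = (cnj (x l) * y l) *\<^sub>C t (head G l)" if "l \<in> arcs G" for l
    using that y by (simp add: cstar_cscale cscale_mult_left cstar_S_mult_series cscale_cscale)
  have "(\<lambda>l. ?h (x l *\<^sub>C S l)) summable_on arcs G"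
    by (rule summable_on_bounded_linear[OF h family_summable[OF x]])
  then have summable: "(\<lambda>l. (cnj (x l) * y l) *\<^sub>C t (head G l)) summable_on arcs G"
    by (rule summable_on_cong[THEN iffD1, rotated]) (rule eq)
  \<comment> \<open>Each edge lies over exactly one vertex, its range; summing fibre by fibre yields
    the inner product as the coefficient of \<open>t v\<close>.\<close>
  have bij: "bij_betw snd (Sigma (verts G) (fibre G)) (arcs G)"
    by (rule bij_betwI[where g = "\<lambda>l. (head G l, l)"]) (auto simp: head_in_verts)
  let ?f = "\<lambda>p. (cnj (x (snd p)) * y (snd p)) *\<^sub>C t (head G (snd p))"
  have "?f summable_on Sigma (verts G) (fibre G)"
    using summable_on_reindex_bij_betw[OF bij, of "\<lambda>l. (cnj (x l) * y l) *\<^sub>C t (head G l)"] summable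
    by simp
  have "(series x)\<^sup>\<star> * series y = (\<Sum>\<^sub>\<infinity>l\<in>arcs G. (cnj (x l) * y l) *\<^sub>C t (head G l))"
    unfolding series_image[OF h x] by (rule infsum_cong) (rule eq)
  also have "\<dots> = infsum ?f (Sigma (verts G) (fibre G))"
    using infsum_reindex_bij_betw[OF bij, of "\<lambda>l. (cnj (x l) * y l) *\<^sub>C t (head G l)"] by simp
  also have "\<dots> = (\<Sum>\<^sub>\<infinity>v\<in>verts G. \<Sum>\<^sub>\<infinity>l\<in>fibre G v. ?f (v, l))"
    by (rule infsum_Sigma_banach[symmetric]) fact
  also have "\<dots> = (\<Sum>\<^sub>\<infinity>v\<in>verts G. inner_prod G x y v *\<^sub>C t v)"
  proof (rule infsum_cong)
    fix v
    have "(\<Sum>\<^sub>\<infinity>l\<in>fibre G v. ?f (v, l)) = (\<Sum>\<^sub>\<infinity>l\<in>fibre G v. (cnj (x l) * y l) *\<^sub>C t v)"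
      by (rule infsum_cong) auto
    also have "\<dots> = inner_prod G x y v *\<^sub>C t v"
      unfolding inner_prod_def
      by (rule infsum_bounded_linear_summable[OF bounded_linear_cscale_left inner_prod_summable[OF x y]])
    finally show "(\<Sum>\<^sub>\<infinity>l\<in>fibre G v. ?f (v, l)) = inner_prod G x y v *\<^sub>C t v" .
  qed
  finally show ?thesis .
qed

lemma S_mult_vertex_series:
  assumes "l \<in> arcs G" and a: "(\<lambda>v. a v *\<^sub>C t v) summable_on verts G"
  shows "S l * (\<Sum>\<^sub>\<infinity>v\<in>verts G. a v *\<^sub>C t v) = a (head G l) *\<^sub>C S l"
proof -
  have zero: "S l * t v = 0" if "v \<in> verts G" "v \<noteq> head G l" for v
    using that assms(1) S_head[OF assms(1)] t_orth[of "head G l" v] head_in_verts[of l]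
    by (metis mult.assoc mult_zero_right)
  have "S l * (\<Sum>\<^sub>\<infinity>v\<in>verts G. a v *\<^sub>C t v) = (\<Sum>\<^sub>\<infinity>v\<in>verts G. S l * (a v *\<^sub>C t v))"
    by (rule infsum_bounded_linear_summable[OF bounded_linear_mult_right a, symmetric])
  also have "\<dots> = S l * (a (head G l) *\<^sub>C t (head G l))"
    by (rule infsum_single) (use assms(1) zero in \<open>auto simp: cscale_mult_right\<close>)
  finally show ?thesis by (simp add: cscale_mult_right S_head assms(1))
qed

lemma vertex_series_mult_S:
  assumes "l \<in> arcs G" and a: "(\<lambda>v. a v *\<^sub>C t v) summable_on verts G"
  shows "(\<Sum>\<^sub>\<infinity>v\<in>verts G. a v *\<^sub>C t v) * S l = a (tail G l) *\<^sub>C S l"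
proof -
  have zero: "t v * S l = 0" if "v \<in> verts G" "v \<noteq> tail G l" for v
    using that assms(1) S_tail[OF assms(1)] t_orth[of v "tail G l"] tail_in_verts[of l]
    by (metis mult.assoc mult_zero_left)
  have "(\<Sum>\<^sub>\<infinity>v\<in>verts G. a v *\<^sub>C t v) * S l = (\<Sum>\<^sub>\<infinity>v\<in>verts G. a v *\<^sub>C t v * S l)"
    by (rule infsum_bounded_linear_summable[OF bounded_linear_mult_left a, symmetric])
  also have "\<dots> = a (tail G l) *\<^sub>C t (tail G l) * S l"
    by (rule infsum_single) (use assms(1) zero in \<open>auto simp: cscale_mult_left\<close>)
  finally show ?thesis by (simp add: cscale_mult_left S_tail assms(1))
qed

lemma partial_isometry_S: "l \<in> arcs G \<Longrightarrow> partial_isometry (S l)"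
  by (simp add: partial_isometry_def mult.assoc S_inner S_head)

text \<open>The sum of the range projections is a projection below \<open>t v\<close>, so the
  difference is a self-adjoint idempotent and serves as its own factor \<open>c\<close>.\<close>

lemma range_projections_le:
  assumes v: "v \<in> verts G" and F: "finite F" "F \<subseteq> out_arcs_at G v"
  shows "(\<Sum>l\<in>F. S l * (S l)\<^sup>\<star>) \<le>\<^sub>C t v"
proof -
  let ?q = "\<Sum>l\<in>F. S l * (S l)\<^sup>\<star>"
  have l: "l \<in> arcs G" "tail G l = v" if "l \<in> F" for l
    using that F(2) by (auto simp: out_arcs_at_def)
  have q_star: "?q\<^sup>\<star> = ?q"
    by (simp add: cstar_sum cstar_mult cstar_cstar)
  have t_star: "(t v)\<^sup>\<star> = t v" "t v * t v = t v"
    using t_proj[OF v] by (auto simp: projection_def)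
  have tq: "t v * ?q = ?q"
    unfolding sum_distrib_left
  proof (rule sum.cong[OF refl])
    fix m assume "m \<in> F"
    then show "t v * (S m * (S m)\<^sup>\<star>) = S m * (S m)\<^sup>\<star>"
      using S_tail[OF l(1)] l(2) by (simp flip: mult.assoc)
  qed
  have qt: "?q * t v = ?q"
    using arg_cong[OF tq, of cstar] by (simp add: cstar_mult q_star t_star)
  have "?q * ?q = (\<Sum>l\<in>F. \<Sum>m\<in>F. S l * ((S l)\<^sup>\<star> * S m) * (S m)\<^sup>\<star>)"
    by (simp add: sum_product mult.assoc)
  also have "\<dots> = (\<Sum>l\<in>F. \<Sum>m\<in>F. if l = m then S l * (S l)\<^sup>\<star> else 0)"
    by (intro sum.cong refl) (use l in \<open>auto simp: S_inner S_head\<close>)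
  also have "\<dots> = ?q" using F(1) by (simp add: sum.delta')
  finally have qq: "?q * ?q = ?q" .
  have "t v - ?q = (t v - ?q)\<^sup>\<star> * (t v - ?q)"
    by (simp only: cstar_diff q_star t_star left_diff_distrib right_diff_distrib tq qt qq) simp
  then show ?thesis unfolding cstar_le_def by blast
qed

end

section \<open>Product systems\<close>

context product_system
begin

lemma wf: "wf_digraph (E p)"
  using graphs[of p] by (simp add: countable_graph_def)

lemma ends_in_V: "l \<in> arcs (E p) \<Longrightarrow> head (E p) l \<in> V" "l \<in> arcs (E p) \<Longrightarrow> tail (E p) l \<in> V"
  using wf_digraph.head_in_verts[OF wf] wf_digraph.tail_in_verts[OF wf] common_verts by blast+

lemma degree_of_eq: "l \<in> arcs (E p) \<Longrightarrow> degree_of E l = p"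
  unfolding degree_of_def using disjoint_arcs by (intro the_equality) blast+

lemma src_eq: "l \<in> arcs (E p) \<Longrightarrow> src E l = tail (E p) l"
  and rng_eq: "l \<in> arcs (E p) \<Longrightarrow> rng E l = head (E p) l"
  and family_of_eq: "l \<in> arcs (E p) \<Longrightarrow> family_of E \<psi> l = \<psi> p (\<delta> l)"
  by (simp_all add: src_def rng_def family_of_def degree_of_eq)

lemma path_comp_eq: "l \<in> arcs (E p) \<Longrightarrow> m \<in> arcs (E q) \<Longrightarrow> path_comp E \<phi> l m = \<phi> p q (l, m)"
  by (simp add: path_comp_def degree_of_eq)

lemma V_arcs: "v \<in> V \<Longrightarrow> v \<in> arcs (E 1)" "v \<in> V \<Longrightarrow> head (E 1) v = v" "v \<in> V \<Longrightarrow> tail (E 1) v = v"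
  using identity_arcs identity_ends by auto

section \<open>Unique factorization of edges and products of bimodule elements\<close>

abbreviation composable :: "'p \<Rightarrow> 'p \<Rightarrow> ('a \<times> 'a) set" where
  "composable p q \<equiv> {(l, m). l \<in> arcs (E p) \<and> m \<in> arcs (E q) \<and> head (E p) l = tail (E q) m}"

lemma arcs_fibre_product: "arcs (E p \<times>\<^sub>G E q) = composable p q"
  by (simp add: fibre_product_def)

lemma bij_phi: "bij_betw (\<phi> p q) (composable p q) (arcs (E (p * q)))"
  using isos[of p q] by (simp add: vertex_fixing_iso_def arcs_fibre_product)

lemma composableE:
  assumes "n \<in> arcs (E (p * q))"
  obtains l m where "(l, m) \<in> composable p q" "n = \<phi> p q (l, m)"
  using assms unfolding bij_betw_imp_surj_on[OF bij_phi, symmetric] by blast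

lemma
  assumes "(l, m) \<in> composable p q"
  shows phi_in: "\<phi> p q (l, m) \<in> arcs (E (p * q))"
    and phi_tail: "tail (E (p * q)) (\<phi> p q (l, m)) = tail (E p) l"
    and phi_head: "head (E (p * q)) (\<phi> p q (l, m)) = head (E q) m"
proof -
  show "\<phi> p q (l, m) \<in> arcs (E (p * q))"
    using bij_phi[of p q] assms by (rule bij_betw_apply)
  have "(l, m) \<in> arcs (E p \<times>\<^sub>G E q)" using assms by (simp add: arcs_fibre_product)
  from bspec[OF conjunct2[OF conjunct2[OF isos[of p q, unfolded vertex_fixing_iso_def]]] this]
  show "tail (E (p * q)) (\<phi> p q (l, m)) = tail (E p) l"
    "head (E (p * q)) (\<phi> p q (l, m)) = head (E q) m"
    by (simp_all add: fibre_product_def)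
qed

text \<open>
  Composition with a vertex is not assumed to be trivial. It is an idempotent by associativity,
  and an injective one.
\<close>

lemma phi_left_unit:
  assumes l: "l \<in> arcs (E p)"
  shows "\<phi> 1 p (tail (E p) l, l) = l"
proof -
  let ?v = "tail (E p) l" and ?l = "\<phi> 1 p (tail (E p) l, l)"
  have v: "?v \<in> V" using ends_in_V[OF l] by blast
  have vv: "(?v, ?v) \<in> composable 1 1" and vl: "(?v, l) \<in> composable 1 p"
    using v l V_arcs by auto
  have l': "?l \<in> arcs (E p)" "tail (E p) ?l = ?v"
    using phi_in[OF vl] phi_tail[OF vl] V_arcs[OF v] by auto
  then have vl': "(?v, ?l) \<in> composable 1 p"
    using v V_arcs by auto
  have "\<phi> 1 1 (?v, ?v) \<in> V" "tail (E 1) (\<phi> 1 1 (?v, ?v)) = ?v"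
    using phi_in[OF vv] phi_tail[OF vv] V_arcs[OF v] identity_arcs by auto
  then have "\<phi> 1 1 (?v, ?v) = ?v" using V_arcs by metis
  then have "\<phi> 1 p (?v, ?l) = \<phi> 1 p (?v, l)"
    using assoc[of ?v ?v 1 1 l p] vv vl by (simp add: arcs_fibre_product)
  then have "(?v, ?l) = (?v, l)"
    using bij_phi[of 1 p] vl vl' by (auto simp only: bij_betw_def mult_1_left dest: inj_onD)
  then show ?thesis by simp
qed

lemma bimod_mult_phi:
  assumes "(l, m) \<in> composable p q"
  shows "bimod_mult E \<phi> p q x y (\<phi> p q (l, m)) = x l * y m"
  using the_inv_into_f_f[OF bij_betw_imp_inj_on[OF bij_phi] assms] phi_in[OF assms]
  by (simp add: bimod_mult_def arcs_fibre_product)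

lemma bimod_mult_zero: "n \<notin> arcs (E (p * q)) \<Longrightarrow> bimod_mult E \<phi> p q x y n = 0"
  by (simp add: bimod_mult_def)

lemma bimod_mult_point_mass:
  assumes "(l, m) \<in> composable p q"
  shows "bimod_mult E \<phi> p q (\<delta> l) (\<delta> m) = \<delta> (\<phi> p q (l, m))"
proof
  fix n
  show "bimod_mult E \<phi> p q (\<delta> l) (\<delta> m) n = \<delta> (\<phi> p q (l, m)) n"
  proof (cases "n \<in> arcs (E (p * q))")
    case True
    then obtain l' m' where c: "(l', m') \<in> composable p q" "n = \<phi> p q (l', m')"
      by (rule composableE)
    have "n = \<phi> p q (l, m) \<longleftrightarrow> (l', m') = (l, m)"
      unfolding c(2) by (rule inj_on_eq_iff[OF bij_betw_imp_inj_on[OF bij_phi] c(1) assms])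
    then show ?thesis
      unfolding c(2) bimod_mult_phi[OF c(1)] by (auto simp: point_mass_def)
  next
    case False
    then show ?thesis
      using phi_in[OF assms] by (auto simp: bimod_mult_zero point_mass_def)
  qed
qed

text \<open>The degree 1 fibre over a vertex is that vertex alone, so the fibre norm is the squared
  modulus. Through this equality \<open>\<psi> 1\<close> can act as \<open>\<pi>\<close>.\<close>

lemma bimod_identity: "bimod (E 1) = C0 V"
proof -
  interpret wf_digraph "E 1" by (rule wf)
  have fib: "fibre (E 1) v = (if v \<in> V then {v} else {})" for v
    using V_arcs identity_arcs by auto
  have "fibre_norm (E 1) x = (\<lambda>v. (cmod (x v))\<^sup>2)" if "\<forall>v. v \<notin> V \<longrightarrow> x v = 0" for x
    using that by (auto simp: fibre_norm_def fib)
  moreover have "((\<lambda>v. (cmod (x v))\<^sup>2) \<longlongrightarrow> 0) cofinite \<longleftrightarrow> (x \<longlongrightarrow> 0) cofinite"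
    for x :: "'a \<Rightarrow> complex"
  proof
    assume "((\<lambda>v. (cmod (x v))\<^sup>2) \<longlongrightarrow> 0) cofinite"
    from tendsto_real_sqrt[OF this] show "(x \<longlongrightarrow> 0) cofinite"
      by (simp add: tendsto_norm_zero_iff)
  next
    assume "(x \<longlongrightarrow> 0) cofinite"
    from tendsto_power[OF tendsto_norm_zero[OF this], of 2]
    show "((\<lambda>v. (cmod (x v))\<^sup>2) \<longlongrightarrow> 0) cofinite" by simp
  qed
  moreover have "(\<lambda>l. (cmod (x l))\<^sup>2) summable_on fibre (E 1) v" for x v
    unfolding fib by simp
  ultimately show ?thesis
    by (auto simp: bimod_iff C0_iff simp flip: identity_arcs)
qed

text \<open>An edge of degree \<open>p * q\<close> ending at \<open>v\<close> is a unique pair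
  \<open>(l, m)\<close> with \<open>m\<close> ending at \<open>v\<close> and \<open>l\<close> ending
  where \<open>m\<close> begins. Summing over \<open>l\<close> before \<open>m\<close> bounds the
  mass over \<open>v\<close> by the squared norm of \<open>x\<close> times the mass of
  \<open>y\<close> over \<open>v\<close>.\<close>

lemma bimod_mult_in_bimod:
  assumes x: "x \<in> bimod (E p)" and y: "y \<in> bimod (E q)"
  shows "bimod_mult E \<phi> p q x y \<in> bimod (E (p * q))"
proof -
  interpret P: wf_digraph "E p" by (rule wf)
  interpret Q: wf_digraph "E q" by (rule wf)
  interpret PQ: wf_digraph "E (p * q)" by (rule wf)
  let ?z = "bimod_mult E \<phi> p q x y"
  let ?M = "(bimod_norm (E p) x)\<^sup>2"
  have key: "(\<lambda>n. (cmod (?z n))\<^sup>2) summable_on fibre (E (p * q)) v \<and>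
      fibre_norm (E (p * q)) ?z v \<le> ?M * fibre_norm (E q) y v" for v
  proof -
    let ?A = "Sigma (fibre (E q) v) (\<lambda>m. fibre (E p) (tail (E q) m))"
    let ?h = "\<lambda>(m, l). \<phi> p q (l, m)"
    have bij: "bij_betw ?h ?A (fibre (E (p * q)) v)"
    proof (rule bij_betwI')
      fix c d assume "c \<in> ?A" "d \<in> ?A"
      moreover obtain m l m' l' where cd: "c = (m, l)" "d = (m', l')"
        by (cases c, cases d)
      ultimately have "(l, m) \<in> composable p q" "(l', m') \<in> composable p q"
        by auto
      then show "?h c = ?h d \<longleftrightarrow> c = d"
        using inj_on_eq_iff[OF bij_betw_imp_inj_on[OF bij_phi]] by (auto simp: cd)
    next
      fix c assume c: "c \<in> ?A"
      obtain m l where ml: "c = (m, l)" by (cases c)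
      then have "(l, m) \<in> composable p q" using c by simp
      then show "?h c \<in> fibre (E (p * q)) v"
        using c phi_in[of l m] phi_head[of l m] by (simp add: ml)
    next
      fix n assume n: "n \<in> fibre (E (p * q)) v"
      then have "n \<in> arcs (E (p * q))" by simp
      then obtain l m where lm: "(l, m) \<in> composable p q" "n = \<phi> p q (l, m)"
        by (rule composableE)
      have "head (E q) m = v"
        using n phi_head[OF lm(1)] lm(2) by simp
      then have "(m, l) \<in> ?A"
        using lm(1) by simp
      then show "\<exists>c\<in>?A. n = ?h c"
        by (rule rev_bexI) (simp add: lm(2))
    qed
    let ?f = "\<lambda>(m, l). (cmod (y m))\<^sup>2 * (cmod (x l))\<^sup>2"
    have f_eq: "(cmod (?z (?h c)))\<^sup>2 = ?f c" if "c \<in> ?A" for c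
      using that by (auto simp: bimod_mult_phi norm_mult power_mult_distrib)
    have inner: "((\<lambda>l. ?f (m, l)) has_sum (cmod (y m))\<^sup>2 * fibre_norm (E p) x (tail (E q) m))
        (fibre (E p) (tail (E q) m))" for m
      using P.bimod_summable[OF x] by (auto simp: fibre_norm_def intro!: has_sum_cmult_right)
    have dom: "(\<lambda>m. ?M * (cmod (y m))\<^sup>2) summable_on fibre (E q) v"
      by (intro summable_on_cmult_right Q.bimod_summable y)
    have le: "(cmod (y m))\<^sup>2 * fibre_norm (E p) x w \<le> ?M * (cmod (y m))\<^sup>2" for m w
      using P.fibre_norm_le_bimod_norm[OF x, of w]
      by (metis mult.commute mult_left_mono zero_le_power2)
    have outer: "(\<lambda>m. (cmod (y m))\<^sup>2 * fibre_norm (E p) x (tail (E q) m)) summable_on fibre (E q) v"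
      by (rule summable_on_comparison_test[OF dom]) (use le in auto)
    have sA: "?f summable_on ?A"
      by (rule summable_on_SigmaI[OF inner outer]) auto
    have "(\<lambda>n. (cmod (?z n))\<^sup>2) summable_on fibre (E (p * q)) v \<longleftrightarrow> ?f summable_on ?A"
      unfolding summable_on_reindex_bij_betw[OF bij, symmetric]
      by (rule summable_on_cong) (rule f_eq)
    moreover have "fibre_norm (E (p * q)) ?z v = infsum ?f ?A"
      unfolding fibre_norm_def infsum_reindex_bij_betw[OF bij, symmetric]
      by (rule infsum_cong) (rule f_eq)
    moreover have "infsum ?f ?A = (\<Sum>\<^sub>\<infinity>m\<in>fibre (E q) v. (cmod (y m))\<^sup>2 * fibre_norm (E p) x (tail (E q) m))"
      by (rule infsumI[OF has_sum_SigmaI[OF inner has_sum_infsum[OF outer] sA]])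
    moreover have "\<dots> \<le> (\<Sum>\<^sub>\<infinity>m\<in>fibre (E q) v. ?M * (cmod (y m))\<^sup>2)"
      by (rule infsum_mono[OF outer dom]) (rule le)
    moreover have "\<dots> = ?M * fibre_norm (E q) y v"
      by (simp add: fibre_norm_def infsum_cmult_right')
    ultimately show ?thesis using sA by simp
  qed
  have "((\<lambda>v. ?M * fibre_norm (E q) y v) \<longlongrightarrow> ?M * 0) cofinite"
    by (intro tendsto_intros Q.bimod_tendsto y)
  then have "((\<lambda>v. ?M * fibre_norm (E q) y v) \<longlongrightarrow> 0) cofinite" by simp
  then have "(fibre_norm (E (p * q)) ?z \<longlongrightarrow> 0) cofinite"
    by (rule Lim_null_comparison[rotated]) (simp add: key)
  with key show ?thesis
    by (auto simp: PQ.bimod_iff bimod_mult_zero)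
qed

subsection \<open>From representations to families\<close>

lemma toeplitz_bimod_of_rep:
  "toeplitz_rep E \<phi> \<psi> \<Longrightarrow> toeplitz_bimod (E p) (\<psi> p) (\<psi> 1)"
  unfolding toeplitz_rep_def by (intro toeplitz_bimod.intro wf toeplitz_bimod_axioms.intro) blast

lemma graph_family_of_rep:
  fixes \<psi> :: "'p \<Rightarrow> ('a \<Rightarrow> complex) \<Rightarrow> 'c::cstar_algebra"
  assumes rep: "toeplitz_rep E \<phi> \<psi>"
  shows "graph_family (E p) (family_of E \<psi>) (family_of E \<psi>)"
proof -
  interpret toeplitz_bimod "E p" "\<psi> p" "\<psi> 1" by (rule toeplitz_bimod_of_rep[OF rep])
  let ?s = "family_of E \<psi>"
  have s_V: "?s v = \<psi> 1 (\<delta> v)" if "v \<in> V" for v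
    using family_of_eq V_arcs(1)[OF that] by blast
  have hom: "\<psi> 1 (\<lambda>v. a v * b v) = \<psi> 1 a * \<psi> 1 b" "\<psi> 1 (\<lambda>v. cnj (a v)) = (\<psi> 1 a)\<^sup>\<star>"
    "\<psi> 1 (\<lambda>v. c * a v) = c *\<^sub>C \<psi> 1 a" if "a \<in> C0 V" "b \<in> C0 V" for a b c
    using pi_hom that by (auto simp: C0_hom_def linear_on_functions_def common_verts)
  have zero: "\<psi> 1 (\<lambda>v. 0) = 0"
    using hom(3)[OF C0_zero C0_zero, of 0] by simp
  show ?thesis
  proof (intro graph_family.intro wf graph_family_axioms.intro)
    fix v assume "v \<in> verts (E p)"
    then have v: "v \<in> V" by (simp add: common_verts)
    have "(\<lambda>w. cnj (\<delta> v w)) = \<delta> v" "(\<lambda>w. \<delta> v w * \<delta> v w) = \<delta> v"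
      by (auto simp: point_mass_def)
    then show "projection (?s v)"
      using hom(1,2)[OF point_mass_in_C0[OF v] point_mass_in_C0[OF v]]
      by (simp add: projection_def s_V[OF v])
    fix w assume "w \<in> verts (E p)" "v \<noteq> w"
    then have w: "w \<in> V" and "(\<lambda>u. \<delta> v u * \<delta> w u) = (\<lambda>u. 0)"
      by (auto simp: point_mass_def common_verts)
    then show "?s v * ?s w = 0"
      using hom(1)[OF point_mass_in_C0[OF v] point_mass_in_C0[OF w]] zero by (simp add: s_V v)
  next
    fix l assume l: "l \<in> arcs (E p)"
    note s_l = family_of_eq[OF l, of \<psi>]
    have "left_act (E p) (\<delta> (tail (E p) l)) (\<delta> l) = \<delta> l" "right_act (E p) (\<delta> l) (\<delta> (head (E p) l)) = \<delta> l"
      by (auto simp: left_act_def right_act_def point_mass_def)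
    then show "?s (tail (E p) l) * ?s l = ?s l" "?s l * ?s (head (E p) l) = ?s l"
      using psi_left[OF point_mass_in_bimod[OF l] point_mass_in_C0, of "tail (E p) l"]
        psi_right[OF point_mass_in_bimod[OF l] point_mass_in_C0, of "head (E p) l"] ends_in_V[OF l]
      by (simp_all add: s_l s_V common_verts)
    fix m assume m: "m \<in> arcs (E p)"
    have "inner_prod (E p) (\<delta> l) (\<delta> m) = (if l = m then \<delta> (head (E p) l) else (\<lambda>v. 0))"
      by (auto simp: inner_prod_point_mass[OF l] fun_eq_iff) (auto simp: point_mass_def)
    then show "(?s l)\<^sup>\<star> * ?s m = (if l = m then ?s (head (E p) l) else 0)"
      using psi_inner[OF point_mass_in_bimod[OF l] point_mass_in_bimod[OF m]]
        s_V[OF ends_in_V(1)[OF l]] zero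
      by (cases "l = m") (simp_all add: s_l family_of_eq[OF m])
  qed
qed

text \<open>The inequality for range projections comes from orthogonality of point masses of one
  degree, the product relation from the fact that point masses multiply to the point mass at the
  composed edge.\<close>

lemma toeplitz_family_of_rep:
  fixes \<psi> :: "'p \<Rightarrow> ('a \<Rightarrow> complex) \<Rightarrow> 'c::cstar_algebra"
  assumes rep: "toeplitz_rep E \<phi> \<psi>"
  shows "toeplitz_family V E \<phi> (family_of E \<psi>)"
proof -
  let ?s = "family_of E \<psi>"
  note fam = graph_family_of_rep[OF rep]
  have mult: "?s l * ?s m = ?s (path_comp E \<phi> l m)"
    if l: "l \<in> arcs (E p)" and m: "m \<in> arcs (E q)" and "rng E l = src E m" for l m p q
  proof -
    have lm: "(l, m) \<in> composable p q"
      using that rng_eq src_eq by auto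
    have "?s l * ?s m = \<psi> (p * q) (bimod_mult E \<phi> p q (\<delta> l) (\<delta> m))"
      using rep l m wf_digraph.point_mass_in_bimod[OF wf]
      by (simp add: family_of_eq toeplitz_rep_def)
    then show ?thesis
      using phi_in[OF lm] by (simp add: bimod_mult_point_mass[OF lm] path_comp_eq[OF l m] family_of_eq)
  qed
  show ?thesis
    unfolding toeplitz_family_def all_arcs_def
    using graph_family.partial_isometry_S[OF fam] graph_family.t_proj[OF fam, of _ 1]
      graph_family.t_orth[OF fam, of _ 1] graph_family.S_inner[OF fam] mult
      graph_family.range_projections_le[OF fam]
    by (auto simp: common_verts rng_eq)
qed

subsection \<open>From families to representations\<close>

text \<open>The relation to be gained is orthogonality of distinct edges of one degree. Different
  sources are separated by the vertex projections; a common source requires the order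
  relation.\<close>

lemma graph_family_of_family:
  fixes s :: "'a \<Rightarrow> 'c::cstar_algebra"
  assumes fam: "toeplitz_family V E \<phi> s"
  shows "graph_family (E p) s s"
proof -
  have all: "l \<in> all_arcs E" if "l \<in> arcs (E q)" for l q
    using that by (auto simp: all_arcs_def)
  have proj: "projection (s v)" if "v \<in> V" for v
    using fam that by (simp add: toeplitz_family_def)
  have orth: "s v * s w = 0" if "v \<in> V" "w \<in> V" "v \<noteq> w" for v w
    using fam that by (simp add: toeplitz_family_def)
  have init: "(s l)\<^sup>\<star> * s l = s (head (E p) l)" if "l \<in> arcs (E p)" for l
    using fam all[OF that] rng_eq[OF that] by (simp add: toeplitz_family_def)
  have pi: "s l * ((s l)\<^sup>\<star> * s l) = s l" if "l \<in> arcs (E p)" for l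
  proof -
    have "partial_isometry (s l)"
      using fam all[OF that] by (simp add: toeplitz_family_def)
    then show ?thesis by (simp add: partial_isometry_def mult.assoc)
  qed
  have tail: "s (tail (E p) l) * s l = s l" if l: "l \<in> arcs (E p)" for l
  proof -
    let ?v = "tail (E p) l"
    have v: "?v \<in> arcs (E 1)" "rng E ?v = src E l"
      using V_arcs ends_in_V[OF l] by (auto simp: rng_eq[OF V_arcs(1)] src_eq[OF l])
    then have "s ?v * s l = s (path_comp E \<phi> ?v l)"
      using fam all[OF l] all[OF v(1)] by (simp add: toeplitz_family_def)
    then show ?thesis
      by (simp add: path_comp_eq[OF v(1) l] phi_left_unit[OF l])
  qed
  have star_tail: "(s l)\<^sup>\<star> * s (tail (E p) l) = (s l)\<^sup>\<star>" if "l \<in> arcs (E p)" for l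
    using arg_cong[OF tail[OF that], of cstar] proj[OF ends_in_V(2)[OF that]]
    by (simp add: cstar_mult projection_def)
  have inner_0: "(s l)\<^sup>\<star> * s m = 0" if l: "l \<in> arcs (E p)" and m: "m \<in> arcs (E p)" and "l \<noteq> m" for l m
  proof (cases "tail (E p) l = tail (E p) m")
    case False
    have "(s l)\<^sup>\<star> * s m = (s l)\<^sup>\<star> * (s (tail (E p) l) * s (tail (E p) m)) * s m"
      using star_tail[OF l] tail[OF m] by (metis mult.assoc)
    then show ?thesis
      using orth[OF ends_in_V(2)[OF l] ends_in_V(2)[OF m] False] by simp
  next
    case True
    let ?v = "tail (E p) l"
    have v: "?v \<in> V" using ends_in_V[OF l] by blast
    \<comment> \<open>In degree 1 every edge is its own source, so two distinct edges never share
      one.\<close>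
    have "p \<noteq> 1"
      using True \<open>l \<noteq> m\<close> l m V_arcs identity_arcs by auto
    moreover have "finite {l, m} \<and> {l, m} \<subseteq> out_arcs_at (E p) ?v"
      using l m True by (auto simp: out_arcs_at_def)
    ultimately have "(\<Sum>k\<in>{l, m}. s k * (s k)\<^sup>\<star>) \<le>\<^sub>C s ?v"
      using fam v unfolding toeplitz_family_def by blast
    then have le: "s l * (s l)\<^sup>\<star> + s m * (s m)\<^sup>\<star> \<le>\<^sub>C s ?v"
      using \<open>l \<noteq> m\<close> by simp
    have range_proj: "projection (s k * (s k)\<^sup>\<star>)" if "k \<in> arcs (E p)" for k
    proof -
      have "s k * (s k)\<^sup>\<star> * (s k * (s k)\<^sup>\<star>) = s k * ((s k)\<^sup>\<star> * s k) * (s k)\<^sup>\<star>"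
        by (simp add: mult.assoc)
      then show ?thesis
        by (simp add: projection_def cstar_mult cstar_cstar pi[OF that])
    qed
    have "s l * (s l)\<^sup>\<star> * (s m * (s m)\<^sup>\<star>) = 0"
    proof (rule projection_orthogonal_if_sum_le[OF range_proj[OF l] range_proj[OF m] proj[OF v] _ _ le])
      show "s ?v * (s l * (s l)\<^sup>\<star>) = s l * (s l)\<^sup>\<star>" "s ?v * (s m * (s m)\<^sup>\<star>) = s m * (s m)\<^sup>\<star>"
        using tail[OF l] tail[OF m] True by (simp_all flip: mult.assoc)
    qed
    \<comment> \<open>Multiplying by \<open>(s l)\<^sup>\<star>\<close> and \<open>s m\<close>
      carries orthogonality from the range projections back to the partial isometries.\<close>
    then have "(s l)\<^sup>\<star> * (s l * (s l)\<^sup>\<star> * (s m * (s m)\<^sup>\<star>)) * s m = 0" by simp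
    moreover have "(s l)\<^sup>\<star> * (s l * (s l)\<^sup>\<star> * (s m * (s m)\<^sup>\<star>)) * s m =
        (s l * ((s l)\<^sup>\<star> * s l))\<^sup>\<star> * (s m * ((s m)\<^sup>\<star> * s m))"
      by (simp add: cstar_mult cstar_cstar mult.assoc)
    ultimately show ?thesis by (simp add: pi[OF l] pi[OF m])
  qed
  show ?thesis
    by (intro graph_family.intro wf graph_family_axioms.intro)
      (use proj orth init inner_0 tail pi in \<open>auto simp: common_verts\<close>)
qed

text \<open>Each map is defined on the whole bimodule by its unconditionally convergent series, so
  the relations are checked by moving bounded linear maps inside sums. The product relation is a
  Fubini argument over composable pairs.\<close>

lemma rep_of_family:
  fixes s :: "'a \<Rightarrow> 'c::cstar_algebra"
  assumes fam: "toeplitz_family V E \<phi> s"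
  defines "\<psi> \<equiv> \<lambda>p x. \<Sum>\<^sub>\<infinity>l\<in>arcs (E p). x l *\<^sub>C s l"
  shows "toeplitz_rep E \<phi> \<psi>"
    and "x \<in> fin_supp (E p) \<Longrightarrow> \<psi> p x = (\<Sum>l | l \<in> arcs (E p) \<and> x l \<noteq> 0. x l *\<^sub>C s l)"
    and "l \<in> all_arcs E \<Longrightarrow> s l = family_of E \<psi> l"
proof -
  have gf: "graph_family (E q) s s" for q
    by (rule graph_family_of_family[OF fam])
  have psi_series: "\<psi> q = graph_family.series (E q) s" for q
    by (rule ext) (simp add: \<psi>_def graph_family.series_def[OF gf])
  have psi_eq: "\<psi> q x = (\<Sum>\<^sub>\<infinity>l\<in>arcs (E q). x l *\<^sub>C s l)" for q x
    by (simp add: \<psi>_def)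
  have psi_1: "\<psi> 1 a = (\<Sum>\<^sub>\<infinity>v\<in>verts (E q). a v *\<^sub>C s v)" for a q
    by (simp add: \<psi>_def identity_arcs common_verts)
  have psi_1_summable: "(\<lambda>v. a v *\<^sub>C s v) summable_on verts (E q)" if "a \<in> C0 V" for a q
    using graph_family.family_summable[OF gf, of a 1] that
    by (simp add: bimod_identity identity_arcs common_verts)
  have s_mult_pi: "s l * \<psi> 1 a = a (head (E q) l) *\<^sub>C s l" "\<psi> 1 a * s l = a (tail (E q) l) *\<^sub>C s l"
    if "l \<in> arcs (E q)" "a \<in> C0 V" for l a q
    unfolding psi_1[of _ q]
    using graph_family.S_mult_vertex_series[OF gf that(1) psi_1_summable[OF that(2)]]
      graph_family.vertex_series_mult_S[OF gf that(1) psi_1_summable[OF that(2)]] by auto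
  have image: "h (\<psi> q x) = (\<Sum>\<^sub>\<infinity>l\<in>arcs (E q). h (x l *\<^sub>C s l))"
    if "bounded_linear h" "x \<in> bimod (E q)" for h :: "'c \<Rightarrow> 'c" and q x
    using graph_family.series_image[OF gf that] by (simp add: psi_series)
  have hom: "C0_hom V (\<psi> 1)"
    unfolding C0_hom_def
  proof (intro conjI ballI)
    show "linear_on_functions (C0 V) (\<psi> 1)"
      using graph_family.series_linear[OF gf, of 1] by (simp add: bimod_identity psi_series)
    fix a assume a: "a \<in> C0 V"
    then have a': "a \<in> bimod (E 1)" by (simp add: bimod_identity)
    show "\<psi> 1 (\<lambda>v. cnj (a v)) = (\<psi> 1 a)\<^sup>\<star>"
      unfolding image[OF bounded_linear_cstar a']
      using graph_family.t_proj[OF gf, of _ 1]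
      by (auto simp: \<psi>_def cstar_cscale projection_def common_verts identity_arcs intro!: infsum_cong)
    fix b assume b: "b \<in> C0 V"
    have s_mult_b: "s v * \<psi> 1 b = b v *\<^sub>C s v" if "v \<in> arcs (E 1)" for v
      using s_mult_pi(1)[OF that b] that V_arcs(2) identity_arcs by simp
    have "\<psi> 1 a * \<psi> 1 b = (\<Sum>\<^sub>\<infinity>v\<in>arcs (E 1). a v *\<^sub>C s v * \<psi> 1 b)"
      by (rule image[OF bounded_linear_mult_left a'])
    also have "\<dots> = \<psi> 1 (\<lambda>v. a v * b v)"
      unfolding psi_eq[of 1 "\<lambda>v. a v * b v"]
      by (intro infsum_cong) (simp add: cscale_mult_left s_mult_b cscale_cscale)
    finally show "\<psi> 1 (\<lambda>v. a v * b v) = \<psi> 1 a * \<psi> 1 b" ..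
  qed
  have "toeplitz_bimod_rep (E q) (\<psi> q) (\<psi> 1)" for q
    unfolding toeplitz_bimod_rep_def common_verts
  proof (intro conjI ballI)
    show "linear_on_functions (bimod (E q)) (\<psi> q)"
      using graph_family.series_linear[OF gf] by (simp add: psi_series)
    show "C0_hom V (\<psi> 1)" by (rule hom)
    fix y assume y: "y \<in> bimod (E q)"
    show "\<psi> q (right_act (E q) y a) = \<psi> q y * \<psi> 1 a" if "a \<in> C0 V" for a
      unfolding image[OF bounded_linear_mult_left y]
      unfolding psi_eq[of q "right_act (E q) y a"] using that
      by (intro infsum_cong) (simp add: right_act_def cscale_mult_left s_mult_pi cscale_cscale)
    show "\<psi> q (left_act (E q) a y) = \<psi> 1 a * \<psi> q y" if "a \<in> C0 V" for a
      unfolding image[OF bounded_linear_mult_right y]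
      unfolding psi_eq[of q "left_act (E q) a y"] using that
      by (intro infsum_cong) (simp add: left_act_def cscale_mult_right s_mult_pi cscale_cscale mult.commute)
  next
    fix x y assume "x \<in> bimod (E q)" "y \<in> bimod (E q)"
    then show "(\<psi> q x)\<^sup>\<star> * \<psi> q y = \<psi> 1 (inner_prod (E q) x y)"
      unfolding psi_1[of "inner_prod (E q) x y" q] psi_series[of q]
      by (rule graph_family.series_inner[OF gf])
  qed
  moreover have "\<psi> p x * \<psi> q y = \<psi> (p * q) (bimod_mult E \<phi> p q x y)"
    if x: "x \<in> bimod (E p)" and y: "y \<in> bimod (E q)" for p q x y
  proof -
    let ?z = "bimod_mult E \<phi> p q x y"
    let ?B = "\<lambda>l. {m \<in> arcs (E q). tail (E q) m = head (E p) l}"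
    let ?f = "\<lambda>(l, m). (x l * y m) *\<^sub>C s (\<phi> p q (l, m))"
    have comp_eq: "composable p q = Sigma (arcs (E p)) ?B" by auto
    have f_eq: "?z (\<phi> p q c) *\<^sub>C s (\<phi> p q c) = ?f c" if "c \<in> composable p q" for c
      using that bimod_mult_phi by (cases c) simp
    \<comment> \<open>The series need not converge absolutely, so summability of the double family
      is transported along \<open>\<phi> p q\<close> from the series of the product, an element of
      the bimodule of degree \<open>p * q\<close>.\<close>
    have "(\<lambda>n. ?z n *\<^sub>C s n) summable_on arcs (E (p * q))"
      by (rule graph_family.family_summable[OF gf bimod_mult_in_bimod[OF x y]])
    then have "(\<lambda>c. ?z (\<phi> p q c) *\<^sub>C s (\<phi> p q c)) summable_on composable p q"
      by (simp only: summable_on_reindex_bij_betw[OF bij_phi, of "\<lambda>n. ?z n *\<^sub>C s n"])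
    then have f_summable: "?f summable_on Sigma (arcs (E p)) ?B"
      unfolding comp_eq[symmetric] by (rule summable_on_cong[THEN iffD1, rotated]) (rule f_eq)
    have inner: "s l * \<psi> q y = (\<Sum>\<^sub>\<infinity>m\<in>?B l. y m *\<^sub>C s (\<phi> p q (l, m)))" if l: "l \<in> arcs (E p)" for l
    proof -
      have mult: "s l * s m = (if head (E p) l = tail (E q) m then s (\<phi> p q (l, m)) else 0)"
        if m: "m \<in> arcs (E q)" for m
      proof (cases "head (E p) l = tail (E q) m")
        case True
        then show ?thesis
          using fam l m path_comp_eq[OF l m] rng_eq[OF l] src_eq[OF m]
          by (auto simp: toeplitz_family_def all_arcs_def)
      next
        case False
        have "s l * s m = s l * (s (head (E p) l) * s (tail (E q) m)) * s m"
          using graph_family.S_head[OF gf l] graph_family.S_tail[OF gf m] by (metis mult.assoc)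
        then show ?thesis
          using False graph_family.t_orth[OF gf, of "head (E p) l" p "tail (E q) m"]
            ends_in_V[OF l] ends_in_V[OF m] by (simp add: common_verts)
      qed
      have "s l * \<psi> q y = (\<Sum>\<^sub>\<infinity>m\<in>arcs (E q). s l * (y m *\<^sub>C s m))"
        by (rule image[OF bounded_linear_mult_right y])
      also have "\<dots> = (\<Sum>\<^sub>\<infinity>m\<in>?B l. y m *\<^sub>C s (\<phi> p q (l, m)))"
        by (rule infsum_cong_neutral) (auto simp: cscale_mult_right mult)
      finally show ?thesis .
    qed
    have "\<psi> p x * \<psi> q y = (\<Sum>\<^sub>\<infinity>l\<in>arcs (E p). x l *\<^sub>C s l * \<psi> q y)"
      by (rule image[OF bounded_linear_mult_left x])
    also have "\<dots> = (\<Sum>\<^sub>\<infinity>l\<in>arcs (E p). \<Sum>\<^sub>\<infinity>m\<in>?B l. ?f (l, m))"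
    proof (rule infsum_cong)
      fix l assume l: "l \<in> arcs (E p)"
      show "x l *\<^sub>C s l * \<psi> q y = (\<Sum>\<^sub>\<infinity>m\<in>?B l. ?f (l, m))"
      \<comment> \<open>For nonzero \<open>x l\<close> scaling is invertible, so the two inner
        families are summable together and the scalar may leave the sum.\<close>
      proof (cases "x l = 0")
        case False
        have "(\<Sum>\<^sub>\<infinity>m\<in>?B l. x l *\<^sub>C (y m *\<^sub>C s (\<phi> p q (l, m)))) =
            x l *\<^sub>C (\<Sum>\<^sub>\<infinity>m\<in>?B l. y m *\<^sub>C s (\<phi> p q (l, m)))"
        proof (rule infsum_bounded_linear_strong[OF _ bounded_linear_cscale])
          show "(\<lambda>m. x l *\<^sub>C y m *\<^sub>C s (\<phi> p q (l, m))) summable_on ?B l \<longleftrightarrow>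
              (\<lambda>m. y m *\<^sub>C s (\<phi> p q (l, m))) summable_on ?B l"
            by (rule summable_on_bounded_linear_iff[OF bounded_linear_cscale
                  bounded_linear_cscale[of "inverse (x l)"]])
              (use False in \<open>simp add: cscale_cscale\<close>)
        qed
        then show ?thesis
          by (simp add: cscale_mult_left inner[OF l] cscale_cscale)
      qed simp
    qed
    also have "\<dots> = infsum ?f (Sigma (arcs (E p)) ?B)"
      by (rule infsum_Sigma_banach[OF f_summable])
    also have "\<dots> = (\<Sum>\<^sub>\<infinity>c\<in>composable p q. ?z (\<phi> p q c) *\<^sub>C s (\<phi> p q c))"
      unfolding comp_eq[symmetric] by (rule infsum_cong) (rule f_eq[symmetric])
    also have "\<dots> = \<psi> (p * q) ?z"
      unfolding \<psi>_def by (rule infsum_reindex_bij_betw[OF bij_phi, of "\<lambda>n. ?z n *\<^sub>C s n"])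
    finally show ?thesis .
  qed
  ultimately show "toeplitz_rep E \<phi> \<psi>"
    by (simp add: toeplitz_rep_def)
  show "\<psi> p x = (\<Sum>l | l \<in> arcs (E p) \<and> x l \<noteq> 0. x l *\<^sub>C s l)" if "x \<in> fin_supp (E p)"
    unfolding psi_series by (rule graph_family.series_fin_supp[OF gf that])
  show "s l = family_of E \<psi> l" if "l \<in> all_arcs E"
    using that by (auto simp: all_arcs_def family_of_eq psi_series graph_family.series_point_mass[OF gf])
qed

subsection \<open>Cuntz-Pimsner covariance\<close>

text \<open>Agreement of \<open>s\<close> with the representation is asked on edges only, so the
  equivalence covers a given Toeplitz family, whose values off the edges are arbitrary, as well as
  the family of a given representation.\<close>

lemma cp_covariant_iff:
  fixes \<psi> :: "'p \<Rightarrow> ('a \<Rightarrow> complex) \<Rightarrow> 'c::cstar_algebra"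
  assumes rep: "toeplitz_rep E \<phi> \<psi>"
    and s: "\<And>l. l \<in> all_arcs E \<Longrightarrow> s l = family_of E \<psi> l"
  shows "cp_covariant E \<psi> \<longleftrightarrow> cuntz_pimsner_relations V E s"
proof -
  have s_eq: "s l = \<psi> p (\<delta> l)" if "l \<in> arcs (E p)" for l p
    using s[of l] that family_of_eq[OF that, of \<psi>] by (auto simp: all_arcs_def)
  have "(\<Sum>l\<in>out_arcs_at (E p) v. \<psi> p (\<delta> l) * (\<psi> p (\<delta> l))\<^sup>\<star>) = (\<Sum>l\<in>out_arcs_at (E p) v. s l * (s l)\<^sup>\<star>)"
    for p v
    by (rule sum.cong) (auto simp: out_arcs_at_def s_eq)
  moreover have "\<psi> 1 (\<delta> v) = s v" if "v \<in> V" for v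
    using s_eq[OF V_arcs(1)[OF that]] by simp
  ultimately show ?thesis
    unfolding cp_covariant_def cuntz_pimsner_relations_def
      toeplitz_bimod.cp_covariant_bimod_iff[OF toeplitz_bimod_of_rep[OF rep]]
    by (simp add: common_verts)
qed

end

theorem theorem4p2:
  fixes V :: "'a set"
    and E :: "'p::{monoid_mult,countable} \<Rightarrow> ('a,'a) pre_digraph"
    and \<phi> :: "'p \<Rightarrow> 'p \<Rightarrow> 'a \<times> 'a \<Rightarrow> 'a"
  assumes "product_system V E \<phi>"
  shows "(\<forall>\<psi> :: 'p \<Rightarrow> ('a \<Rightarrow> complex) \<Rightarrow> 'b::cstar_algebra. toeplitz_rep E \<phi> \<psi> \<longrightarrow>
            toeplitz_family V E \<phi> (family_of E \<psi>) \<and>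
            (cp_covariant E \<psi> \<longleftrightarrow> cuntz_pimsner_relations V E (family_of E \<psi>))) \<and>
         (\<forall>s :: 'a \<Rightarrow> 'b. toeplitz_family V E \<phi> s \<longrightarrow>
            (\<exists>\<psi>. toeplitz_rep E \<phi> \<psi> \<and>
                 (\<forall>p. \<forall>x\<in>fin_supp (E p). \<psi> p x = (\<Sum>l | l \<in> arcs (E p) \<and> x l \<noteq> 0. x l *\<^sub>C s l)) \<and>
                 (\<forall>l\<in>all_arcs E. s l = family_of E \<psi> l) \<and>
                 (cp_covariant E \<psi> \<longleftrightarrow> cuntz_pimsner_relations V E s)))"
proof -
  interpret product_system V E \<phi> by fact
  show ?thesis
  proof (intro conjI allI impI)
    fix \<psi> :: "'p \<Rightarrow> ('a \<Rightarrow> complex) \<Rightarrow> 'b" assume rep: "toeplitz_rep E \<phi> \<psi>"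
    show "toeplitz_family V E \<phi> (family_of E \<psi>)"
      by (rule toeplitz_family_of_rep[OF rep])
    show "cp_covariant E \<psi> \<longleftrightarrow> cuntz_pimsner_relations V E (family_of E \<psi>)"
      by (rule cp_covariant_iff[OF rep refl])
  next
    fix s :: "'a \<Rightarrow> 'b" assume fam: "toeplitz_family V E \<phi> s"
    note rep = rep_of_family[OF fam]
    from rep cp_covariant_iff[OF rep(1,3)]
    show "\<exists>\<psi>. toeplitz_rep E \<phi> \<psi> \<and>
        (\<forall>p. \<forall>x\<in>fin_supp (E p). \<psi> p x = (\<Sum>l | l \<in> arcs (E p) \<and> x l \<noteq> 0. x l *\<^sub>C s l)) \<and>
        (\<forall>l\<in>all_arcs E. s l = family_of E \<psi> l) \<and>
        (cp_covariant E \<psi> \<longleftrightarrow> cuntz_pimsner_relations V E s)"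
      by (intro exI[of _ "\<lambda>p x. \<Sum>\<^sub>\<infinity>l\<in>arcs (E p). x l *\<^sub>C s l"] conjI allI ballI)
  qed
qed

end
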